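(* Let $G$ be a compact Lie group, $\phi: G \to \mathbb{Z}_2$ a surjective homomorphism (so that $(G,\phi)$ is a magnetic group), $G_0=\ker\phi$, and $\iota: G_0\to G$ the inclusion. Let $X$ be a compact $G$-space. Let $\widetilde{G}$ be a central extension of $G$ by the group $\mathbb{Z}_2$, and let $\widetilde{G}_0$ be the kernel of the induced homomorphism $\widetilde{G}\to G\xrightarrow{\phi}\mathbb{Z}_2$. Then restriction from $G$ to $G_0$ induces a homomorphism of twisted K-theories $$\iota^*:{}^{\widetilde{G}}\mathcal{K}_G^*(X)\to{}^{\widetilde{G}_0}K_{G_0}^*(X)^{\mathbb{Z}_2},$$ where $\mathbb{Z}_2$ acts by the conjugation involution $F\mapsto a_0^*\overline{F}$ (for any $a_0\in\widetilde{G}\setminus\widetilde{G}_0$), and it becomes an isomorphism rationally: $$\iota^*\otimes\mathbb{Q}:{}^{\widetilde{G}}\mathcal{K}_G^*(X)\otimes\mathbb{Q}\xrightarrow{\ \cong\ }{}^{\widetilde{G}_0}K_{G_0}^*(X)^{\mathbb{Z}_2}\otimes\mathbb{Q}.$$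
   Context: **Magnetic groups.** A magnetic group is a group $G$ together with a surjective homomorphism $\phi:G\to\mathbb{Z}_2$; write $G_0=\ker\phi$. Here $G$ is a compact Lie group, and $\phi$ is continuous. The extension $1\to A\to\widetilde{G}\to G\to1$ with $A=\mathbb{Z}_2=\{\pm1\}\subset\mathbb{S}^1$ makes $\widetilde{G}$ a magnetic group via $\widetilde{G}\to G\to\mathbb{Z}_2$, with kernel $\widetilde{G}_0$, which is a central extension of $G_0$ by $A$. Any $G$-space is a $\widetilde{G}$-space via $\widetilde{G}\to G$. **Magnetic bundles and K-groups.** For a magnetic group $L$ (with kernel $L_0$) and a compact $L$-space $X$, a magnetic $L$-equivariant vector bundle over $X$ is a complex vector bundle $p:E\to X$ with an $L$-action on $E$ making $p$ equivariant, such that elements of $L_0$ act complex linearly on the fibers and elements of $L\setminus L_0$ act complex anti-linearly. $\mathcal{K}_L(X)$ is the Grothendieck group of isomorphism classes of such bundles under direct sum (formal differences $E_0-E_1$, with $E_0-E_1\sim E_0'-E_1'$ iff $E_0\oplus E_1'\oplus F\cong E_0'\oplus E_1\oplus F$ for some magnetic bundle $F$). $K_{L_0}(X)$ is the usual (Segal) complex $L_0$-equivariant K-theory. For a base point $x_0$ fixed by the group, the reduced group is $\widetilde{\mathcal{K}}_L(X)=\ker(\mathcal{K}_L(X)\to\mathcal{K}_L(\{x_0\}))$. For a pair $(X,Y)$, $\mathcal{K}_L(X,Y)=\widetilde{\mathcal{K}}_L(X/Y)$, with $X/\emptyset=X_+$ ($X$ with a disjoint base point). For $q\ge0$, $$\mathcal{K}_L^{-q}(X,Y)=\mathcal{K}_L(X\times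 B^q,\ X\times S^{q-1}\cup Y\times B^q),$$ with trivial action on the unit ball $B^q$ and its boundary sphere $S^{q-1}$, and $\mathcal{K}_L^{-q}(X)=\mathcal{K}_L^{-q}(X,\emptyset)$. The same definitions are used for $K_{L_0}^{-q}$. Positive degrees are defined by the 8-periodicity $\mathcal{K}_L^{-q-8}\cong\mathcal{K}_L^{-q}$ (similarly, compatibly with the restriction map $\iota^*$ and the involution $F\mapsto a_0^*\overline{F}$, for $K_{L_0}^*$). The superscript $*$ denotes an arbitrary integer degree. **Twisted K-theory.** A $\widetilde{G}$-twisted magnetic $G$-vector bundle over $X$ is a magnetic $\widetilde{G}$-equivariant vector bundle $E\to X$ on whose fibers $A=\{\pm1\}$ acts by scalar multiplication. ${}^{\widetilde{G}}\mathcal{K}_G(X)$ is the subgroup of $\mathcal{K}_{\widetilde{G}}(X)$ generated by the $\widetilde{G}$-twisted magnetic $G$-vector bundles. The higher groups ${}^{\widetilde{G}}\mathcal{K}_G^{-q}(X)\subset\mathcal{K}_{\widetilde{G}}^{-q}(X)$ are defined using twisted bundles by the formula ${}^{\widetilde{G}}\mathcal{K}_G^{-q}(X)={}^{\widetilde{G}}\mathcal{K}_G(X\times B^q,\ X\times S^{q-1})$ for $q\ge0$, where for a pair $(X,Y)$ of compact $G$-spaces ${}^{\widetilde{G}}\mathcal{K}_G(X,Y)=\ker\left({}^{\widetilde{G}}\mathcal{K}_G(X/Y)\to{}^{\widetilde{G}}\mathcal{K}_G(\{x_0\})\right)$ with $x_0$ the base point of $X/Y$ (and $X/\emptyset=X_+$).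 Likewise, ${}^{\widetilde{G}_0}K_{G_0}(X)$ is the subgroup of $K_{\widetilde{G}_0}(X)$ generated by complex $\widetilde{G}_0$-equivariant bundles on whose fibers $A$ acts by scalar multiplication, and similarly for ${}^{\widetilde{G}_0}K_{G_0}^{-q}(X)\subset K_{\widetilde{G}_0}^{-q}(X)$. **Restriction.** $\iota^*$ is induced by regarding a $\widetilde{G}$-twisted magnetic bundle as a complex $\widetilde{G}_0$-equivariant bundle. **The $\mathbb{Z}_2$-action.** Choose $a_0\in\widetilde{G}\setminus\widetilde{G}_0$. For a complex $\widetilde{G}_0$-equivariant bundle $p:F\to X$, let $\overline{F}$ be the complex conjugate bundle (the element corresponding to $s\in F$ is written $\overline{s}$) and put $$a_0^*\overline{F}=\{(\overline{s},x)\in\overline{F}\times X\mid p(s)=a_0x\},$$ a bundle over $X$ by projection to the second coordinate, with complex structure $\lambda\cdot(\overline{s},x)=(\overline{\bar\lambda s},x)$ for $\lambda\in\mathbb{C}$ and $\widetilde{G}_0$-action $g\cdot(\overline{s},x)=(\overline{a_0ga_0^{-1}s},gx)$. The assignment $F\mapsto a_0^*\overline{F}$ induces an involution of $K_{\widetilde{G}_0}(X)$, independent of the choice of $a_0$, and, by the same construction over the (pairs of) spaces defining $K_{\widetilde{G}_0}^{-q}(X)$, an involution of $K_{\widetilde{G}_0}^*(X)$. Since $A=\mathbb{Z}_2$, it preserves the subgroup ${}^{\widetilde{G}_0}K_{G_0}^*(X)$, and ${}^{\widetilde{G}_0}K_{G_0}^*(X)^{\mathbb{Z}_2}$ is the subgroup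 of its elements fixed by the involution. *)

theory Defs
  imports
    "HOL-Analysis.Analysis"
    "HOL-Algebra.Coset"
    "HOL-Algebra.Generated_Groups"
    "HOL-Algebra.Elementary_Groups"
    "HOL-Algebra.Free_Abelian_Groups"
begin

section \<open>Compact Lie groups and magnetic groups\<close>

text \<open>
  A group together with a topology on its carrier and a degree \<open>Gdeg\<close> with values in
  \<open>integer_mod_group 2\<close>. The degree is the homomorphism \<open>\<phi>\<close> of a magnetic group; elements of
  degree 0 are meant to act complex linearly, the others anti-linearly.
\<close>

record 'g graded_group = "'g monoid" +
  Gtop :: "'g topology"
  Gdeg :: "'g \<Rightarrow> int"

definition topological_group :: "'g graded_group \<Rightarrow> bool" where
  "topological_group G \<longleftrightarrow>
     group G \<and> topspace (Gtop G) = carrier G \<and>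
     continuous_map (prod_topology (Gtop G) (Gtop G)) (Gtop G) (\<lambda>(x, y). x \<otimes>\<^bsub>G\<^esub> y) \<and>
     continuous_map (Gtop G) (Gtop G) (\<lambda>x. inv\<^bsub>G\<^esub> x)"

text \<open>
  Smoothness on an open subset of \<open>Euclidean_space n\<close>, whose points are the functions
  \<open>nat \<Rightarrow> real\<close> vanishing from \<open>n\<close> on: all iterated partial derivatives exist and are continuous.
\<close>

fun Ck_on :: "nat \<Rightarrow> nat \<Rightarrow> (nat \<Rightarrow> real) set \<Rightarrow> ((nat \<Rightarrow> real) \<Rightarrow> real) \<Rightarrow> bool" where
  "Ck_on 0 n U f \<longleftrightarrow> continuous_map (subtopology (Euclidean_space n) U) euclideanreal f"
| "Ck_on (Suc k) n U f \<longleftrightarrow>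
     continuous_map (subtopology (Euclidean_space n) U) euclideanreal f \<and>
     (\<forall>i<n. \<exists>g. (\<forall>x\<in>U. ((\<lambda>t. f (x(i := t))) has_real_derivative g x) (at (x i))) \<and>
                 Ck_on k n U g)"

definition smooth_map_on ::
    "nat \<Rightarrow> nat \<Rightarrow> (nat \<Rightarrow> real) set \<Rightarrow> ((nat \<Rightarrow> real) \<Rightarrow> (nat \<Rightarrow> real)) \<Rightarrow> bool" where
  "smooth_map_on n m U f \<longleftrightarrow> (\<forall>j<m. \<forall>k. Ck_on k n U (\<lambda>x. f x j))"

definition smooth_atlas ::
    "'a topology \<Rightarrow> nat \<Rightarrow> ('a set \<times> ('a \<Rightarrow> nat \<Rightarrow> real)) set \<Rightarrow> bool" where
  "smooth_atlas T n \<A> \<longleftrightarrow>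
     (\<Union>(U, c)\<in>\<A>. U) = topspace T \<and>
     (\<forall>(U, c)\<in>\<A>. openin T U \<and> openin (Euclidean_space n) (c ` U) \<and>
        homeomorphic_map (subtopology T U) (subtopology (Euclidean_space n) (c ` U)) c) \<and>
     (\<forall>(U, c)\<in>\<A>. \<forall>(V, d)\<in>\<A>.
        smooth_map_on n n (c ` (U \<inter> V)) (\<lambda>x. d (inv_into U c x)))"

text \<open>The two projections of \<open>Euclidean_space (n + n)\<close>, viewed as a product, onto its factors.\<close>

definition lower_half :: "nat \<Rightarrow> (nat \<Rightarrow> real) \<Rightarrow> nat \<Rightarrow> real" where
  "lower_half n z = (\<lambda>i. if i < n then z i else 0)"

definition upper_half :: "nat \<Rightarrow> (nat \<Rightarrow> real) \<Rightarrow> nat \<Rightarrow> real" where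
  "upper_half n z = (\<lambda>i. if i < n then z (n + i) else 0)"

definition smooth_group_atlas ::
    "'g graded_group \<Rightarrow> nat \<Rightarrow> ('g set \<times> ('g \<Rightarrow> nat \<Rightarrow> real)) set \<Rightarrow> bool" where
  "smooth_group_atlas G n \<A> \<longleftrightarrow>
     smooth_atlas (Gtop G) n \<A> \<and>
     (\<forall>(U, c)\<in>\<A>. \<forall>(V, d)\<in>\<A>. \<forall>(W, e)\<in>\<A>.
        smooth_map_on (n + n) n
          {z \<in> topspace (Euclidean_space (n + n)).
             lower_half n z \<in> c ` U \<and> upper_half n z \<in> d ` V \<and>
             inv_into U c (lower_half n z) \<otimes>\<^bsub>G\<^esub> inv_into V d (upper_half n z) \<in> W}
          (\<lambda>z. e (inv_into U c (lower_half n z) \<otimes>\<^bsub>G\<^esub> inv_into V d (upper_half n z)))) \<and>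
     (\<forall>(U, c)\<in>\<A>. \<forall>(V, d)\<in>\<A>.
        smooth_map_on n n
          {x \<in> c ` U. inv\<^bsub>G\<^esub> (inv_into U c x) \<in> V}
          (\<lambda>x. d (inv\<^bsub>G\<^esub> (inv_into U c x))))"

definition compact_Lie_group :: "'g graded_group \<Rightarrow> bool" where
  "compact_Lie_group G \<longleftrightarrow>
     topological_group G \<and> compact_space (Gtop G) \<and> Hausdorff_space (Gtop G) \<and>
     second_countable (Gtop G) \<and> (\<exists>n \<A>. smooth_group_atlas G n \<A>)"

definition magnetic_group :: "'g graded_group \<Rightarrow> bool" where
  "magnetic_group G \<longleftrightarrow>
     topological_group G \<and>
     Gdeg G \<in> epi G (integer_mod_group 2) \<and>
     continuous_map (Gtop G) (discrete_topology (carrier (integer_mod_group 2))) (Gdeg G)"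

definition kernel_group :: "'g graded_group \<Rightarrow> 'g graded_group" where
  "kernel_group G =
     (let N = kernel G (integer_mod_group 2) (Gdeg G)
      in G\<lparr>carrier := N, Gtop := subtopology (Gtop G) N\<rparr>)"

definition sign_group :: "complex monoid" where
  "sign_group = \<lparr>carrier = {1, -1}, monoid.mult = (*), one = 1\<rparr>"

text \<open>
  A central extension \<open>1 \<rightarrow> {1,-1} \<rightarrow> Gt \<rightarrow> G \<rightarrow> 1\<close> of compact Lie groups with maps \<open>inc\<close> and \<open>\<pi>\<close>,
  where \<open>Gt\<close> is graded by the composite of \<open>\<pi>\<close> with the degree of \<open>G\<close>.
\<close>

definition magnetic_central_extension ::
    "(complex \<Rightarrow> 'h) \<Rightarrow> 'h graded_group \<Rightarrow> ('h \<Rightarrow> 'g) \<Rightarrow> 'g graded_group \<Rightarrow> bool" where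
  "magnetic_central_extension inc Gt \<pi> G \<longleftrightarrow>
     compact_Lie_group Gt \<and>
     inc \<in> mon sign_group Gt \<and>
     \<pi> \<in> epi Gt G \<and> continuous_map (Gtop Gt) (Gtop G) \<pi> \<and>
     inc ` carrier sign_group = kernel Gt G \<pi> \<and>
     (\<forall>a\<in>carrier sign_group. \<forall>h\<in>carrier Gt. inc a \<otimes>\<^bsub>Gt\<^esub> h = h \<otimes>\<^bsub>Gt\<^esub> inc a) \<and>
     (\<forall>h\<in>carrier Gt. Gdeg Gt h = Gdeg G (\<pi> h))"


section \<open>Spaces with group action\<close>

record ('g, 'x) gspace =
  Xtop :: "'x topology"
  Xact :: "'g \<Rightarrow> 'x \<Rightarrow> 'x"

definition G_space :: "'g graded_group \<Rightarrow> ('g, 'x) gspace \<Rightarrow> bool" where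
  "G_space G X \<longleftrightarrow>
     continuous_map (prod_topology (Gtop G) (Xtop X)) (Xtop X) (\<lambda>(g, x). Xact X g x) \<and>
     (\<forall>x\<in>topspace (Xtop X). Xact X \<one>\<^bsub>G\<^esub> x = x) \<and>
     (\<forall>g\<in>carrier G. \<forall>h\<in>carrier G. \<forall>x\<in>topspace (Xtop X).
        Xact X (g \<otimes>\<^bsub>G\<^esub> h) x = Xact X g (Xact X h x))"

definition act_via :: "('h \<Rightarrow> 'g) \<Rightarrow> ('g, 'x) gspace \<Rightarrow> ('h, 'x) gspace" where
  "act_via \<pi> X = \<lparr>Xtop = Xtop X, Xact = (\<lambda>h. Xact X (\<pi> h))\<rparr>"

definition subspace_of :: "('g, 'x) gspace \<Rightarrow> 'x set \<Rightarrow> ('g, 'x) gspace" where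
  "subspace_of X S = X\<lparr>Xtop := subtopology (Xtop X) S\<rparr>"

text \<open>
  The pointed space \<open>X/Y\<close> for \<open>Y \<subseteq> X\<close>, with base point \<open>None\<close>. For \<open>Y = {}\<close> the base point is
  isolated, so that \<open>X/{}\<close> is \<open>X\<close> with a disjoint base point.
\<close>

definition collapse :: "'x set \<Rightarrow> 'x \<Rightarrow> 'x option" where
  "collapse Y x = (if x \<in> Y then None else Some x)"

definition collapse_topology :: "'x topology \<Rightarrow> 'x set \<Rightarrow> 'x option topology" where
  "collapse_topology T Y =
     topology (\<lambda>U. U \<subseteq> insert None (Some ` (topspace T - Y)) \<and>
                    openin T {x \<in> topspace T. collapse Y x \<in> U})"

lemma openin_collapse_topology:
  "openin (collapse_topology T Y) U \<longleftrightarrow>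
     U \<subseteq> insert None (Some ` (topspace T - Y)) \<and> openin T {x \<in> topspace T. collapse Y x \<in> U}"
proof -
  have "istopology (\<lambda>U. U \<subseteq> insert None (Some ` (topspace T - Y)) \<and>
                    openin T {x \<in> topspace T. collapse Y x \<in> U})"
    unfolding istopology_def
  proof (intro conjI allI impI)
    fix S U
    assume S: "S \<subseteq> insert None (Some ` (topspace T - Y)) \<and>
                 openin T {x \<in> topspace T. collapse Y x \<in> S}"
      and U: "U \<subseteq> insert None (Some ` (topspace T - Y)) \<and>
                 openin T {x \<in> topspace T. collapse Y x \<in> U}"
    show "S \<inter> U \<subseteq> insert None (Some ` (topspace T - Y))"
      using S by blast
    have "{x \<in> topspace T. collapse Y x \<in> S \<inter> U} =
          {x \<in> topspace T. collapse Y x \<in> S} \<inter> {x \<in> topspace T. collapse Y x \<in> U}"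
      by blast
    then show "openin T {x \<in> topspace T. collapse Y x \<in> S \<inter> U}"
      using S U by (metis (no_types, lifting) openin_Int)
  next
    fix \<K>
    assume K: "\<forall>K\<in>\<K>. K \<subseteq> insert None (Some ` (topspace T - Y)) \<and>
                 openin T {x \<in> topspace T. collapse Y x \<in> K}"
    show "\<Union>\<K> \<subseteq> insert None (Some ` (topspace T - Y))"
      using K by blast
    have "{x \<in> topspace T. collapse Y x \<in> \<Union>\<K>} =
          \<Union>((\<lambda>K. {x \<in> topspace T. collapse Y x \<in> K}) ` \<K>)"
      by blast
    then show "openin T {x \<in> topspace T. collapse Y x \<in> \<Union>\<K>}"
      using K by (metis (no_types, lifting) imageE openin_Union)
  qed
  then show ?thesis
    unfolding collapse_topology_def by (simp add: topology_inverse')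
qed

definition quotient_space :: "('g, 'x) gspace \<Rightarrow> 'x set \<Rightarrow> ('g, 'x option) gspace" where
  "quotient_space X Y =
     \<lparr>Xtop = collapse_topology (Xtop X) Y, Xact = (\<lambda>g. map_option (Xact X g))\<rparr>"

definition unit_ball :: "nat \<Rightarrow> (nat \<Rightarrow> real) set" where
  "unit_ball q = {v \<in> topspace (Euclidean_space q). (\<Sum>i<q. (v i)\<^sup>2) \<le> 1}"

definition unit_sphere :: "nat \<Rightarrow> (nat \<Rightarrow> real) set" where
  "unit_sphere q = {v \<in> topspace (Euclidean_space q). (\<Sum>i<q. (v i)\<^sup>2) = 1}"

definition times_ball :: "('g, 'x) gspace \<Rightarrow> nat \<Rightarrow> ('g, 'x \<times> (nat \<Rightarrow> real)) gspace" where
  "times_ball X q =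
     \<lparr>Xtop = prod_topology (Xtop X) (subtopology (Euclidean_space q) (unit_ball q)),
      Xact = (\<lambda>g (x, v). (Xact X g x, v))\<rparr>"

text \<open>The pointed space \<open>(X \<times> B\<^sup>q) / (X \<times> S\<^sup>q\<^sup>-\<^sup>1)\<close>; for \<open>q = 0\<close> the sphere is empty.\<close>

definition ball_mod_sphere ::
    "('g, 'x) gspace \<Rightarrow> nat \<Rightarrow> ('g, ('x \<times> (nat \<Rightarrow> real)) option) gspace" where
  "ball_mod_sphere X q = quotient_space (times_ball X q) (topspace (Xtop X) \<times> unit_sphere q)"


section \<open>Magnetic equivariant vector bundles\<close>

record ('g, 'x, 'e) gbundle =
  Etop :: "'e topology"
  Eproj :: "'e \<Rightarrow> 'x"
  Eadd :: "'e \<Rightarrow> 'e \<Rightarrow> 'e"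
  Escale :: "complex \<Rightarrow> 'e \<Rightarrow> 'e"
  Eact :: "'g \<Rightarrow> 'e \<Rightarrow> 'e"

definition complex_space :: "nat \<Rightarrow> (nat \<Rightarrow> complex) topology" where
  "complex_space n = product_topology (\<lambda>i. euclidean) {..<n}"

text \<open>
  That the fibres are complex vector spaces is part of local triviality: the trivializations
  \<open>h\<close> transport the vector space operations of \<open>complex_space n\<close> to \<open>Eadd\<close> and \<open>Escale\<close>.
  The rank \<open>n\<close> may vary with the point.
\<close>

definition complex_vector_bundle :: "'x topology \<Rightarrow> ('g, 'x, 'e) gbundle \<Rightarrow> bool" where
  "complex_vector_bundle T E \<longleftrightarrow>
     continuous_map (Etop E) T (Eproj E) \<and>
     (\<forall>x\<in>topspace T. \<exists>U n h. openin T U \<and> x \<in> U \<and>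
        homeomorphic_map (prod_topology (subtopology T U) (complex_space n))
          (subtopology (Etop E) {e \<in> topspace (Etop E). Eproj E e \<in> U}) h \<and>
        (\<forall>y\<in>U. \<forall>v\<in>topspace (complex_space n).
           Eproj E (h (y, v)) = y \<and>
           (\<forall>w\<in>topspace (complex_space n).
              Eadd E (h (y, v)) (h (y, w)) = h (y, \<lambda>i\<in>{..<n}. v i + w i)) \<and>
           (\<forall>c. Escale E c (h (y, v)) = h (y, \<lambda>i\<in>{..<n}. c * v i))))"

text \<open>
  For a magnetic group \<open>L\<close> these are the magnetic \<open>L\<close>-equivariant bundles. If the degree vanishes
  on \<open>L\<close>, as it does on \<open>kernel_group G\<close>, these are the usual complex \<open>L\<close>-equivariant bundles.
\<close>

definition magnetic_bundle ::
    "'g graded_group \<Rightarrow> ('g, 'x) gspace \<Rightarrow> ('g, 'x, 'e) gbundle \<Rightarrow> bool" where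
  "magnetic_bundle L X E \<longleftrightarrow>
     complex_vector_bundle (Xtop X) E \<and>
     continuous_map (prod_topology (Gtop L) (Etop E)) (Etop E) (\<lambda>(g, e). Eact E g e) \<and>
     (\<forall>e\<in>topspace (Etop E). Eact E \<one>\<^bsub>L\<^esub> e = e) \<and>
     (\<forall>g\<in>carrier L. \<forall>h\<in>carrier L. \<forall>e\<in>topspace (Etop E).
        Eact E (g \<otimes>\<^bsub>L\<^esub> h) e = Eact E g (Eact E h e)) \<and>
     (\<forall>g\<in>carrier L. \<forall>e\<in>topspace (Etop E).
        Eproj E (Eact E g e) = Xact X g (Eproj E e) \<and>
        (\<forall>e'\<in>topspace (Etop E). Eproj E e' = Eproj E e \<longrightarrow>
           Eact E g (Eadd E e e') = Eadd E (Eact E g e) (Eact E g e')) \<and>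
        (\<forall>c. Eact E g (Escale E c e) =
               Escale E (if Gdeg L g = 0 then c else cnj c) (Eact E g e)))"

definition bundle_iso ::
    "'g graded_group \<Rightarrow> ('g, 'x, 'e) gbundle \<Rightarrow> ('g, 'x, 'f) gbundle \<Rightarrow> bool" where
  "bundle_iso L E F \<longleftrightarrow>
     (\<exists>h. homeomorphic_map (Etop E) (Etop F) h \<and>
       (\<forall>e\<in>topspace (Etop E).
          Eproj F (h e) = Eproj E e \<and>
          (\<forall>e'\<in>topspace (Etop E). Eproj E e' = Eproj E e \<longrightarrow>
             h (Eadd E e e') = Eadd F (h e) (h e')) \<and>
          (\<forall>c. h (Escale E c e) = Escale F c (h e)) \<and>
          (\<forall>g\<in>carrier L. h (Eact E g e) = Eact F g (h e))))"

definition bundle_sum ::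
    "('g, 'x, 'e) gbundle \<Rightarrow> ('g, 'x, 'f) gbundle \<Rightarrow> ('g, 'x, 'e \<times> 'f) gbundle"
    (infixl \<open>\<oplus>\<^sub>B\<close> 65) where
  "E \<oplus>\<^sub>B F =
     \<lparr>Etop = subtopology (prod_topology (Etop E) (Etop F)) {(e, f). Eproj E e = Eproj F f},
      Eproj = (\<lambda>(e, f). Eproj E e),
      Eadd = (\<lambda>(e, f) (e', f'). (Eadd E e e', Eadd F f f')),
      Escale = (\<lambda>c (e, f). (Escale E c e, Escale F c f)),
      Eact = (\<lambda>g (e, f). (Eact E g e, Eact F g f))\<rparr>"

definition zero_bundle :: "('g, 'x) gspace \<Rightarrow> ('g, 'x, 'x) gbundle" where
  "zero_bundle X =
     \<lparr>Etop = Xtop X, Eproj = (\<lambda>x. x), Eadd = (\<lambda>x y. x), Escale = (\<lambda>c x. x), Eact = Xact X\<rparr>"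

definition pullback_bundle ::
    "('g, 'y) gspace \<Rightarrow> ('y \<Rightarrow> 'x) \<Rightarrow> ('g, 'x, 'e) gbundle \<Rightarrow> ('g, 'y, 'y \<times> 'e) gbundle" where
  "pullback_bundle Y f E =
     \<lparr>Etop = subtopology (prod_topology (Xtop Y) (Etop E)) {(y, e). f y = Eproj E e},
      Eproj = fst,
      Eadd = (\<lambda>(y, e) (y', e'). (y, Eadd E e e')),
      Escale = (\<lambda>c (y, e). (y, Escale E c e)),
      Eact = (\<lambda>g (y, e). (Xact Y g y, Eact E g e))\<rparr>"

text \<open>The bundle \<open>a\<^sub>0\<^sup>*\<close> of the complex conjugate of \<open>F\<close>.\<close>

definition conjugate_bundle ::
    "'g graded_group \<Rightarrow> 'g \<Rightarrow> ('g, 'x) gspace \<Rightarrow> ('g, 'x, 'e) gbundle \<Rightarrow> ('g, 'x, 'e \<times> 'x) gbundle" where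
  "conjugate_bundle L a\<^sub>0 X F =
     \<lparr>Etop = subtopology (prod_topology (Etop F) (Xtop X)) {(s, x). Eproj F s = Xact X a\<^sub>0 x},
      Eproj = snd,
      Eadd = (\<lambda>(s, x) (s', x'). (Eadd F s s', x)),
      Escale = (\<lambda>c (s, x). (Escale F (cnj c) s, x)),
      Eact = (\<lambda>g (s, x). (Eact F (a\<^sub>0 \<otimes>\<^bsub>L\<^esub> g \<otimes>\<^bsub>L\<^esub> inv\<^bsub>L\<^esub> a\<^sub>0) s, Xact X g x))\<rparr>"

definition twisted_bundle ::
    "(complex \<Rightarrow> 'g) \<Rightarrow> 'g graded_group \<Rightarrow> ('g, 'x) gspace \<Rightarrow> ('g, 'x, 'e) gbundle \<Rightarrow> bool" where
  "twisted_bundle inc L X E \<longleftrightarrow>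
     magnetic_bundle L X E \<and>
     (\<forall>a\<in>carrier sign_group. \<forall>e\<in>topspace (Etop E). Eact E (inc a) e = Escale E a e)"


section \<open>K-groups\<close>

text \<open>
  Every vector bundle over a base of type \<open>'x\<close> is isomorphic to one whose total space is a
  topological space on a subset of the following type: after choosing a basis in each fibre,
  use the pairs of a point of the base and a coordinate list.
  Hence these bundles represent all isomorphism classes.
\<close>

type_synonym ('g, 'x) std_bundle = "('g, 'x, 'x \<times> complex list) gbundle"

type_synonym ('g, 'x) K_element = "(('g, 'x) std_bundle \<times> ('g, 'x) std_bundle) set"

text \<open>
  The class of \<open>E\<^sub>0 - E\<^sub>1\<close>, as the set of all formal differences of standard bundles equivalent to
  it. The total spaces of \<open>E\<^sub>0\<close> and \<open>E\<^sub>1\<close> may be of any type.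
\<close>

definition K_class ::
    "'g graded_group \<Rightarrow> ('g, 'x) gspace \<Rightarrow> ('g, 'x, 'e) gbundle \<Rightarrow> ('g, 'x, 'f) gbundle \<Rightarrow>
     ('g, 'x) K_element" where
  "K_class L X E\<^sub>0 E\<^sub>1 =
     {(P\<^sub>0, P\<^sub>1). magnetic_bundle L X P\<^sub>0 \<and> magnetic_bundle L X P\<^sub>1 \<and>
        (\<exists>F :: ('g, 'x) std_bundle. magnetic_bundle L X F \<and>
           bundle_iso L (E\<^sub>0 \<oplus>\<^sub>B P\<^sub>1 \<oplus>\<^sub>B F) (P\<^sub>0 \<oplus>\<^sub>B E\<^sub>1 \<oplus>\<^sub>B F))}"

definition K_group :: "'g graded_group \<Rightarrow> ('g, 'x) gspace \<Rightarrow> ('g, 'x) K_element monoid" where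
  "K_group L X =
     \<lparr>carrier = {K_class L X E\<^sub>0 E\<^sub>1 | (E\<^sub>0 :: ('g, 'x) std_bundle) (E\<^sub>1 :: ('g, 'x) std_bundle).
                   magnetic_bundle L X E\<^sub>0 \<and> magnetic_bundle L X E\<^sub>1},
      monoid.mult = (\<lambda>a b. \<Union>(E\<^sub>0, E\<^sub>1)\<in>a. \<Union>(F\<^sub>0, F\<^sub>1)\<in>b. K_class L X (E\<^sub>0 \<oplus>\<^sub>B F\<^sub>0) (E\<^sub>1 \<oplus>\<^sub>B F\<^sub>1)),
      one = K_class L X (zero_bundle X) (zero_bundle X)\<rparr>"

text \<open>
  The map on K-classes induced by an additive construction \<open>t\<close> on bundles. The classes in the
  union all coincide when \<open>t\<close> preserves direct sums and isomorphisms.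
\<close>

definition K_induced ::
    "'h graded_group \<Rightarrow> ('h, 'y) gspace \<Rightarrow> (('g, 'x) std_bundle \<Rightarrow> ('h, 'y, 'e) gbundle) \<Rightarrow>
     ('g, 'x) K_element \<Rightarrow> ('h, 'y) K_element" where
  "K_induced M Y t a = (\<Union>(E\<^sub>0, E\<^sub>1)\<in>a. K_class M Y (t E\<^sub>0) (t E\<^sub>1))"

definition twisted_K_group ::
    "(complex \<Rightarrow> 'g) \<Rightarrow> 'g graded_group \<Rightarrow> ('g, 'x) gspace \<Rightarrow> ('g, 'x) K_element monoid" where
  "twisted_K_group inc L X =
     subgroup_generated (K_group L X)
       {K_class L X E (zero_bundle X) | E :: ('g, 'x) std_bundle. twisted_bundle inc L X E}"

definition reduced_twisted_K_group ::
    "(complex \<Rightarrow> 'g) \<Rightarrow> 'g graded_group \<Rightarrow> ('g, 'x) gspace \<Rightarrow> 'x \<Rightarrow> ('g, 'x) K_element monoid" where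
  "reduced_twisted_K_group inc L X x\<^sub>0 =
     (let P = subspace_of X {x\<^sub>0} in
      (twisted_K_group inc L X)
        \<lparr>carrier := kernel (twisted_K_group inc L X) (twisted_K_group inc L P)
           (K_induced L P (pullback_bundle P (\<lambda>x. x)))\<rparr>)"

text \<open>
  K-groups in integer degree \<open>n\<close> are those in degree \<open>-q\<close> for \<open>q = degree_shift n\<close>. For \<open>n > 0\<close>
  this is the representative of \<open>n\<close> modulo 8 in \<open>{-7..0}\<close>, as prescribed by 8-periodicity.
\<close>

definition degree_shift :: "int \<Rightarrow> nat" where
  "degree_shift n = (if n \<le> 0 then nat (- n) else nat ((- n) mod 8))"

definition twisted_K ::
    "(complex \<Rightarrow> 'g) \<Rightarrow> 'g graded_group \<Rightarrow> int \<Rightarrow> ('g, 'x) gspace \<Rightarrow>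
     ('g, ('x \<times> (nat \<Rightarrow> real)) option) K_element monoid" where
  "twisted_K inc L n X = reduced_twisted_K_group inc L (ball_mod_sphere X (degree_shift n)) None"

definition restriction ::
    "'g graded_group \<Rightarrow> int \<Rightarrow> ('g, 'x) gspace \<Rightarrow>
     ('g, ('x \<times> (nat \<Rightarrow> real)) option) K_element \<Rightarrow>
     ('g, ('x \<times> (nat \<Rightarrow> real)) option) K_element" where
  "restriction L n X =
     K_induced (kernel_group L) (ball_mod_sphere X (degree_shift n)) (\<lambda>E. E)"

definition conjugation ::
    "'g graded_group \<Rightarrow> 'g \<Rightarrow> int \<Rightarrow> ('g, 'x) gspace \<Rightarrow>
     ('g, ('x \<times> (nat \<Rightarrow> real)) option) K_element \<Rightarrow>
     ('g, ('x \<times> (nat \<Rightarrow> real)) option) K_element" where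
  "conjugation L a\<^sub>0 n X =
     (let Z = ball_mod_sphere X (degree_shift n)
      in K_induced (kernel_group L) Z (conjugate_bundle L a\<^sub>0 Z))"

definition fixed_subgroup :: "'a monoid \<Rightarrow> ('a \<Rightarrow> 'a) \<Rightarrow> 'a monoid" where
  "fixed_subgroup A \<tau> = A\<lparr>carrier := {a \<in> carrier A. \<tau> a = a}\<rparr>"


section \<open>Tensor products of abelian groups\<close>

definition tensor_relations ::
    "'a monoid \<Rightarrow> 'b monoid \<Rightarrow> (('a \<times> 'b) \<Rightarrow>\<^sub>0 int) set" where
  "tensor_relations A B =
     {frag_of (a \<otimes>\<^bsub>A\<^esub> a', b) - frag_of (a, b) - frag_of (a', b) | a a' b.
        a \<in> carrier A \<and> a' \<in> carrier A \<and> b \<in> carrier B} \<union>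
     {frag_of (a, b \<otimes>\<^bsub>B\<^esub> b') - frag_of (a, b) - frag_of (a, b') | a b b'.
        a \<in> carrier A \<and> b \<in> carrier B \<and> b' \<in> carrier B}"

definition tensor_kernel ::
    "'a monoid \<Rightarrow> 'b monoid \<Rightarrow> (('a \<times> 'b) \<Rightarrow>\<^sub>0 int) set" where
  "tensor_kernel A B =
     generate (free_Abelian_group (carrier A \<times> carrier B)) (tensor_relations A B)"

definition tensor_product ::
    "'a monoid \<Rightarrow> 'b monoid \<Rightarrow> (('a \<times> 'b) \<Rightarrow>\<^sub>0 int) set monoid" (infixl \<open>\<otimes>\<^sub>\<int>\<close> 70) where
  "A \<otimes>\<^sub>\<int> B = free_Abelian_group (carrier A \<times> carrier B) Mod tensor_kernel A B"

text \<open>The map \<open>f \<otimes> B\<close> from \<open>A \<otimes>\<^sub>\<int> B\<close> to \<open>A' \<otimes>\<^sub>\<int> B\<close> for a homomorphism \<open>f\<close> from \<open>A\<close> to \<open>A'\<close>.\<close>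

definition tensor_map ::
    "'c monoid \<Rightarrow> 'b monoid \<Rightarrow> ('a \<Rightarrow> 'c) \<Rightarrow>
     (('a \<times> 'b) \<Rightarrow>\<^sub>0 int) set \<Rightarrow> (('c \<times> 'b) \<Rightarrow>\<^sub>0 int) set" where
  "tensor_map A' B f C =
     (\<Union>u\<in>C. tensor_kernel A' B
        #>\<^bsub>free_Abelian_group (carrier A' \<times> carrier B)\<^esub>
        frag_extend (\<lambda>(a, b). frag_of (f a, b)) u)"

definition rat_group :: "rat monoid" where
  "rat_group = \<lparr>carrier = UNIV, monoid.mult = (+), one = 0\<rparr>"

end

theory Submission
  imports Defs
begin

text \<open>
  Restriction is inverted, up to the factor 2, by a transfer. Let \<open>L\<close> be the extended magnetic group,
  \<open>L\<^sub>0\<close> its subgroup of even elements and \<open>\<tau>\<close> the conjugation involution. For a complex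
  \<open>L\<^sub>0\<close>-bundle \<open>F\<close>, the sum of \<open>F\<close> and its conjugate \<open>a\<^sub>0\<^sup>*F\<close> carries an action of all of \<open>L\<close> in
  which the odd elements exchange the summands; this is the bundle induced from \<open>F\<close>
  (\<open>transfer_bundle\<close>, \<open>magnetic_bundle_transfer\<close>).

  Restricting the transfer of \<open>F\<close> gives \<open>F\<close> plus its conjugate (\<open>transfer_bundle_iso_restriction\<close>).
  So restriction after transfer is \<open>1 + \<tau>\<close>, which is 2 on the elements fixed by \<open>\<tau>\<close>. If \<open>E\<close> is a
  magnetic bundle, then \<open>a\<^sub>0\<inverse>\<close> identifies its conjugate with \<open>E\<close> itself
  (\<open>conjugate_bundle_iso_self\<close>). Hence classes of restricted bundles are fixed by \<open>\<tau>\<close>, and the transfer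
  of the restriction of \<open>E\<close> is \<open>E\<close> plus \<open>E\<close> with the odd elements also exchanging the summands. As they
  act antilinearly, the change of coordinates \<open>(s, u) \<mapsto> (s + u, \<i> (s - u))\<close> removes the exchange
  (\<open>transfer_bundle_iso_double\<close>), and transfer after restriction is 2 as well. Two homomorphisms
  whose composites are both multiplication by 2 become isomorphisms over the rationals
  (\<open>tensor_map_rat_iso\<close>).

  It remains to let these constructions act on K-groups. Isomorphism classes of bundles form
  a commutative monoid under direct sum, the K-group is its group of formal differences
  (\<open>comm_group_K_group\<close>), and a construction on bundles that respects sums induces a homomorphism
  (locale \<open>additive_construction\<close>). Restriction and transfer preserve twisted bundles and
  commute with the restriction to a fixed base point, so they act on the reduced twisted groups
  (\<open>restriction_rational_iso\<close>). The degree does not matter: the quotient of \<open>X \<times> B\<^sup>q\<close> by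
  \<open>X \<times> S\<^sup>q\<^sup>-\<^sup>1\<close> is again a space with an action that fixes the base point
  (\<open>G_space_ball_mod_sphere\<close>).
\<close>

section \<open>Tensor products with the rationals\<close>

abbreviation pair_group :: "'a monoid \<Rightarrow> 'b monoid \<Rightarrow> (('a \<times> 'b) \<Rightarrow>\<^sub>0 int) monoid" where
  "pair_group A B \<equiv> free_Abelian_group (carrier A \<times> carrier B)"

abbreviation tensor_lift ::
    "('a \<Rightarrow> 'c) \<Rightarrow> ('b \<Rightarrow> 'd) \<Rightarrow> (('a \<times> 'b) \<Rightarrow>\<^sub>0 int) \<Rightarrow> (('c \<times> 'd) \<Rightarrow>\<^sub>0 int)" where
  "tensor_lift f r \<equiv> frag_extend (\<lambda>(a, b). frag_of (f a, r b))"

text \<open>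
  The constant \<^const>\<open>tensor_map\<close> varies only the first factor. Inverting it requires the map that
  moreover halves the rational factor, hence this version with a map on both factors.
\<close>

definition bitensor_map ::
    "'c monoid \<Rightarrow> 'd monoid \<Rightarrow> ('a \<Rightarrow> 'c) \<Rightarrow> ('b \<Rightarrow> 'd) \<Rightarrow>
     (('a \<times> 'b) \<Rightarrow>\<^sub>0 int) set \<Rightarrow> (('c \<times> 'd) \<Rightarrow>\<^sub>0 int) set" where
  "bitensor_map C D f r U = (\<Union>u\<in>U. tensor_kernel C D #>\<^bsub>pair_group C D\<^esub> tensor_lift f r u)"

lemma tensor_map_eq_bitensor_map: "tensor_map C D f = bitensor_map C D f (\<lambda>b. b)"
  by (simp add: fun_eq_iff tensor_map_def bitensor_map_def)

lemma keys_tensor_lift: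
  assumes "f \<in> carrier A \<rightarrow> carrier C" "r \<in> carrier B \<rightarrow> carrier D"
    and "Poly_Mapping.keys u \<subseteq> carrier A \<times> carrier B"
  shows "Poly_Mapping.keys (tensor_lift f r u) \<subseteq> carrier C \<times> carrier D"
proof -
  have "Poly_Mapping.keys (tensor_lift f r u) \<subseteq>
      (\<Union>x\<in>Poly_Mapping.keys u. Poly_Mapping.keys (case x of (a, b) \<Rightarrow> frag_of (f a, r b)))"
    by (rule keys_frag_extend)
  also have "\<dots> \<subseteq> carrier C \<times> carrier D"
    using assms by (fastforce simp: keys_frag_of)
  finally show ?thesis .
qed

lemma tensor_relations_subset:
  assumes "group A" "group B"
  shows "tensor_relations A B \<subseteq> carrier (pair_group A B)"
proof -
  interpret A: group A by fact
  interpret B: group B by fact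
  have "Poly_Mapping.keys (frag_of p - frag_of q - frag_of s) \<subseteq> carrier A \<times> carrier B"
    if "p \<in> carrier A \<times> carrier B" "q \<in> carrier A \<times> carrier B" "s \<in> carrier A \<times> carrier B" for p q s
    using that keys_diff[of "frag_of p - frag_of q" "frag_of s"] keys_diff[of "frag_of p" "frag_of q"]
    by (auto simp: keys_frag_of)
  then show ?thesis
    unfolding tensor_relations_def by auto
qed

lemma subgroup_tensor_kernel:
  assumes "group A" "group B"
  shows "subgroup (tensor_kernel A B) (pair_group A B)"
  unfolding tensor_kernel_def
  by (intro group.generate_is_subgroup tensor_relations_subset assms) auto

lemma tensor_kernel_closed:
  assumes "group A" "group B"
  shows "u \<in> tensor_kernel A B \<Longrightarrow> Poly_Mapping.keys u \<subseteq> carrier A \<times> carrier B"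
    and "0 \<in> tensor_kernel A B"
    and "u \<in> tensor_kernel A B \<Longrightarrow> v \<in> tensor_kernel A B \<Longrightarrow> u + v \<in> tensor_kernel A B"
    and "u \<in> tensor_kernel A B \<Longrightarrow> - u \<in> tensor_kernel A B"
    and "u \<in> tensor_kernel A B \<Longrightarrow> v \<in> tensor_kernel A B \<Longrightarrow> u - v \<in> tensor_kernel A B"
proof -
  interpret K: subgroup "tensor_kernel A B" "pair_group A B"
    by (rule subgroup_tensor_kernel[OF assms])
  show 1: "u \<in> tensor_kernel A B \<Longrightarrow> Poly_Mapping.keys u \<subseteq> carrier A \<times> carrier B" for u
    by (drule K.mem_carrier) simp
  show "0 \<in> tensor_kernel A B"
    using K.one_closed by simp
  show 2: "u \<in> tensor_kernel A B \<Longrightarrow> v \<in> tensor_kernel A B \<Longrightarrow> u + v \<in> tensor_kernel A B" for u v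
    using K.m_closed by simp
  show 3: "u \<in> tensor_kernel A B \<Longrightarrow> - u \<in> tensor_kernel A B" for u
    using K.m_inv_closed[of u] 1[of u] by simp
  show "u \<in> tensor_kernel A B \<Longrightarrow> v \<in> tensor_kernel A B \<Longrightarrow> u - v \<in> tensor_kernel A B"
    using 2[of u "- v"] 3[of v] by simp
qed

lemma tensor_coset_eq_iff:
  assumes "group A" "group B"
  shows "tensor_kernel A B #>\<^bsub>pair_group A B\<^esub> u = tensor_kernel A B #>\<^bsub>pair_group A B\<^esub> v \<longleftrightarrow>
         u - v \<in> tensor_kernel A B"
proof
  assume "tensor_kernel A B #>\<^bsub>pair_group A B\<^esub> u = tensor_kernel A B #>\<^bsub>pair_group A B\<^esub> v"
  moreover have "u \<in> tensor_kernel A B #>\<^bsub>pair_group A B\<^esub> u"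
    using tensor_kernel_closed(2)[OF assms] by (force simp: r_coset_def)
  ultimately show "u - v \<in> tensor_kernel A B"
    by (auto simp: r_coset_def)
next
  have sub: "tensor_kernel A B #>\<^bsub>pair_group A B\<^esub> u \<subseteq> tensor_kernel A B #>\<^bsub>pair_group A B\<^esub> v"
    if "u - v \<in> tensor_kernel A B" for u v
  proof
    fix x assume "x \<in> tensor_kernel A B #>\<^bsub>pair_group A B\<^esub> u"
    then obtain k where k: "k \<in> tensor_kernel A B" "x = k + u"
      by (auto simp: r_coset_def)
    then have "x = (k + (u - v)) + v" "k + (u - v) \<in> tensor_kernel A B"
      using tensor_kernel_closed(3)[OF assms k(1) that] by simp_all
    then have "\<exists>k'\<in>tensor_kernel A B. x = k' + v"
      by blast
    then show "x \<in> tensor_kernel A B #>\<^bsub>pair_group A B\<^esub> v"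
      by (auto simp: r_coset_def)
  qed
  assume "u - v \<in> tensor_kernel A B"
  moreover from tensor_kernel_closed(4)[OF assms this] have "v - u \<in> tensor_kernel A B" by simp
  ultimately show "tensor_kernel A B #>\<^bsub>pair_group A B\<^esub> u = tensor_kernel A B #>\<^bsub>pair_group A B\<^esub> v"
    using sub by blast
qed

lemma tensor_lift_kernel:
  assumes "group A" "group B" "group C" "group D" and f: "f \<in> hom A C" and r: "r \<in> hom B D"
    and "u \<in> tensor_kernel A B"
  shows "tensor_lift f r u \<in> tensor_kernel C D"
proof -
  have rel: "tensor_lift f r w \<in> tensor_kernel C D" if "w \<in> tensor_relations A B" for w
  proof -
    have "tensor_lift f r w \<in> tensor_relations C D"
    proof -
      from that consider
        (l) a a' b where "a \<in> carrier A" "a' \<in> carrier A" "b \<in> carrier B"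
          "w = frag_of (a \<otimes>\<^bsub>A\<^esub> a', b) - frag_of (a, b) - frag_of (a', b)"
      | (r) a b b' where "a \<in> carrier A" "b \<in> carrier B" "b' \<in> carrier B"
          "w = frag_of (a, b \<otimes>\<^bsub>B\<^esub> b') - frag_of (a, b) - frag_of (a, b')"
        unfolding tensor_relations_def by blast
      then show ?thesis
      proof cases
        case l
        then have "tensor_lift f r w =
            frag_of (f a \<otimes>\<^bsub>C\<^esub> f a', r b) - frag_of (f a, r b) - frag_of (f a', r b)"
          using f by (simp add: frag_extend_diff hom_mult)
        moreover have "f a \<in> carrier C" "f a' \<in> carrier C" "r b \<in> carrier D"
          using l f r by (auto simp: hom_def)
        ultimately show ?thesis unfolding tensor_relations_def by blast
      next
        case r': r
        then have "tensor_lift f r w =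
            frag_of (f a, r b \<otimes>\<^bsub>D\<^esub> r b') - frag_of (f a, r b) - frag_of (f a, r b')"
          using r by (simp add: frag_extend_diff hom_mult)
        moreover have "f a \<in> carrier C" "r b \<in> carrier D" "r b' \<in> carrier D"
          using r' f r by (auto simp: hom_def)
        ultimately show ?thesis unfolding tensor_relations_def by blast
      qed
    qed
    then show ?thesis
      unfolding tensor_kernel_def by (rule generate.incl)
  qed
  from assms(7) show ?thesis
    unfolding tensor_kernel_def[of A B]
  proof (induction rule: generate.induct)
    case one
    then show ?case using tensor_kernel_closed(2)[OF assms(3,4)] by simp
  next
    case (incl h)
    then show ?case by (rule rel)
  next
    case (inv h)
    moreover from inv have "Poly_Mapping.keys h \<subseteq> carrier A \<times> carrier B"
      using subsetD[OF tensor_relations_subset[OF assms(1,2)] inv] by simp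
    ultimately show ?case
      using rel tensor_kernel_closed(4)[OF assms(3,4)] by (simp add: frag_extend_minus)
  next
    case (eng h1 h2)
    then show ?case
      using tensor_kernel_closed(3)[OF assms(3,4)] by (simp add: frag_extend_add)
  qed
qed

lemma bitensor_map_coset:
  assumes "group A" "group B" "group C" "group D" "f \<in> hom A C" "r \<in> hom B D"
  shows "bitensor_map C D f r (tensor_kernel A B #>\<^bsub>pair_group A B\<^esub> u) =
         tensor_kernel C D #>\<^bsub>pair_group C D\<^esub> tensor_lift f r u"
proof -
  have "tensor_kernel C D #>\<^bsub>pair_group C D\<^esub> tensor_lift f r w =
        tensor_kernel C D #>\<^bsub>pair_group C D\<^esub> tensor_lift f r u"
    if "w \<in> tensor_kernel A B #>\<^bsub>pair_group A B\<^esub> u" for w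
  proof -
    from that have "w - u \<in> tensor_kernel A B" by (auto simp: r_coset_def)
    then show ?thesis
      using tensor_lift_kernel[OF assms] by (simp add: tensor_coset_eq_iff[OF assms(3,4)] flip: frag_extend_diff)
  qed
  moreover have "u \<in> tensor_kernel A B #>\<^bsub>pair_group A B\<^esub> u"
    using tensor_kernel_closed(2)[OF assms(1,2)] by (force simp: r_coset_def)
  ultimately show ?thesis
    unfolding bitensor_map_def by blast
qed

lemma carrier_tensor_product:
  "carrier (A \<otimes>\<^sub>\<int> B) = {tensor_kernel A B #>\<^bsub>pair_group A B\<^esub> u | u.
     Poly_Mapping.keys u \<subseteq> carrier A \<times> carrier B}"
  by (auto simp: tensor_product_def FactGroup_def RCOSETS_def)

lemma bitensor_map_hom:
  assumes "group A" "group B" "group C" "group D" and f: "f \<in> hom A C" and r: "r \<in> hom B D"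
  shows "bitensor_map C D f r \<in> hom (A \<otimes>\<^sub>\<int> B) (C \<otimes>\<^sub>\<int> D)"
proof (rule homI)
  have fr: "f \<in> carrier A \<rightarrow> carrier C" "r \<in> carrier B \<rightarrow> carrier D"
    using f r by (auto simp: hom_def)
  have norm: "tensor_kernel A B \<lhd> pair_group A B" if "group A" "group B"
    for A :: "'u monoid" and B :: "'v monoid"
    using comm_group.normal_iff_subgroup[OF abelian_free_Abelian_group] subgroup_tensor_kernel[OF that]
    by blast
  have mult: "(tensor_kernel A B #>\<^bsub>pair_group A B\<^esub> u) \<otimes>\<^bsub>A \<otimes>\<^sub>\<int> B\<^esub> (tensor_kernel A B #>\<^bsub>pair_group A B\<^esub> v) =
      tensor_kernel A B #>\<^bsub>pair_group A B\<^esub> (u + v)"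
    if "group A" "group B" "Poly_Mapping.keys u \<subseteq> carrier A \<times> carrier B"
      "Poly_Mapping.keys v \<subseteq> carrier A \<times> carrier B"
    for A :: "'u monoid" and B :: "'v monoid" and u v
    using normal.rcos_sum[OF norm[OF that(1,2)], of u v] that
    by (simp add: tensor_product_def FactGroup_def)
  fix x assume "x \<in> carrier (A \<otimes>\<^sub>\<int> B)"
  then obtain u where u: "x = tensor_kernel A B #>\<^bsub>pair_group A B\<^esub> u"
    "Poly_Mapping.keys u \<subseteq> carrier A \<times> carrier B"
    by (auto simp: carrier_tensor_product)
  then show "bitensor_map C D f r x \<in> carrier (C \<otimes>\<^sub>\<int> D)"
    using keys_tensor_lift[OF fr] by (auto simp: carrier_tensor_product bitensor_map_coset[OF assms])
  fix y assume "y \<in> carrier (A \<otimes>\<^sub>\<int> B)"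
  then obtain v where v: "y = tensor_kernel A B #>\<^bsub>pair_group A B\<^esub> v"
    "Poly_Mapping.keys v \<subseteq> carrier A \<times> carrier B"
    by (auto simp: carrier_tensor_product)
  show "bitensor_map C D f r (x \<otimes>\<^bsub>A \<otimes>\<^sub>\<int> B\<^esub> y) =
      bitensor_map C D f r x \<otimes>\<^bsub>C \<otimes>\<^sub>\<int> D\<^esub> bitensor_map C D f r y"
    using u v keys_tensor_lift[OF fr]
    by (simp add: mult[OF assms(1,2)] mult[OF assms(3,4)] bitensor_map_coset[OF assms] frag_extend_add)
qed

lemma bitensor_map_inverse:
  assumes grp: "group A" "group B" "group C" "group D"
    and f: "f \<in> hom A C" and r: "r \<in> hom B D" and g: "g \<in> hom C A" and s: "s \<in> hom D B"
    and gen: "\<And>a b. a \<in> carrier A \<Longrightarrow> b \<in> carrier B \<Longrightarrow>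
                frag_of (g (f a), s (r b)) - frag_of (a, b) \<in> tensor_kernel A B"
    and x: "x \<in> carrier (A \<otimes>\<^sub>\<int> B)"
  shows "bitensor_map A B g s (bitensor_map C D f r x) = x"
proof -
  obtain u where u: "x = tensor_kernel A B #>\<^bsub>pair_group A B\<^esub> u"
    "Poly_Mapping.keys u \<subseteq> carrier A \<times> carrier B"
    using x by (auto simp: carrier_tensor_product)
  have "tensor_lift g s (tensor_lift f r u) - u \<in> tensor_kernel A B"
  proof (rule free_Abelian_group_induct[OF u(2)])
    show "tensor_lift g s (tensor_lift f r 0) - 0 \<in> tensor_kernel A B"
      using tensor_kernel_closed(2)[OF grp(1,2)] by simp
  next
    fix v w
    assume "tensor_lift g s (tensor_lift f r v) - v \<in> tensor_kernel A B"
      "tensor_lift g s (tensor_lift f r w) - w \<in> tensor_kernel A B"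
    from tensor_kernel_closed(5)[OF grp(1,2) this]
    show "tensor_lift g s (tensor_lift f r (v - w)) - (v - w) \<in> tensor_kernel A B"
      by (simp add: frag_extend_diff algebra_simps)
  next
    fix p assume "p \<in> carrier A \<times> carrier B"
    then show "tensor_lift g s (tensor_lift f r (frag_of p)) - frag_of p \<in> tensor_kernel A B"
      using gen by (cases p) auto
  qed
  then show ?thesis
    by (simp add: u(1) bitensor_map_coset[OF grp f r] bitensor_map_coset[OF grp(3,4,1,2) g s]
        tensor_coset_eq_iff[OF grp(1,2)])
qed

lemma group_rat_group: "group rat_group"
proof (rule groupI)
  fix x show "\<exists>y\<in>carrier rat_group. y \<otimes>\<^bsub>rat_group\<^esub> x = \<one>\<^bsub>rat_group\<^esub>"
    by (rule bexI[of _ "- x"]) (auto simp: rat_group_def)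
qed (auto simp: rat_group_def)

text \<open>
  If both composites of \<open>f\<close> and \<open>g\<close> are squaring (doubling, in additive notation), then
  \<open>f \<otimes> \<rat>\<close> has the inverse \<open>b \<otimes> q \<mapsto> g b \<otimes> q/2\<close>.
\<close>

lemma tensor_map_rat_iso:
  assumes grp: "group A" "group B" and f: "f \<in> hom A B" and g: "g \<in> hom B A"
    and gf: "\<And>a. a \<in> carrier A \<Longrightarrow> g (f a) = a \<otimes>\<^bsub>A\<^esub> a"
    and fg: "\<And>b. b \<in> carrier B \<Longrightarrow> f (g b) = b \<otimes>\<^bsub>B\<^esub> b"
  shows "tensor_map B rat_group f \<in> iso (A \<otimes>\<^sub>\<int> rat_group) (B \<otimes>\<^sub>\<int> rat_group)"
proof -
  let ?h = "\<lambda>q::rat. q / 2"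
  have half: "?h \<in> hom rat_group rat_group"
    by (auto simp: hom_def rat_group_def add_divide_distrib)
  have one: "(\<lambda>q. q) \<in> hom rat_group rat_group"
    by (auto simp: hom_def)
  have gen: "frag_of (a \<otimes>\<^bsub>A\<^esub> a, q / 2) - frag_of (a, q) \<in> tensor_kernel A rat_group"
    if A: "group A" and a: "a \<in> carrier A" for a q and A :: "'u monoid"
  proof -
    have "frag_of (a \<otimes>\<^bsub>A\<^esub> a, q / 2) - frag_of (a, q / 2) - frag_of (a, q / 2) \<in> tensor_kernel A rat_group"
      using a unfolding tensor_kernel_def tensor_relations_def
      by (intro generate.incl UnI1) (auto simp: rat_group_def)
    moreover have "frag_of (a, (q / 2) \<otimes>\<^bsub>rat_group\<^esub> (q / 2)) - frag_of (a, q / 2) - frag_of (a, q / 2)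
        \<in> tensor_kernel A rat_group"
      using a unfolding tensor_kernel_def tensor_relations_def
      by (intro generate.incl UnI2 CollectI exI[where x = a] exI[where x = "q / 2"] conjI)
        (auto simp: rat_group_def)
    ultimately show ?thesis
      using tensor_kernel_closed(5)[OF A group_rat_group] by (fastforce simp: rat_group_def)
  qed
  show ?thesis
    unfolding tensor_map_eq_bitensor_map
  proof (rule isoI)
    show hom: "bitensor_map B rat_group f (\<lambda>q. q) \<in> hom (A \<otimes>\<^sub>\<int> rat_group) (B \<otimes>\<^sub>\<int> rat_group)"
      by (intro bitensor_map_hom grp group_rat_group f one)
    have hom': "bitensor_map A rat_group g ?h \<in> hom (B \<otimes>\<^sub>\<int> rat_group) (A \<otimes>\<^sub>\<int> rat_group)"
      by (intro bitensor_map_hom grp group_rat_group g half)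
    show "bij_betw (bitensor_map B rat_group f (\<lambda>q. q))
        (carrier (A \<otimes>\<^sub>\<int> rat_group)) (carrier (B \<otimes>\<^sub>\<int> rat_group))"
    proof (rule bij_betw_byWitness[where f' = "bitensor_map A rat_group g ?h"])
      show "\<forall>x\<in>carrier (A \<otimes>\<^sub>\<int> rat_group).
          bitensor_map A rat_group g ?h (bitensor_map B rat_group f (\<lambda>q. q) x) = x"
        by (intro ballI, rule bitensor_map_inverse)
          (use grp group_rat_group f g half one gen[OF grp(1)] gf in auto)
      show "\<forall>y\<in>carrier (B \<otimes>\<^sub>\<int> rat_group).
          bitensor_map B rat_group f (\<lambda>q. q) (bitensor_map A rat_group g ?h y) = y"
        by (intro ballI, rule bitensor_map_inverse)
          (use grp group_rat_group f g half one gen[OF grp(2)] fg in auto)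
    qed (use hom hom' in \<open>auto simp: hom_def\<close>)
  qed
qed

section \<open>Continuity between abstract topologies\<close>

lemma continuous_map_compose_app:
  assumes "continuous_map X Y f" "continuous_map Y Z g"
  shows "continuous_map X Z (\<lambda>x. g (f x))"
  using continuous_map_compose[OF assms] by (simp add: o_def)

lemma continuous_map_apply2:
  assumes "continuous_map (prod_topology A B) C (\<lambda>(a, b). m a b)"
    and "continuous_map X A f" "continuous_map X B g"
  shows "continuous_map X C (\<lambda>x. m (f x) (g x))"
  using continuous_map_compose_app[OF continuous_map_pairedI[OF assms(2,3)] assms(1)] by simp

lemma continuous_map_fst_app:
  "continuous_map X (prod_topology A B) f \<Longrightarrow> continuous_map X A (\<lambda>x. fst (f x))"
  by (rule continuous_map_compose_app[OF _ continuous_map_fst])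

lemma continuous_map_snd_app:
  "continuous_map X (prod_topology A B) f \<Longrightarrow> continuous_map X B (\<lambda>x. snd (f x))"
  by (rule continuous_map_compose_app[OF _ continuous_map_snd])

lemma continuous_map_subtopologyI:
  assumes "continuous_map X Y f" "\<And>x. x \<in> topspace X \<Longrightarrow> f x \<in> S"
  shows "continuous_map X (subtopology Y S) f"
  using assms by (auto intro: continuous_map_into_subtopology)

lemma continuous_map_locally:
  assumes "\<And>x. x \<in> topspace X \<Longrightarrow> \<exists>U. openin X U \<and> x \<in> U \<and> continuous_map (subtopology X U) Y f"
  shows "continuous_map X Y f"
proof -
  obtain U where U: "\<And>x. x \<in> topspace X \<Longrightarrow>
      openin X (U x) \<and> x \<in> U x \<and> continuous_map (subtopology X (U x)) Y f"
    using assms by metis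
  show ?thesis
    by (rule pasting_lemma[where I = "topspace X" and T = U and f = "\<lambda>_. f"]) (use U in auto)
qed

lemma continuous_map_complex_space:
  "continuous_map X (complex_space n) f \<longleftrightarrow>
     (\<forall>x\<in>topspace X. f x \<in> extensional {..<n}) \<and>
     (\<forall>i<n. continuous_map X euclidean (\<lambda>x. f x i))"
  unfolding complex_space_def continuous_map_componentwise by auto

lemma topspace_complex_space: "topspace (complex_space n) = extensional {..<n}"
  by (auto simp: complex_space_def PiE_def)

lemma continuous_map_complex_ops:
  fixes f g :: "'a \<Rightarrow> complex"
  assumes "continuous_map X euclidean f"
  shows "continuous_map X euclidean g \<Longrightarrow> continuous_map X euclidean (\<lambda>x. f x + g x)"
    and "continuous_map X euclidean (\<lambda>x. c * f x)"
    and "continuous_map X euclidean (\<lambda>x. cnj (f x))"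
proof -
  show "continuous_map X euclidean (\<lambda>x. f x + g x)" if "continuous_map X euclidean g"
    by (rule continuous_map_add[OF assms that])
  show "continuous_map X euclidean (\<lambda>x. c * f x)"
    by (rule continuous_map_compose_app[OF assms]) (simp add: continuous_on_mult_left continuous_on_id)
  show "continuous_map X euclidean (\<lambda>x. cnj (f x))"
    by (rule continuous_map_compose_app[OF assms]) (simp add: continuous_on_cnj)
qed


section \<open>Local coordinates of vector bundles\<close>

abbreviation "Epts E \<equiv> topspace (Etop E)"

text \<open>
  A trivialization in which the coordinate vector of a point is separated from its position in
  the base, so that the two directions of the homeomorphism are \<open>\<eta>\<close> and \<open>e \<mapsto> (Eproj E e, \<kappa> e)\<close>.
\<close>

definition bundle_chart ::
    "'x topology \<Rightarrow> ('g, 'x, 'e) gbundle \<Rightarrow> 'x set \<Rightarrow> nat \<Rightarrow>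
     ('x \<Rightarrow> (nat \<Rightarrow> complex) \<Rightarrow> 'e) \<Rightarrow> ('e \<Rightarrow> nat \<Rightarrow> complex) \<Rightarrow> bool" where
  "bundle_chart T E U n \<eta> \<kappa> \<longleftrightarrow>
     openin T U \<and>
     continuous_map (prod_topology (subtopology T U) (complex_space n)) (Etop E) (\<lambda>(y, v). \<eta> y v) \<and>
     continuous_map (subtopology (Etop E) {e \<in> Epts E. Eproj E e \<in> U}) (complex_space n) \<kappa> \<and>
     (\<forall>y\<in>U. \<forall>v\<in>extensional {..<n}.
        Eproj E (\<eta> y v) = y \<and> \<kappa> (\<eta> y v) = v \<and>
        (\<forall>w\<in>extensional {..<n}. Eadd E (\<eta> y v) (\<eta> y w) = \<eta> y (\<lambda>i\<in>{..<n}. v i + w i)) \<and>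
        (\<forall>c. Escale E c (\<eta> y v) = \<eta> y (\<lambda>i\<in>{..<n}. c * v i))) \<and>
     (\<forall>e\<in>Epts E. Eproj E e \<in> U \<longrightarrow> \<eta> (Eproj E e) (\<kappa> e) = e)"

lemma bundle_chartD:
  assumes "bundle_chart T E U n \<eta> \<kappa>"
  shows "openin T U"
    and "y \<in> U \<Longrightarrow> v \<in> extensional {..<n} \<Longrightarrow> \<eta> y v \<in> Epts E"
    and "y \<in> U \<Longrightarrow> v \<in> extensional {..<n} \<Longrightarrow> Eproj E (\<eta> y v) = y"
    and "y \<in> U \<Longrightarrow> v \<in> extensional {..<n} \<Longrightarrow> \<kappa> (\<eta> y v) = v"
    and "y \<in> U \<Longrightarrow> v \<in> extensional {..<n} \<Longrightarrow> w \<in> extensional {..<n} \<Longrightarrow>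
           Eadd E (\<eta> y v) (\<eta> y w) = \<eta> y (\<lambda>i\<in>{..<n}. v i + w i)"
    and "y \<in> U \<Longrightarrow> v \<in> extensional {..<n} \<Longrightarrow> Escale E c (\<eta> y v) = \<eta> y (\<lambda>i\<in>{..<n}. c * v i)"
    and "e \<in> Epts E \<Longrightarrow> Eproj E e \<in> U \<Longrightarrow> \<eta> (Eproj E e) (\<kappa> e) = e"
    and "e \<in> Epts E \<Longrightarrow> Eproj E e \<in> U \<Longrightarrow> \<kappa> e \<in> extensional {..<n}"
    and "continuous_map X T f \<Longrightarrow> (\<And>x. x \<in> topspace X \<Longrightarrow> f x \<in> U) \<Longrightarrow>
           continuous_map X (complex_space n) g \<Longrightarrow> continuous_map X (Etop E) (\<lambda>x. \<eta> (f x) (g x))"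
    and "continuous_map X (Etop E) f' \<Longrightarrow> (\<And>x. x \<in> topspace X \<Longrightarrow> Eproj E (f' x) \<in> U) \<Longrightarrow>
           continuous_map X (complex_space n) (\<lambda>x. \<kappa> (f' x))"
proof -
  note c = assms[unfolded bundle_chart_def]
  have \<eta>: "continuous_map (prod_topology (subtopology T U) (complex_space n)) (Etop E) (\<lambda>(y, v). \<eta> y v)"
    and \<kappa>: "continuous_map (subtopology (Etop E) {e \<in> Epts E. Eproj E e \<in> U}) (complex_space n) \<kappa>"
    using c by blast+
  show U: "openin T U" using c by blast
  then have UT: "U \<subseteq> topspace T" by (rule openin_subset)
  show "y \<in> U \<Longrightarrow> v \<in> extensional {..<n} \<Longrightarrow> \<eta> y v \<in> Epts E"
    using continuous_map_image_subset_topspace[OF \<eta>] UT by (auto simp: topspace_complex_space)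
  show "e \<in> Epts E \<Longrightarrow> Eproj E e \<in> U \<Longrightarrow> \<kappa> e \<in> extensional {..<n}"
    using continuous_map_image_subset_topspace[OF \<kappa>] by (auto simp: topspace_complex_space)
  show "continuous_map X (Etop E) (\<lambda>x. \<eta> (f x) (g x))"
    if "continuous_map X T f" "\<And>x. x \<in> topspace X \<Longrightarrow> f x \<in> U" "continuous_map X (complex_space n) g"
    by (rule continuous_map_apply2[OF \<eta>]) (use that in \<open>auto intro: continuous_map_subtopologyI\<close>)
  show "continuous_map X (complex_space n) (\<lambda>x. \<kappa> (f' x))"
    if "continuous_map X (Etop E) f'" "\<And>x. x \<in> topspace X \<Longrightarrow> Eproj E (f' x) \<in> U"
    by (rule continuous_map_compose_app[OF _ \<kappa>], rule continuous_map_subtopologyI)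
      (use that continuous_map_image_subset_topspace[OF that(1)] in auto)
qed (use assms in \<open>auto simp: bundle_chart_def\<close>)

lemma complex_vector_bundle_iff_charts:
  "complex_vector_bundle T E \<longleftrightarrow>
     continuous_map (Etop E) T (Eproj E) \<and>
     (\<forall>x\<in>topspace T. \<exists>U n \<eta> \<kappa>. x \<in> U \<and> bundle_chart T E U n \<eta> \<kappa>)"
proof -
  have key: "(\<exists>U n h. openin T U \<and> x \<in> U \<and>
        homeomorphic_map (prod_topology (subtopology T U) (complex_space n))
          (subtopology (Etop E) {e \<in> Epts E. Eproj E e \<in> U}) h \<and>
        (\<forall>y\<in>U. \<forall>v\<in>topspace (complex_space n).
           Eproj E (h (y, v)) = y \<and>
           (\<forall>w\<in>topspace (complex_space n).
              Eadd E (h (y, v)) (h (y, w)) = h (y, \<lambda>i\<in>{..<n}. v i + w i)) \<and>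
           (\<forall>c. Escale E c (h (y, v)) = h (y, \<lambda>i\<in>{..<n}. c * v i)))) \<longleftrightarrow>
     (\<exists>U n \<eta> \<kappa>. x \<in> U \<and> bundle_chart T E U n \<eta> \<kappa>)"
    (is "(\<exists>U n h. ?L U n h) \<longleftrightarrow> _")
    if p: "continuous_map (Etop E) T (Eproj E)" for x
  proof (intro iffI; elim exE)
    fix U n h assume L: "?L U n h"
    then obtain k where hk: "homeomorphic_maps (prod_topology (subtopology T U) (complex_space n))
          (subtopology (Etop E) {e \<in> Epts E. Eproj E e \<in> U}) h k"
      by (auto simp: homeomorphic_map_maps)
    have UT: "U \<subseteq> topspace T" using L openin_subset by blast
    have h: "continuous_map (prod_topology (subtopology T U) (complex_space n)) (Etop E) h"
      and k: "continuous_map (subtopology (Etop E) {e \<in> Epts E. Eproj E e \<in> U})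
          (prod_topology (subtopology T U) (complex_space n)) k"
      and kh: "\<And>y v. y \<in> U \<Longrightarrow> v \<in> extensional {..<n} \<Longrightarrow> k (h (y, v)) = (y, v)"
      and hk': "\<And>e. e \<in> Epts E \<Longrightarrow> Eproj E e \<in> U \<Longrightarrow> h (k e) = e"
      using hk UT unfolding homeomorphic_maps_def
      by (auto simp: continuous_map_in_subtopology topspace_complex_space)
    have k_in: "k e \<in> U \<times> extensional {..<n}" if "e \<in> Epts E" "Eproj E e \<in> U" for e
      using continuous_map_image_subset_topspace[OF k] that UT by (auto simp: topspace_complex_space)
    have "h (Eproj E e, snd (k e)) = e" if "e \<in> Epts E" "Eproj E e \<in> U" for e
    proof -
      have "Eproj E (h (k e)) = fst (k e)"
        using L k_in[OF that] by (cases "k e") (auto simp: topspace_complex_space)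
      then show ?thesis using hk'[OF that] by simp
    qed
    moreover have "continuous_map (subtopology (Etop E) {e \<in> Epts E. Eproj E e \<in> U})
        (complex_space n) (\<lambda>e. snd (k e))"
      by (rule continuous_map_snd_app[OF k])
    ultimately have "bundle_chart T E U n (\<lambda>y v. h (y, v)) (\<lambda>e. snd (k e))"
      using L h kh by (auto simp: bundle_chart_def topspace_complex_space case_prod_beta')
    then show "\<exists>U n \<eta> \<kappa>. x \<in> U \<and> bundle_chart T E U n \<eta> \<kappa>"
      using L by blast
  next
    fix U n \<eta> \<kappa> assume c: "x \<in> U \<and> bundle_chart T E U n \<eta> \<kappa>"
    then have b: "bundle_chart T E U n \<eta> \<kappa>" by blast
    note B = bundle_chartD[OF b]
    have UT: "U \<subseteq> topspace T" using B(1) by (rule openin_subset)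
    let ?E = "subtopology (Etop E) {e \<in> Epts E. Eproj E e \<in> U}"
    let ?P = "prod_topology (subtopology T U) (complex_space n)"
    have id: "continuous_map ?E (Etop E) (\<lambda>e. e)"
      using continuous_map_id_subt by (simp add: id_def)
    have "homeomorphic_maps ?P ?E (\<lambda>(y, v). \<eta> y v) (\<lambda>e. (Eproj E e, \<kappa> e))"
      unfolding homeomorphic_maps_def
    proof (intro conjI)
      show "continuous_map ?P ?E (\<lambda>(y, v). \<eta> y v)"
        using b by (auto simp: bundle_chart_def intro!: continuous_map_subtopologyI B(2) simp: topspace_complex_space)
      show "continuous_map ?E ?P (\<lambda>e. (Eproj E e, \<kappa> e))"
        using b by (auto simp: bundle_chart_def intro!: continuous_map_pairedI continuous_map_subtopologyI
            continuous_map_compose_app[OF id p])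
    qed (use B in \<open>auto simp: topspace_complex_space\<close>)
    then have "?L U n (\<lambda>(y, v). \<eta> y v)"
      using B c by (auto simp: topspace_complex_space homeomorphic_map_maps)
    then show "\<exists>U n h. ?L U n h" by blast
  qed
  show ?thesis
    unfolding complex_vector_bundle_def by (rule conj_cong[OF refl], rule ball_cong[OF refl], erule key)
qed

lemma complex_vector_bundleE:
  assumes "complex_vector_bundle T E" "x \<in> topspace T"
  obtains U n \<eta> \<kappa> where "x \<in> U" "bundle_chart T E U n \<eta> \<kappa>"
  using assms unfolding complex_vector_bundle_iff_charts by blast

lemma complex_vector_bundle_proj:
  assumes "complex_vector_bundle T E"
  shows "continuous_map (Etop E) T (Eproj E)"
    and "e \<in> Epts E \<Longrightarrow> Eproj E e \<in> topspace T"
  using assms continuous_map_image_subset_topspace[of "Etop E" T "Eproj E"]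
  by (auto simp: complex_vector_bundle_def)

lemma complex_vector_bundle_ops:
  assumes E: "complex_vector_bundle T E" and e: "e \<in> Epts E"
  shows "f \<in> Epts E \<Longrightarrow> Eproj E f = Eproj E e \<Longrightarrow>
           Eadd E e f \<in> Epts E \<and> Eproj E (Eadd E e f) = Eproj E e"
    and "Escale E c e \<in> Epts E"
    and "Eproj E (Escale E c e) = Eproj E e"
proof -
  obtain U n \<eta> \<kappa> where x: "Eproj E e \<in> U" and c: "bundle_chart T E U n \<eta> \<kappa>"
    using complex_vector_bundleE[OF E] complex_vector_bundle_proj(2)[OF E e] by metis
  note B = bundle_chartD[OF c]
  note \<kappa>e = B(8)[OF e x]
  have "Escale E c e = \<eta> (Eproj E e) (\<lambda>i\<in>{..<n}. c * \<kappa> e i)"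
    using B(6)[OF x \<kappa>e] B(7)[OF e x] by simp
  then show "Escale E c e \<in> Epts E" "Eproj E (Escale E c e) = Eproj E e"
    using B(2,3)[OF x] by simp_all
  assume f: "f \<in> Epts E" "Eproj E f = Eproj E e"
  then have fx: "Eproj E f \<in> U" using x by simp
  have "Eadd E e f = \<eta> (Eproj E e) (\<lambda>i\<in>{..<n}. \<kappa> e i + \<kappa> f i)"
    using B(5)[OF x \<kappa>e B(8)[OF f(1) fx]] B(7)[OF e x] B(7)[OF f(1) fx] f(2) by simp
  then show "Eadd E e f \<in> Epts E \<and> Eproj E (Eadd E e f) = Eproj E e"
    using B(2,3)[OF x] by simp
qed

text \<open>
  A linear coordinate system of a single fibre, for verifying vector space identities and for
  transferring fibres to coordinate lists.
\<close>

lemma fibre_coordinates: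
  fixes E :: "('g, 'x, 'e) gbundle"
  assumes E: "complex_vector_bundle T E" and x: "x \<in> topspace T"
  obtains n :: nat and \<eta> :: "(nat \<Rightarrow> complex) \<Rightarrow> 'e" and \<kappa> where
    "\<And>v. v \<in> extensional {..<n} \<Longrightarrow> \<kappa> (\<eta> v) = v"
    "\<And>e. e \<in> Epts E \<Longrightarrow> Eproj E e = x \<Longrightarrow> \<kappa> e \<in> extensional {..<n} \<and> \<eta> (\<kappa> e) = e"
    "\<And>v w. v \<in> extensional {..<n} \<Longrightarrow> w \<in> extensional {..<n} \<Longrightarrow>
       Eadd E (\<eta> v) (\<eta> w) = \<eta> (\<lambda>i\<in>{..<n}. v i + w i)"
    "\<And>c v. v \<in> extensional {..<n} \<Longrightarrow> Escale E c (\<eta> v) = \<eta> (\<lambda>i\<in>{..<n}. c * v i)"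
proof -
  obtain U n \<eta> \<kappa> where xU: "x \<in> U" and c: "bundle_chart T E U n \<eta> \<kappa>"
    using complex_vector_bundleE[OF E x] by metis
  note B = bundle_chartD[OF c]
  show thesis
    by (rule that[where n = n and \<kappa> = \<kappa> and \<eta> = "\<eta> x"]) (use B(4-8) xU in auto)
qed

text \<open>Both vector space operations are linear combinations of coordinate vectors.\<close>

lemma continuous_map_linear_combination:
  assumes E: "complex_vector_bundle T E"
    and f: "continuous_map X (Etop E) f" and g: "continuous_map X (Etop E) g"
    and fg: "\<And>x. x \<in> topspace X \<Longrightarrow> Eproj E (f x) = Eproj E (g x)"
    and m: "\<And>U n \<eta> \<kappa> y v w. bundle_chart T E U n \<eta> \<kappa> \<Longrightarrow> y \<in> U \<Longrightarrow> v \<in> extensional {..<n} \<Longrightarrow>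
       w \<in> extensional {..<n} \<Longrightarrow> m (\<eta> y v) (\<eta> y w) = \<eta> y (\<lambda>i\<in>{..<n}. a * v i + b * w i)"
  shows "continuous_map X (Etop E) (\<lambda>x. m (f x) (g x))"
proof (rule continuous_map_locally)
  fix x assume x: "x \<in> topspace X"
  note p = complex_vector_bundle_proj[OF E]
  have pf: "continuous_map X T (\<lambda>x. Eproj E (f x))"
    by (rule continuous_map_compose_app[OF f p(1)])
  have fE: "f y \<in> Epts E" "g y \<in> Epts E" if "y \<in> topspace X" for y
    using f g that continuous_map_image_subset_topspace by blast+
  obtain U n \<eta> \<kappa> where xU: "Eproj E (f x) \<in> U" and c: "bundle_chart T E U n \<eta> \<kappa>"
    using complex_vector_bundleE[OF E p(2)[OF fE(1)[OF x]]] by metis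
  note B = bundle_chartD[OF c]
  let ?V = "{y \<in> topspace X. Eproj E (f y) \<in> U}"
  have "continuous_map (subtopology X ?V) (Etop E)
      (\<lambda>y. \<eta> (Eproj E (f y)) (\<lambda>i\<in>{..<n}. a * \<kappa> (f y) i + b * \<kappa> (g y) i))"
  proof (rule B(9))
    have "continuous_map (subtopology X ?V) (complex_space n) (\<lambda>x. \<kappa> (f x))"
      "continuous_map (subtopology X ?V) (complex_space n) (\<lambda>x. \<kappa> (g x))"
      by (rule B(10), use f g fg in \<open>auto intro: continuous_map_from_subtopology\<close>)+
    then show "continuous_map (subtopology X ?V) (complex_space n)
        (\<lambda>y. \<lambda>i\<in>{..<n}. a * \<kappa> (f y) i + b * \<kappa> (g y) i)"
      by (auto simp: continuous_map_complex_space intro!: continuous_map_complex_ops)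
  qed (use pf in \<open>auto intro: continuous_map_from_subtopology\<close>)
  moreover have "\<eta> (Eproj E (f y)) (\<lambda>i\<in>{..<n}. a * \<kappa> (f y) i + b * \<kappa> (g y) i) = m (f y) (g y)"
    if "y \<in> topspace X" "Eproj E (f y) \<in> U" for y
    using m[OF c that(2) B(8)[OF fE(1)[OF that(1)] that(2)] B(8)[OF fE(2)[OF that(1)]]]
      B(7)[OF fE(1)[OF that(1)] that(2)] B(7)[OF fE(2)[OF that(1)]] that fg[OF that(1)] by simp
  ultimately have "continuous_map (subtopology X ?V) (Etop E) (\<lambda>x. m (f x) (g x))"
    by (elim continuous_map_eq) auto
  moreover have "openin X ?V"
    by (rule openin_continuous_map_preimage[OF pf B(1)])
  ultimately show "\<exists>U. openin X U \<and> x \<in> U \<and>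
      continuous_map (subtopology X U) (Etop E) (\<lambda>x. m (f x) (g x))"
    using x xU by blast
qed

lemma continuous_map_Eadd:
  assumes "complex_vector_bundle T E" "continuous_map X (Etop E) f" "continuous_map X (Etop E) g"
    and "\<And>x. x \<in> topspace X \<Longrightarrow> Eproj E (f x) = Eproj E (g x)"
  shows "continuous_map X (Etop E) (\<lambda>x. Eadd E (f x) (g x))"
  by (rule continuous_map_linear_combination[OF assms, where a = 1 and b = 1])
    (simp, simp, erule (3) bundle_chartD(5))

lemma continuous_map_Escale:
  assumes "complex_vector_bundle T E" "continuous_map X (Etop E) f"
  shows "continuous_map X (Etop E) (\<lambda>x. Escale E c (f x))"
  by (rule continuous_map_linear_combination[OF assms assms(2), where a = c and b = 0])
    (simp, simp, erule (2) bundle_chartD(6))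

section \<open>Isomorphisms and sums of equivariant bundles\<close>

lemma continuous_map_ident: "continuous_map X X (\<lambda>x. x)"
  using continuous_map_id[of X] by (simp add: id_def)

lemma continuous_map_in_topspace:
  "continuous_map X Y f \<Longrightarrow> x \<in> topspace X \<Longrightarrow> f x \<in> topspace Y"
  using continuous_map_image_subset_topspace by blast

lemma topological_groupD:
  assumes "topological_group L"
  shows "group L" "monoid L" "topspace (Gtop L) = carrier L"
    and "continuous_map (prod_topology (Gtop L) (Gtop L)) (Gtop L) (\<lambda>(x, y). x \<otimes>\<^bsub>L\<^esub> y)"
  using assms group.is_monoid by (auto simp: topological_group_def)

lemma magnetic_bundleD:
  assumes "magnetic_bundle L X E" and "topological_group L"
  shows "complex_vector_bundle (Xtop X) E"
    and "continuous_map (Etop E) (Xtop X) (Eproj E)"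
    and "e \<in> Epts E \<Longrightarrow> Eproj E e \<in> topspace (Xtop X)"
    and "continuous_map (prod_topology (Gtop L) (Etop E)) (Etop E) (\<lambda>(g, e). Eact E g e)"
    and "e \<in> Epts E \<Longrightarrow> Eact E \<one>\<^bsub>L\<^esub> e = e"
    and "g \<in> carrier L \<Longrightarrow> h \<in> carrier L \<Longrightarrow> e \<in> Epts E \<Longrightarrow>
           Eact E (g \<otimes>\<^bsub>L\<^esub> h) e = Eact E g (Eact E h e)"
    and "g \<in> carrier L \<Longrightarrow> e \<in> Epts E \<Longrightarrow> Eproj E (Eact E g e) = Xact X g (Eproj E e)"
    and "g \<in> carrier L \<Longrightarrow> e \<in> Epts E \<Longrightarrow> f \<in> Epts E \<Longrightarrow>
           Eproj E f = Eproj E e \<Longrightarrow> Eact E g (Eadd E e f) = Eadd E (Eact E g e) (Eact E g f)"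
    and "g \<in> carrier L \<Longrightarrow> e \<in> Epts E \<Longrightarrow>
           Eact E g (Escale E c e) = Escale E (if Gdeg L g = 0 then c else cnj c) (Eact E g e)"
    and "g \<in> carrier L \<Longrightarrow> e \<in> Epts E \<Longrightarrow> Eact E g e \<in> Epts E"
proof -
  note m = assms(1)[unfolded magnetic_bundle_def]
  show 1: "complex_vector_bundle (Xtop X) E" using m by blast
  show "continuous_map (Etop E) (Xtop X) (Eproj E)"
    "e \<in> Epts E \<Longrightarrow> Eproj E e \<in> topspace (Xtop X)"
    by (rule complex_vector_bundle_proj[OF 1])+
  show act: "continuous_map (prod_topology (Gtop L) (Etop E)) (Etop E) (\<lambda>(g, e). Eact E g e)"
    using m by blast
  show "g \<in> carrier L \<Longrightarrow> e \<in> Epts E \<Longrightarrow> Eact E g e \<in> Epts E"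
    using continuous_map_in_topspace[OF act, of "(g, e)"] topological_groupD(3)[OF assms(2)] by simp
qed (use assms in \<open>auto simp: magnetic_bundle_def\<close>)

lemma magnetic_bundleI:
  assumes "complex_vector_bundle (Xtop X) E"
    and "continuous_map (prod_topology (Gtop L) (Etop E)) (Etop E) (\<lambda>(g, e). Eact E g e)"
    and "\<And>e. e \<in> Epts E \<Longrightarrow> Eact E \<one>\<^bsub>L\<^esub> e = e"
    and "\<And>g h e. g \<in> carrier L \<Longrightarrow> h \<in> carrier L \<Longrightarrow> e \<in> Epts E \<Longrightarrow>
           Eact E (g \<otimes>\<^bsub>L\<^esub> h) e = Eact E g (Eact E h e)"
    and "\<And>g e. g \<in> carrier L \<Longrightarrow> e \<in> Epts E \<Longrightarrow>
           Eproj E (Eact E g e) = Xact X g (Eproj E e)"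
    and "\<And>g e f. g \<in> carrier L \<Longrightarrow> e \<in> Epts E \<Longrightarrow> f \<in> Epts E \<Longrightarrow>
           Eproj E f = Eproj E e \<Longrightarrow> Eact E g (Eadd E e f) = Eadd E (Eact E g e) (Eact E g f)"
    and "\<And>g c e. g \<in> carrier L \<Longrightarrow> e \<in> Epts E \<Longrightarrow>
           Eact E g (Escale E c e) = Escale E (if Gdeg L g = 0 then c else cnj c) (Eact E g e)"
  shows "magnetic_bundle L X E"
  using assms by (simp add: magnetic_bundle_def)

lemma magnetic_bundle_act_continuous:
  assumes "magnetic_bundle L X E" "continuous_map Z (Gtop L) g" "continuous_map Z (Etop E) e"
  shows "continuous_map Z (Etop E) (\<lambda>z. Eact E (g z) (e z))"
proof (rule continuous_map_apply2[OF _ assms(2,3)])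
  show "continuous_map (prod_topology (Gtop L) (Etop E)) (Etop E) (\<lambda>(g, e). Eact E g e)"
    using assms(1) by (simp add: magnetic_bundle_def)
qed

lemma bundle_isoI:
  assumes "continuous_map (Etop E) (Etop F) h" "continuous_map (Etop F) (Etop E) k"
    and "\<And>e. e \<in> Epts E \<Longrightarrow> k (h e) = e" "\<And>f. f \<in> Epts F \<Longrightarrow> h (k f) = f"
    and "\<And>e. e \<in> Epts E \<Longrightarrow> Eproj F (h e) = Eproj E e"
    and "\<And>e e'. e \<in> Epts E \<Longrightarrow> e' \<in> Epts E \<Longrightarrow> Eproj E e' = Eproj E e \<Longrightarrow>
           h (Eadd E e e') = Eadd F (h e) (h e')"
    and "\<And>c e. e \<in> Epts E \<Longrightarrow> h (Escale E c e) = Escale F c (h e)"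
    and "\<And>g e. g \<in> carrier L \<Longrightarrow> e \<in> Epts E \<Longrightarrow> h (Eact E g e) = Eact F g (h e)"
  shows "bundle_iso L E F"
  unfolding bundle_iso_def homeomorphic_map_maps homeomorphic_maps_def
  by (rule exI[of _ h]) (use assms in auto)

definition bundle_isomorphisms ::
    "'g graded_group \<Rightarrow> ('g, 'x, 'e) gbundle \<Rightarrow> ('g, 'x, 'f) gbundle \<Rightarrow> ('e \<Rightarrow> 'f) \<Rightarrow> ('f \<Rightarrow> 'e) \<Rightarrow> bool" where
  "bundle_isomorphisms L E F h k \<longleftrightarrow> homeomorphic_maps (Etop E) (Etop F) h k \<and>
     (\<forall>e\<in>Epts E.
        Eproj F (h e) = Eproj E e \<and>
        (\<forall>e'\<in>Epts E. Eproj E e' = Eproj E e \<longrightarrow> h (Eadd E e e') = Eadd F (h e) (h e')) \<and>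
        (\<forall>c. h (Escale E c e) = Escale F c (h e)) \<and>
        (\<forall>g\<in>carrier L. h (Eact E g e) = Eact F g (h e)))"

lemma bundle_iso_iff: "bundle_iso L E F \<longleftrightarrow> (\<exists>h k. bundle_isomorphisms L E F h k)"
  unfolding bundle_iso_def bundle_isomorphisms_def homeomorphic_map_maps by blast

lemma bundle_isomorphismsD:
  assumes hk: "bundle_isomorphisms L E F h k"
  shows "continuous_map (Etop E) (Etop F) h" "continuous_map (Etop F) (Etop E) k"
    "e \<in> Epts E \<Longrightarrow> k (h e) = e" "f \<in> Epts F \<Longrightarrow> h (k f) = f"
    "e \<in> Epts E \<Longrightarrow> h e \<in> Epts F"
    "f \<in> Epts F \<Longrightarrow> k f \<in> Epts E"
    "e \<in> Epts E \<Longrightarrow> Eproj F (h e) = Eproj E e"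
    "f \<in> Epts F \<Longrightarrow> Eproj E (k f) = Eproj F f"
    "e \<in> Epts E \<Longrightarrow> e' \<in> Epts E \<Longrightarrow> Eproj E e' = Eproj E e \<Longrightarrow>
       h (Eadd E e e') = Eadd F (h e) (h e')"
    "e \<in> Epts E \<Longrightarrow> h (Escale E c e) = Escale F c (h e)"
    "g \<in> carrier L \<Longrightarrow> e \<in> Epts E \<Longrightarrow> h (Eact E g e) = Eact F g (h e)"
proof -
  note h = hk[unfolded bundle_isomorphisms_def homeomorphic_maps_def]
  show hc: "continuous_map (Etop E) (Etop F) h" and kc: "continuous_map (Etop F) (Etop E) k"
    using h by blast+
  show "e \<in> Epts E \<Longrightarrow> h e \<in> Epts F"
    by (rule continuous_map_in_topspace[OF hc])
  show kt: "f \<in> Epts F \<Longrightarrow> k f \<in> Epts E" for f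
    by (rule continuous_map_in_topspace[OF kc])
  show "f \<in> Epts F \<Longrightarrow> Eproj E (k f) = Eproj F f"
    using h kt[of f] by metis
qed (use hk in \<open>simp_all add: bundle_isomorphisms_def homeomorphic_maps_def\<close>)

lemma bundle_iso_trans:
  assumes "bundle_iso L E F" "bundle_iso L F H"
  shows "bundle_iso L E H"
proof -
  obtain h k where hk: "bundle_isomorphisms L E F h k"
    using assms(1) by (auto simp: bundle_iso_iff)
  note h = bundle_isomorphismsD[OF hk]
  obtain h' k' where h'k': "bundle_isomorphisms L F H h' k'"
    using assms(2) by (auto simp: bundle_iso_iff)
  note h' = bundle_isomorphismsD[OF h'k']
  show ?thesis
    by (rule bundle_isoI[OF continuous_map_compose_app[OF h(1) h'(1)]
          continuous_map_compose_app[OF h'(2) h(2)]])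
      (simp_all add: h(3-) h'(3-))
qed

text \<open>
  The inverse of an isomorphism is compatible with the operations because the values of the
  operations stay in the total space, which is part of the axioms for \<open>E\<close>.
\<close>

lemma bundle_iso_sym:
  assumes "bundle_iso L E F" and E: "magnetic_bundle L X E" and L: "topological_group L"
  shows "bundle_iso L F E"
proof -
  obtain h k where hk: "bundle_isomorphisms L E F h k"
    using assms(1) by (auto simp: bundle_iso_iff)
  note h = bundle_isomorphismsD[OF hk]
  note M = magnetic_bundleD[OF E L]
  note ops = complex_vector_bundle_ops[OF M(1)]
  show ?thesis
  proof (rule bundle_isoI[OF h(2,1,4,3,8)])
    fix f f' assume f: "f \<in> Epts F" "f' \<in> Epts F" "Eproj F f' = Eproj F f"
    have "h (Eadd E (k f) (k f')) = Eadd F f f'"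
      using h f by simp
    then show "k (Eadd F f f') = Eadd E (k f) (k f')"
      using h(3)[OF conjunct1[OF ops(1)[OF h(6)[OF f(1)] h(6)[OF f(2)]]]] f h(8) by simp
  next
    fix c f assume f: "f \<in> Epts F"
    have "h (Escale E c (k f)) = Escale F c f"
      using h f by simp
    then show "k (Escale F c f) = Escale E c (k f)"
      using h(3)[OF ops(2)[OF h(6)[OF f]]] by metis
  next
    fix g f assume f: "g \<in> carrier L" "f \<in> Epts F"
    have "h (Eact E g (k f)) = Eact F g f"
      using h f by simp
    then show "k (Eact F g f) = Eact E g (k f)"
      using h(3)[OF M(10)[OF f(1) h(6)[OF f(2)]]] by metis
  qed
qed

lemma complex_vector_bundle_transport:
  assumes E: "complex_vector_bundle T E"
    and h: "continuous_map (Etop E) (Etop F) h" and k: "continuous_map (Etop F) (Etop E) k"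
    and kh: "\<And>e. e \<in> Epts E \<Longrightarrow> k (h e) = e"
    and hk: "\<And>f. f \<in> Epts F \<Longrightarrow> h (k f) = f"
    and p: "\<And>e. e \<in> Epts E \<Longrightarrow> Eproj F (h e) = Eproj E e"
    and add: "\<And>e e'. e \<in> Epts E \<Longrightarrow> e' \<in> Epts E \<Longrightarrow> Eproj E e' = Eproj E e \<Longrightarrow>
           h (Eadd E e e') = Eadd F (h e) (h e')"
    and scale: "\<And>c e. e \<in> Epts E \<Longrightarrow> h (Escale E c e) = Escale F c (h e)"
  shows "complex_vector_bundle T F"
  unfolding complex_vector_bundle_iff_charts
proof (intro conjI ballI)
  have kt: "k f \<in> Epts E" if "f \<in> Epts F" for f
    using continuous_map_in_topspace[OF k that] .
  have pk: "Eproj E (k f) = Eproj F f" if "f \<in> Epts F" for f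
    using p[OF kt[OF that]] hk[OF that] by simp
  show "continuous_map (Etop F) T (Eproj F)"
    by (rule continuous_map_eq[OF continuous_map_compose_app[OF k complex_vector_bundle_proj(1)[OF E]]])
      (rule pk)
  fix x assume "x \<in> topspace T"
  then obtain U n \<eta> \<kappa> where x: "x \<in> U" and c: "bundle_chart T E U n \<eta> \<kappa>"
    using complex_vector_bundleE[OF E] by metis
  note B = bundle_chartD[OF c]
  have "bundle_chart T F U n (\<lambda>y v. h (\<eta> y v)) (\<lambda>f. \<kappa> (k f))"
    unfolding bundle_chart_def
  proof (intro conjI ballI allI impI)
    have "continuous_map (prod_topology (subtopology T U) (complex_space n)) (Etop E) (\<lambda>(y, v). \<eta> y v)"
      using c by (simp add: bundle_chart_def)
    from continuous_map_compose_app[OF this h]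
    show "continuous_map (prod_topology (subtopology T U) (complex_space n)) (Etop F)
        (\<lambda>(y, v). h (\<eta> y v))"
      by (simp add: case_prod_beta')
    show "continuous_map (subtopology (Etop F) {e \<in> Epts F. Eproj F e \<in> U})
        (complex_space n) (\<lambda>f. \<kappa> (k f))"
      by (rule B(10)) (use pk k in \<open>auto intro: continuous_map_from_subtopology\<close>)
    fix y and v :: "nat \<Rightarrow> complex" assume yv: "y \<in> U" "v \<in> extensional {..<n}"
    show "Eproj F (h (\<eta> y v)) = y" "\<kappa> (k (h (\<eta> y v))) = v"
      using B(2-4)[OF yv] p kh by simp_all
    show "Eadd F (h (\<eta> y v)) (h (\<eta> y w)) = h (\<eta> y (\<lambda>i\<in>{..<n}. v i + w i))"
      if "w \<in> extensional {..<n}" for w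
      using B(5)[OF yv that] add[of "\<eta> y v" "\<eta> y w"] B(2,3)[OF yv] B(2,3)[OF yv(1) that] by simp
    show "Escale F c (h (\<eta> y v)) = h (\<eta> y (\<lambda>i\<in>{..<n}. c * v i))" for c
      using B(6)[OF yv] scale[of "\<eta> y v"] B(2)[OF yv] by simp
  next
    fix f assume f: "f \<in> Epts F" "Eproj F f \<in> U"
    then show "h (\<eta> (Eproj F f) (\<kappa> (k f))) = f"
      using B(7)[OF kt] pk hk by simp
  qed (rule B(1))
  then show "\<exists>U n \<eta> \<kappa>. x \<in> U \<and> bundle_chart T F U n \<eta> \<kappa>"
    using x by blast
qed

text \<open>
  Bundles may thus be replaced by isomorphic ones without separate proofs of the axioms.
\<close>

lemma magnetic_bundle_iso:
  assumes "bundle_iso L E F" and E: "magnetic_bundle L X E" and L: "topological_group L"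
  shows "magnetic_bundle L X F"
proof -
  obtain h k where hk: "bundle_isomorphisms L E F h k"
    using assms(1) by (auto simp: bundle_iso_iff)
  note h = bundle_isomorphismsD[OF hk]
  note M = magnetic_bundleD[OF E L]
  note ops = complex_vector_bundle_ops[OF M(1)]
  have kadd: "k (Eadd F f f') = Eadd E (k f) (k f')"
    and kscale: "k (Escale F c f) = Escale E c (k f)"
    if "f \<in> Epts F" "f' \<in> Epts F" "Eproj F f' = Eproj F f" for f f' c
    using h(9)[of "k f" "k f'"] h(10)[of "k f" c] h(3)[of "Eadd E (k f) (k f')"]
      h(3)[of "Escale E c (k f)"] ops[of "k f"] that h(4,6,8) by simp_all
  have act: "Eact F g f = h (Eact E g (k f))" if "g \<in> carrier L" "f \<in> Epts F" for g f
    using h(11)[OF that(1) h(6)[OF that(2)]] h(4)[OF that(2)] by simp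
  show ?thesis
  proof (rule magnetic_bundleI)
    show "complex_vector_bundle (Xtop X) F"
      by (rule complex_vector_bundle_transport[OF M(1) h(1-4,7,9,10)])
    have "continuous_map (prod_topology (Gtop L) (Etop F)) (Etop F) (\<lambda>z. h (Eact E (fst z) (k (snd z))))"
      by (intro continuous_map_compose_app[OF _ h(1)] magnetic_bundle_act_continuous[OF E]
          continuous_map_fst continuous_map_compose_app[OF continuous_map_snd h(2)])
    then show "continuous_map (prod_topology (Gtop L) (Etop F)) (Etop F) (\<lambda>(g, e). Eact F g e)"
      by (rule continuous_map_eq) (auto simp: act topological_groupD(3)[OF L])
  next
    fix f assume f: "f \<in> Epts F"
    show "Eact F \<one>\<^bsub>L\<^esub> f = f"
      using act[OF monoid.one_closed[OF topological_groupD(2)[OF L]] f] M(5)[OF h(6)[OF f]] h(4)[OF f]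
      by simp
  next
    fix g h' f assume a: "g \<in> carrier L" "h' \<in> carrier L" "f \<in> Epts F"
    have "Eact F (g \<otimes>\<^bsub>L\<^esub> h') f = h (Eact E g (Eact E h' (k f)))"
      using act[OF monoid.m_closed[OF topological_groupD(2)[OF L] a(1,2)] a(3)]
        M(6)[OF a(1,2) h(6)[OF a(3)]] by simp
    also have "\<dots> = Eact F g (Eact F h' f)"
      using h(11)[OF a(1) M(10)[OF a(2) h(6)[OF a(3)]]] act[OF a(2,3)] by simp
    finally show "Eact F (g \<otimes>\<^bsub>L\<^esub> h') f = Eact F g (Eact F h' f)" .
  next
    fix g f assume a: "g \<in> carrier L" "f \<in> Epts F"
    then show "Eproj F (Eact F g f) = Xact X g (Eproj F f)"
      using M(7)[OF a(1) h(6)[OF a(2)]] M(10)[OF a(1) h(6)[OF a(2)]] h(7,8) by (simp add: act)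
  next
    fix g f f' assume a: "g \<in> carrier L" "f \<in> Epts F" "f' \<in> Epts F"
      "Eproj F f' = Eproj F f"
    have "Eadd F f f' \<in> Epts F"
      using h(5)[OF conjunct1[OF ops(1)[OF h(6)[OF a(2)] h(6)[OF a(3)]]]] h(9)[OF h(6)[OF a(2)] h(6)[OF a(3)]]
        h(4,8) a by simp
    then show "Eact F g (Eadd F f f') = Eadd F (Eact F g f) (Eact F g f')"
      using a M(8)[OF a(1) h(6)[OF a(2)] h(6)[OF a(3)]] kadd[OF a(2-4)] h(8)
        h(9)[OF M(10)[OF a(1) h(6)[OF a(2)]] M(10)[OF a(1) h(6)[OF a(3)]]]
        M(7)[OF a(1) h(6)[OF a(2)]] M(7)[OF a(1) h(6)[OF a(3)]]
      by (simp add: act)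
  next
    fix g c f assume a: "g \<in> carrier L" "f \<in> Epts F"
    have "Escale F c f \<in> Epts F"
      using h(5)[OF ops(2)[OF h(6)[OF a(2)]]] h(10)[OF h(6)[OF a(2)]] h(4) a by simp
    then show "Eact F g (Escale F c f) = Escale F (if Gdeg L g = 0 then c else cnj c) (Eact F g f)"
      using a M(9)[OF a(1) h(6)[OF a(2)]] kscale[OF a(2) a(2) refl]
        h(10)[OF M(10)[OF a(1) h(6)[OF a(2)]]]
      by (simp add: act)
  qed
qed

lemma bundle_sum_sel:
  "Eproj (E \<oplus>\<^sub>B F) = (\<lambda>z. Eproj E (fst z))"
  "Eadd (E \<oplus>\<^sub>B F) = (\<lambda>z w. (Eadd E (fst z) (fst w), Eadd F (snd z) (snd w)))"
  "Escale (E \<oplus>\<^sub>B F) = (\<lambda>c z. (Escale E c (fst z), Escale F c (snd z)))"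
  "Eact (E \<oplus>\<^sub>B F) = (\<lambda>g z. (Eact E g (fst z), Eact F g (snd z)))"
  by (auto simp: bundle_sum_def fun_eq_iff)

lemma topspace_bundle_sum:
  "z \<in> Epts (E \<oplus>\<^sub>B F) \<longleftrightarrow>
     fst z \<in> Epts E \<and> snd z \<in> Epts F \<and> Eproj E (fst z) = Eproj F (snd z)"
  by (cases z) (auto simp: bundle_sum_def)

lemmas sum_simps = topspace_bundle_sum bundle_sum_sel

lemma continuous_map_bundle_sumI:
  assumes "continuous_map X (Etop E) f" "continuous_map X (Etop F) g"
    and "\<And>x. x \<in> topspace X \<Longrightarrow> Eproj E (f x) = Eproj F (g x)"
  shows "continuous_map X (Etop (E \<oplus>\<^sub>B F)) (\<lambda>x. (f x, g x))"
  using assms by (auto simp: bundle_sum_def intro!: continuous_map_subtopologyI continuous_map_pairedI)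

lemma continuous_map_bundle_sumD:
  assumes "continuous_map X (Etop (E \<oplus>\<^sub>B F)) f"
  shows "continuous_map X (Etop E) (\<lambda>x. fst (f x))" "continuous_map X (Etop F) (\<lambda>x. snd (f x))"
  using assms
  by (auto simp: bundle_sum_def continuous_map_in_subtopology
      intro: continuous_map_fst_app continuous_map_snd_app)

text \<open>
  The coordinate vectors of the summands over a common domain are concatenated.
\<close>

lemma complex_vector_bundle_sum:
  assumes E: "complex_vector_bundle T E" and F: "complex_vector_bundle T F"
  shows "complex_vector_bundle T (E \<oplus>\<^sub>B F)"
  unfolding complex_vector_bundle_iff_charts
proof (intro conjI ballI)
  note idS = continuous_map_bundle_sumD[OF continuous_map_ident]
  show "continuous_map (Etop (E \<oplus>\<^sub>B F)) T (Eproj (E \<oplus>\<^sub>B F))"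
    unfolding bundle_sum_sel
    by (rule continuous_map_compose_app[OF idS(1) complex_vector_bundle_proj(1)[OF E]])
  fix x assume x: "x \<in> topspace T"
  obtain U n \<eta> \<kappa> where xU: "x \<in> U" and c: "bundle_chart T E U n \<eta> \<kappa>"
    using complex_vector_bundleE[OF E x] by metis
  obtain U' m \<eta>' \<kappa>' where xU': "x \<in> U'" and c': "bundle_chart T F U' m \<eta>' \<kappa>'"
    using complex_vector_bundleE[OF F x] by metis
  note B = bundle_chartD[OF c] and B' = bundle_chartD[OF c']
  define H where "H y v = (\<eta> y (\<lambda>i\<in>{..<n}. v i), \<eta>' y (\<lambda>i\<in>{..<m}. v (n + i)))" for y and v :: "nat \<Rightarrow> complex"
  define K where "K z = (\<lambda>i\<in>{..<n + m}. if i < n then \<kappa> (fst z) i else \<kappa>' (snd z) (i - n))" for z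
  have "bundle_chart T (E \<oplus>\<^sub>B F) (U \<inter> U') (n + m) H K"
    unfolding bundle_chart_def
  proof (intro conjI ballI allI impI)
    show "openin T (U \<inter> U')" using B(1) B'(1) by (rule openin_Int)
    let ?P = "prod_topology (subtopology T (U \<inter> U')) (complex_space (n + m))"
    have f: "continuous_map ?P T fst"
      using continuous_map_fst[of "subtopology T (U \<inter> U')" "complex_space (n + m)"]
      by (simp add: continuous_map_in_subtopology)
    have s: "continuous_map ?P (complex_space (n + m)) snd"
      by (rule continuous_map_snd)
    have s1: "continuous_map ?P (complex_space n) (\<lambda>z. \<lambda>i\<in>{..<n}. snd z i)"
      and s2: "continuous_map ?P (complex_space m) (\<lambda>z. \<lambda>i\<in>{..<m}. snd z (n + i))"
      using s unfolding continuous_map_complex_space by simp_all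
    have "continuous_map ?P (Etop (E \<oplus>\<^sub>B F)) (\<lambda>z. H (fst z) (snd z))"
      unfolding H_def
    proof (rule continuous_map_bundle_sumI)
      show "continuous_map ?P (Etop E) (\<lambda>z. \<eta> (fst z) (\<lambda>i\<in>{..<n}. snd z i))"
        by (rule B(9)[OF f _ s1]) auto
      show "continuous_map ?P (Etop F) (\<lambda>z. \<eta>' (fst z) (\<lambda>i\<in>{..<m}. snd z (n + i)))"
        by (rule B'(9)[OF f _ s2]) auto
    qed (auto simp: B(3) B'(3))
    then show "continuous_map ?P (Etop (E \<oplus>\<^sub>B F)) (\<lambda>(y, v). H y v)"
      by (simp add: case_prod_beta')
    let ?D = "subtopology (Etop (E \<oplus>\<^sub>B F)) {z \<in> Epts (E \<oplus>\<^sub>B F). Eproj (E \<oplus>\<^sub>B F) z \<in> U \<inter> U'}"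
    have "continuous_map ?D (complex_space n) (\<lambda>z. \<kappa> (fst z))"
      "continuous_map ?D (complex_space m) (\<lambda>z. \<kappa>' (snd z))"
      by (rule B(10) B'(10),
          auto simp: sum_simps intro: continuous_map_from_subtopology idS)+
    then show "continuous_map ?D (complex_space (n + m)) K"
      unfolding K_def continuous_map_complex_space by auto
  next
    fix y and v :: "nat \<Rightarrow> complex" assume "y \<in> U \<inter> U'" and v: "v \<in> extensional {..<n + m}"
    then have y: "y \<in> U" "y \<in> U'" by auto
    show "Eproj (E \<oplus>\<^sub>B F) (H y v) = y"
      by (simp add: bundle_sum_sel H_def B(3) y)
    show "K (H y v) = v"
      using v by (intro extensionalityI[of _ "{..<n + m}"]) (auto simp: K_def H_def B(4) B'(4) y)
    show "Eadd (E \<oplus>\<^sub>B F) (H y v) (H y w) = H y (\<lambda>i\<in>{..<n + m}. v i + w i)"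
      if "w \<in> extensional {..<n + m}" for w
      by (auto simp: bundle_sum_sel H_def B(5) B'(5) y cong: restrict_cong intro!: arg_cong[where f = "\<eta> y"] arg_cong[where f = "\<eta>' y"])
    show "Escale (E \<oplus>\<^sub>B F) c (H y v) = H y (\<lambda>i\<in>{..<n + m}. c * v i)" for c
      by (auto simp: bundle_sum_sel H_def B(6) B'(6) y cong: restrict_cong intro!: arg_cong[where f = "\<eta> y"] arg_cong[where f = "\<eta>' y"])
  next
    fix z assume z: "z \<in> Epts (E \<oplus>\<^sub>B F)" and zU: "Eproj (E \<oplus>\<^sub>B F) z \<in> U \<inter> U'"
    have 1: "(\<lambda>i\<in>{..<n}. K z i) = \<kappa> (fst z)"
      by (rule extensionalityI[of _ "{..<n}"]) (use z zU B(8) in \<open>auto simp: K_def sum_simps\<close>)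
    have 2: "(\<lambda>i\<in>{..<m}. K z (n + i)) = \<kappa>' (snd z)"
      by (rule extensionalityI[of _ "{..<m}"]) (use z zU B'(8) in \<open>auto simp: K_def sum_simps\<close>)
    show "H (Eproj (E \<oplus>\<^sub>B F) z) (K z) = z"
      unfolding H_def 1 2 using z zU B(7)[of "fst z"] B'(7)[of "snd z"]
      by (auto simp: sum_simps prod_eq_iff)
  qed
  then show "\<exists>U n \<eta> \<kappa>. x \<in> U \<and> bundle_chart T (E \<oplus>\<^sub>B F) U n \<eta> \<kappa>"
    using xU xU' by blast
qed

lemma magnetic_bundle_sum:
  assumes E: "magnetic_bundle L X E" and F: "magnetic_bundle L X F" and L: "topological_group L"
  shows "magnetic_bundle L X (E \<oplus>\<^sub>B F)"
proof (rule magnetic_bundleI)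
  note ME = magnetic_bundleD[OF E L] and MF = magnetic_bundleD[OF F L]
  note opE = complex_vector_bundle_ops[OF ME(1)] and opF = complex_vector_bundle_ops[OF MF(1)]
  show "complex_vector_bundle (Xtop X) (E \<oplus>\<^sub>B F)"
    by (rule complex_vector_bundle_sum[OF ME(1) MF(1)])
  note s = continuous_map_bundle_sumD[OF continuous_map_snd[of "Gtop L" "Etop (E \<oplus>\<^sub>B F)"]]
  show "continuous_map (prod_topology (Gtop L) (Etop (E \<oplus>\<^sub>B F))) (Etop (E \<oplus>\<^sub>B F))
      (\<lambda>(g, e). Eact (E \<oplus>\<^sub>B F) g e)"
    unfolding case_prod_beta' bundle_sum_sel
    by (intro continuous_map_bundle_sumI magnetic_bundle_act_continuous[OF E]
        magnetic_bundle_act_continuous[OF F] continuous_map_fst s)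
      (auto simp: topspace_bundle_sum ME(7) MF(7) topological_groupD(3)[OF L])
qed (use magnetic_bundleD(5-9)[OF E L] magnetic_bundleD(5-9)[OF F L] in
    \<open>auto simp: bundle_sum_sel topspace_bundle_sum\<close>)

lemma bundle_sum_iso_cong:
  assumes "bundle_iso L E E'" "bundle_iso L F F'"
  shows "bundle_iso L (E \<oplus>\<^sub>B F) (E' \<oplus>\<^sub>B F')"
proof -
  obtain h k where hk: "bundle_isomorphisms L E E' h k"
    using assms(1) by (auto simp: bundle_iso_iff)
  note h = bundle_isomorphismsD[OF hk]
  obtain h' k' where h'k': "bundle_isomorphisms L F F' h' k'"
    using assms(2) by (auto simp: bundle_iso_iff)
  note h' = bundle_isomorphismsD[OF h'k']
  show ?thesis
    by (rule bundle_isoI[where h = "\<lambda>z. (h (fst z), h' (snd z))" and k = "\<lambda>z. (k (fst z), k' (snd z))"])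
      (auto simp: sum_simps h(3-) h'(3-)
        intro!: continuous_map_bundle_sumI continuous_map_compose_app[OF _ h(1)]
          continuous_map_compose_app[OF _ h(2)] continuous_map_compose_app[OF _ h'(1)]
          continuous_map_compose_app[OF _ h'(2)] continuous_map_bundle_sumD[OF continuous_map_ident])
qed

lemma bundle_sum_iso_commute:
  "bundle_iso L (E \<oplus>\<^sub>B F) (F \<oplus>\<^sub>B E)"
  by (rule bundle_isoI[where h = "\<lambda>z. (snd z, fst z)" and k = "\<lambda>z. (snd z, fst z)"])
    (auto simp: sum_simps
      intro!: continuous_map_bundle_sumI continuous_map_bundle_sumD[OF continuous_map_ident])

lemma bundle_sum_iso_assoc:
  "bundle_iso L (E \<oplus>\<^sub>B F \<oplus>\<^sub>B H) (E \<oplus>\<^sub>B (F \<oplus>\<^sub>B H))"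
proof -
  note i = continuous_map_bundle_sumD[OF continuous_map_ident]
  show ?thesis
    by (rule bundle_isoI[where h = "\<lambda>z. (fst (fst z), (snd (fst z), snd z))"
            and k = "\<lambda>z. ((fst z, fst (snd z)), snd (snd z))"])
      (auto simp: sum_simps
        intro!: continuous_map_bundle_sumI continuous_map_bundle_sumD[OF i(1)]
          continuous_map_bundle_sumD[OF i(2)] i)
qed

lemma G_spaceD:
  assumes "G_space L X" and "topological_group L"
  shows "continuous_map Z (Gtop L) f \<Longrightarrow> continuous_map Z (Xtop X) x \<Longrightarrow>
           continuous_map Z (Xtop X) (\<lambda>z. Xact X (f z) (x z))"
    and "x' \<in> topspace (Xtop X) \<Longrightarrow> Xact X \<one>\<^bsub>L\<^esub> x' = x'"
    and "g \<in> carrier L \<Longrightarrow> h \<in> carrier L \<Longrightarrow> x' \<in> topspace (Xtop X) \<Longrightarrow>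
           Xact X (g \<otimes>\<^bsub>L\<^esub> h) x' = Xact X g (Xact X h x')"
    and "g \<in> carrier L \<Longrightarrow> x' \<in> topspace (Xtop X) \<Longrightarrow> Xact X g x' \<in> topspace (Xtop X)"
proof -
  have act: "continuous_map (prod_topology (Gtop L) (Xtop X)) (Xtop X) (\<lambda>(g, x). Xact X g x)"
    using assms(1) by (simp add: G_space_def)
  show "continuous_map Z (Gtop L) f \<Longrightarrow> continuous_map Z (Xtop X) x \<Longrightarrow>
           continuous_map Z (Xtop X) (\<lambda>z. Xact X (f z) (x z))"
    by (rule continuous_map_apply2[OF act])
  show "g \<in> carrier L \<Longrightarrow> x' \<in> topspace (Xtop X) \<Longrightarrow> Xact X g x' \<in> topspace (Xtop X)"
    using continuous_map_in_topspace[OF act, of "(g, x')"] topological_groupD(3)[OF assms(2)] by simp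
qed (use assms in \<open>auto simp: G_space_def\<close>)

lemma magnetic_bundle_zero:
  assumes "G_space L X" "topological_group L"
  shows "magnetic_bundle L X (zero_bundle X)"
proof (rule magnetic_bundleI)
  have "bundle_chart (Xtop X) (zero_bundle X) (topspace (Xtop X)) 0 (\<lambda>y v. y) (\<lambda>e i. undefined)"
    using continuous_map_fst[of "Xtop X" "complex_space 0"]
    by (auto simp: bundle_chart_def zero_bundle_def extensional_def continuous_map_complex_space
        topspace_complex_space case_prod_beta')
  then show "complex_vector_bundle (Xtop X) (zero_bundle X)"
    unfolding complex_vector_bundle_iff_charts
    by (auto simp: zero_bundle_def continuous_map_ident)
qed (use assms in \<open>auto simp: zero_bundle_def G_space_def\<close>)

lemma bundle_sum_iso_zero:
  assumes E: "magnetic_bundle L X E" and L: "topological_group L"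
  shows "bundle_iso L (E \<oplus>\<^sub>B zero_bundle X) E"
proof -
  note M = magnetic_bundleD[OF E L]
  have [simp]: "Etop (zero_bundle X) = Xtop X" "Eproj (zero_bundle X) = (\<lambda>x. x)"
    "Eact (zero_bundle X) = Xact X" "Eadd (zero_bundle X) = (\<lambda>x y. x)"
    "Escale (zero_bundle X) = (\<lambda>c x. x)"
    by (simp_all add: zero_bundle_def)
  show ?thesis
    by (rule bundle_isoI[where h = fst and k = "\<lambda>e. (e, Eproj E e)"])
      (auto simp: sum_simps M(3)
        intro!: continuous_map_bundle_sumI continuous_map_ident M(2)
          continuous_map_bundle_sumD(1)[OF continuous_map_ident])
qed

section \<open>Standard bundles and pullbacks\<close>

text \<open>
  The fibres embed into the coordinate lists after a choice of coordinates in each of them, and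
  all the structure is transported along the resulting injection.
\<close>

lemma standard_bundle_exists:
  fixes E :: "('g, 'x, 'e) gbundle"
  assumes E: "complex_vector_bundle T E"
  obtains P :: "('g, 'x) std_bundle" where "bundle_iso L E P"
proof -
  note p = complex_vector_bundle_proj[OF E]
  have "\<exists>j :: 'e \<Rightarrow> complex list. \<forall>e\<in>Epts E. \<forall>e'\<in>Epts E.
      Eproj E e = x \<longrightarrow> Eproj E e' = x \<longrightarrow> j e = j e' \<longrightarrow> e = e'" if "x \<in> topspace T" for x
  proof -
    from E that show ?thesis
    proof (rule fibre_coordinates)
      fix n and \<eta> :: "(nat \<Rightarrow> complex) \<Rightarrow> 'e" and \<kappa>
      assume \<kappa>: "\<And>e. e \<in> Epts E \<Longrightarrow> Eproj E e = x \<Longrightarrow> \<kappa> e \<in> extensional {..<n} \<and> \<eta> (\<kappa> e) = e"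
      have "e = e'" if "e \<in> Epts E" "e' \<in> Epts E" "Eproj E e = x" "Eproj E e' = x"
        "map (\<kappa> e) [0..<n] = map (\<kappa> e') [0..<n]" for e e'
      proof -
        have "\<kappa> e = \<kappa> e'"
          by (rule extensionalityI[of _ "{..<n}"]) (use \<kappa> that in auto)
        then show ?thesis using \<kappa> that by metis
      qed
      then show ?thesis
        by (intro exI[of _ "\<lambda>e. map (\<kappa> e) [0..<n]"]) blast
    qed
  qed
  then obtain J :: "'x \<Rightarrow> 'e \<Rightarrow> complex list" where
    J: "\<And>x e e'. x \<in> topspace T \<Longrightarrow> e \<in> Epts E \<Longrightarrow> e' \<in> Epts E \<Longrightarrow>
          Eproj E e = x \<Longrightarrow> Eproj E e' = x \<Longrightarrow> J x e = J x e' \<Longrightarrow> e = e'"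
    by metis
  define j where "j e = (Eproj E e, J (Eproj E e) e)" for e
  have inj: "inj_on j (Epts E)"
    by (intro inj_onI) (auto simp: j_def intro: J p(2))
  define k where "k = inv_into (Epts E) j"
  have kj: "k (j e) = e" if "e \<in> Epts E" for e
    using inj that by (simp add: k_def)
  define P :: "('g, 'x) std_bundle" where
    "P = \<lparr>Etop = pullback_topology (j ` Epts E) k (Etop E),
          Eproj = (\<lambda>a. Eproj E (k a)), Eadd = (\<lambda>a b. j (Eadd E (k a) (k b))),
          Escale = (\<lambda>c a. j (Escale E c (k a))), Eact = (\<lambda>g a. j (Eact E g (k a)))\<rparr>"
  have top: "Epts P = j ` Epts E"
    using kj by (auto simp: P_def topspace_pullback_topology)
  have "bundle_iso L E P"
  proof (rule bundle_isoI[where h = j and k = k])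
    show "continuous_map (Etop P) (Etop E) k"
      using continuous_map_pullback[OF continuous_map_id, of "j ` Epts E" k "Etop E"]
      by (simp add: P_def)
    have "continuous_map (Etop E) (Etop E) (k \<circ> j)"
      by (rule continuous_map_eq[OF continuous_map_ident]) (simp add: kj)
    then show "continuous_map (Etop E) (Etop P) j"
      unfolding P_def by (auto intro!: continuous_map_pullback')
  qed (use kj in \<open>auto simp: top\<close>, simp_all add: P_def kj)
  then show thesis by (rule that)
qed

text \<open>
  Pullbacks and conjugate bundles both have this form, with \<open>\<gamma>\<close> the identity or the complex
  conjugation; for conjugate bundles \<open>f\<close> is the action of an antilinear group element.
\<close>

lemma complex_vector_bundle_pullback:
  fixes E :: "('g, 'x, 'e) gbundle" and P :: "('h, 'y, 'y \<times> 'e) gbundle"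
  assumes E: "complex_vector_bundle T E" and f: "continuous_map T' T f"
    and \<gamma>: "\<gamma> = (\<lambda>c. c) \<or> \<gamma> = cnj"
    and P: "Etop P = subtopology (prod_topology T' (Etop E)) {(y, e). f y = Eproj E e}"
      "Eproj P = fst" "Eadd P = (\<lambda>(y, e) (y', e'). (y, Eadd E e e'))"
      "Escale P = (\<lambda>c (y, e). (y, Escale E (\<gamma> c) e))"
  shows "complex_vector_bundle T' P"
  unfolding complex_vector_bundle_iff_charts
proof (intro conjI ballI)
  have \<gamma>_ops: "\<gamma> (\<gamma> a) = a" "\<gamma> (a + b) = \<gamma> a + \<gamma> b" "\<gamma> (a * b) = \<gamma> a * \<gamma> b" for a b
    using \<gamma> by auto
  have \<gamma>_cont: "continuous_map Z euclidean (\<lambda>z. \<gamma> (g z))" if "continuous_map Z euclidean g" for Z :: "'z topology" and g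
    using \<gamma> continuous_map_complex_ops(3)[OF that] that by auto
  have PD: "continuous_map (Etop P) T' fst" "continuous_map (Etop P) (Etop E) snd"
    by (auto simp: P intro: continuous_map_from_subtopology continuous_map_fst continuous_map_snd)
  have topP: "z \<in> Epts P \<longleftrightarrow>
      fst z \<in> topspace T' \<and> snd z \<in> Epts E \<and> f (fst z) = Eproj E (snd z)" for z
    by (cases z) (auto simp: P)
  show "continuous_map (Etop P) T' (Eproj P)"
    using PD by (simp add: P)
  fix y0 assume y0: "y0 \<in> topspace T'"
  obtain U n \<eta> \<kappa> where xU: "f y0 \<in> U" and c: "bundle_chart T E U n \<eta> \<kappa>"
    using complex_vector_bundleE[OF E continuous_map_in_topspace[OF f y0]] by metis
  note B = bundle_chartD[OF c]
  define V where "V = {y \<in> topspace T'. f y \<in> U}"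
  define H where "H y v = (y, \<eta> (f y) (\<lambda>i\<in>{..<n}. \<gamma> (v i)))" for y and v :: "nat \<Rightarrow> complex"
  define K where "K z = (\<lambda>i\<in>{..<n}. \<gamma> (\<kappa> (snd z) i))" for z :: "'y \<times> 'e"
  have "bundle_chart T' P V n H K"
    unfolding bundle_chart_def
  proof (intro conjI ballI allI impI)
    show "openin T' V"
      unfolding V_def by (rule openin_continuous_map_preimage[OF f B(1)])
    let ?P = "prod_topology (subtopology T' V) (complex_space n)"
    have fs: "continuous_map ?P T' fst"
      using continuous_map_fst[of "subtopology T' V" "complex_space n"]
      by (simp add: continuous_map_in_subtopology)
    have s1: "continuous_map ?P (complex_space n) (\<lambda>z. \<lambda>i\<in>{..<n}. \<gamma> (snd z i))"
      using continuous_map_snd[of "subtopology T' V" "complex_space n"]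
      unfolding continuous_map_complex_space by (auto intro: \<gamma>_cont)
    have "continuous_map ?P (Etop E) (\<lambda>z. \<eta> (f (fst z)) (\<lambda>i\<in>{..<n}. \<gamma> (snd z i)))"
      by (rule B(9)[OF continuous_map_compose_app[OF fs f] _ s1]) (auto simp: V_def)
    then have "continuous_map ?P (Etop P) (\<lambda>z. H (fst z) (snd z))"
      unfolding H_def P
      by (intro continuous_map_subtopologyI continuous_map_pairedI fs) (auto simp: V_def B(3))
    then show "continuous_map ?P (Etop P) (\<lambda>(y, v). H y v)"
      by (simp add: case_prod_beta')
    let ?D = "subtopology (Etop P) {z \<in> Epts P. Eproj P z \<in> V}"
    have "continuous_map ?D (complex_space n) (\<lambda>z. \<kappa> (snd z))"
      by (rule B(10)) (auto simp: topP V_def P(2) intro: continuous_map_from_subtopology PD)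
    then show "continuous_map ?D (complex_space n) K"
      unfolding K_def continuous_map_complex_space by (auto intro: \<gamma>_cont)
  next
    fix y and v :: "nat \<Rightarrow> complex" assume "y \<in> V" and v: "v \<in> extensional {..<n}"
    then have y: "f y \<in> U" by (auto simp: V_def)
    show "Eproj P (H y v) = y"
      by (simp add: P H_def)
    show "K (H y v) = v"
      using v by (intro extensionalityI[of _ "{..<n}"]) (auto simp: K_def H_def B(4) y \<gamma>_ops)
    show "Eadd P (H y v) (H y w) = H y (\<lambda>i\<in>{..<n}. v i + w i)"
      if "w \<in> extensional {..<n}" for w
      by (auto simp: P H_def B(5) y \<gamma>_ops cong: restrict_cong intro!: arg_cong[where f = "\<eta> (f y)"])
    show "Escale P c (H y v) = H y (\<lambda>i\<in>{..<n}. c * v i)" for c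
      by (auto simp: P H_def B(6) y \<gamma>_ops cong: restrict_cong intro!: arg_cong[where f = "\<eta> (f y)"])
  next
    fix z assume z: "z \<in> Epts P" and zU: "Eproj P z \<in> V"
    have "(\<lambda>i\<in>{..<n}. \<gamma> (K z i)) = \<kappa> (snd z)"
      by (rule extensionalityI[of _ "{..<n}"]) (use z zU B(8) in \<open>auto simp: K_def topP P(2) V_def \<gamma>_ops\<close>)
    then show "H (Eproj P z) (K z) = z"
      unfolding H_def using z zU B(7)[of "snd z"] by (auto simp: topP P(2) V_def prod_eq_iff)
  qed
  moreover have "y0 \<in> V" using y0 xU by (simp add: V_def)
  ultimately show "\<exists>U n \<eta> \<kappa>. y0 \<in> U \<and> bundle_chart T' P U n \<eta> \<kappa>"
    by blast
qed

lemma pullback_bundle_sel: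
  "Eproj (pullback_bundle Y f E) = fst"
  "Eadd (pullback_bundle Y f E) = (\<lambda>z w. (fst z, Eadd E (snd z) (snd w)))"
  "Escale (pullback_bundle Y f E) = (\<lambda>c z. (fst z, Escale E c (snd z)))"
  "Eact (pullback_bundle Y f E) = (\<lambda>g z. (Xact Y g (fst z), Eact E g (snd z)))"
  by (auto simp: pullback_bundle_def fun_eq_iff)

lemma topspace_pullback_bundle:
  "z \<in> Epts (pullback_bundle Y f E) \<longleftrightarrow>
     fst z \<in> topspace (Xtop Y) \<and> snd z \<in> Epts E \<and> f (fst z) = Eproj E (snd z)"
  by (cases z) (auto simp: pullback_bundle_def)

lemmas pullback_simps = topspace_pullback_bundle pullback_bundle_sel

lemma continuous_map_pullback_bundleI:
  assumes "continuous_map Z (Xtop Y) a" "continuous_map Z (Etop E) b"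
    and "\<And>x. x \<in> topspace Z \<Longrightarrow> f (a x) = Eproj E (b x)"
  shows "continuous_map Z (Etop (pullback_bundle Y f E)) (\<lambda>x. (a x, b x))"
  using assms by (auto simp: pullback_bundle_def intro!: continuous_map_subtopologyI continuous_map_pairedI)

lemma continuous_map_pullback_bundleD:
  assumes "continuous_map Z (Etop (pullback_bundle Y f E)) a"
  shows "continuous_map Z (Xtop Y) (\<lambda>x. fst (a x))" "continuous_map Z (Etop E) (\<lambda>x. snd (a x))"
  using assms
  by (auto simp: pullback_bundle_def continuous_map_in_subtopology
      intro: continuous_map_fst_app continuous_map_snd_app)

lemma magnetic_bundle_pullback:
  assumes E: "magnetic_bundle L X E" and L: "topological_group L" and Y: "G_space L Y"
    and f: "continuous_map (Xtop Y) (Xtop X) f"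
    and equiv: "\<And>g y. g \<in> carrier L \<Longrightarrow> y \<in> topspace (Xtop Y) \<Longrightarrow> f (Xact Y g y) = Xact X g (f y)"
  shows "magnetic_bundle L Y (pullback_bundle Y f E)"
proof (rule magnetic_bundleI)
  note M = magnetic_bundleD[OF E L] and S = G_spaceD[OF Y L]
  show "complex_vector_bundle (Xtop Y) (pullback_bundle Y f E)"
    by (rule complex_vector_bundle_pullback[OF M(1) f, where \<gamma> = "\<lambda>c. c"])
      (simp_all add: pullback_bundle_def)
  note s = continuous_map_pullback_bundleD[OF continuous_map_snd[of "Gtop L" "Etop (pullback_bundle Y f E)"]]
  show "continuous_map (prod_topology (Gtop L) (Etop (pullback_bundle Y f E)))
      (Etop (pullback_bundle Y f E)) (\<lambda>(g, e). Eact (pullback_bundle Y f E) g e)"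
    unfolding case_prod_beta' pullback_bundle_sel
    by (intro continuous_map_pullback_bundleI magnetic_bundle_act_continuous[OF E] S(1)
        continuous_map_fst s)
      (auto simp: topspace_pullback_bundle equiv M(7) topological_groupD(3)[OF L])
qed (use magnetic_bundleD(5-9)[OF E L] G_spaceD[OF Y L] in
    \<open>auto simp: pullback_bundle_sel topspace_pullback_bundle\<close>)

lemma pullback_bundle_additive:
  assumes "bundle_iso L (E \<oplus>\<^sub>B F) H"
  shows "bundle_iso L (pullback_bundle Y f E \<oplus>\<^sub>B pullback_bundle Y f F) (pullback_bundle Y f H)"
proof -
  obtain h k where hk: "bundle_isomorphisms L (E \<oplus>\<^sub>B F) H h k"
    using assms by (auto simp: bundle_iso_iff)
  note h = bundle_isomorphismsD[OF hk]
  note h' = h(3-)[unfolded topspace_bundle_sum bundle_sum_sel]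
  note i = continuous_map_bundle_sumD[OF continuous_map_ident]
  let ?E = "pullback_bundle Y f E" and ?F = "pullback_bundle Y f F" and ?H = "pullback_bundle Y f H"
  show ?thesis
  proof (rule bundle_isoI[where h = "\<lambda>z. (fst (fst z), h (snd (fst z), snd (snd z)))"
        and k = "\<lambda>w. ((fst w, fst (k (snd w))), (fst w, snd (k (snd w))))"])
    show "continuous_map (Etop (?E \<oplus>\<^sub>B ?F)) (Etop ?H) (\<lambda>z. (fst (fst z), h (snd (fst z), snd (snd z))))"
      by (intro continuous_map_pullback_bundleI continuous_map_compose_app[OF _ h(1)]
          continuous_map_bundle_sumI continuous_map_pullback_bundleD[OF i(1)]
          continuous_map_pullback_bundleD[OF i(2)])
        (auto simp: sum_simps pullback_simps h')
    note j = continuous_map_pullback_bundleD[OF continuous_map_ident]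
    show "continuous_map (Etop ?H) (Etop (?E \<oplus>\<^sub>B ?F)) (\<lambda>w. ((fst w, fst (k (snd w))), (fst w, snd (k (snd w)))))"
      by (intro continuous_map_pullback_bundleI continuous_map_bundle_sumI j
          continuous_map_bundle_sumD[OF continuous_map_compose_app[OF j(2) h(2)]])
        (use h' in \<open>auto simp: sum_simps pullback_simps\<close>)
  qed (use h' in \<open>auto simp: sum_simps pullback_simps prod_eq_iff\<close>)
qed

section \<open>Magnetic groups and the transfer\<close>

locale magnetic =
  fixes L :: "'g graded_group" (structure) and a\<^sub>0 :: 'g
  assumes top: "topological_group L"
    and deg_hom: "Gdeg L \<in> hom L (integer_mod_group 2)"
    and deg_cont: "continuous_map (Gtop L) (discrete_topology (carrier (integer_mod_group 2))) (Gdeg L)"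
    and a\<^sub>0: "a\<^sub>0 \<in> carrier L" "Gdeg L a\<^sub>0 \<noteq> 0"
begin

sublocale group L
  by (rule topological_groupD(1)[OF top])

abbreviation "L\<^sub>0 \<equiv> kernel_group L"

lemma deg_mult: "g \<in> carrier L \<Longrightarrow> h \<in> carrier L \<Longrightarrow> Gdeg L (g \<otimes> h) = (Gdeg L g + Gdeg L h) mod 2"
  using deg_hom by (simp add: hom_def)

lemma deg_cases: "g \<in> carrier L \<Longrightarrow> Gdeg L g = 0 \<or> Gdeg L g = 1"
  using deg_hom by (force simp: hom_def carrier_integer_mod_group)

lemma deg_one: "Gdeg L \<one> = 0"
  using hom_one[OF deg_hom is_group group_integer_mod_group] by simp

lemma deg_inv: "g \<in> carrier L \<Longrightarrow> Gdeg L (inv g) = Gdeg L g"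
  using deg_mult[of g "inv g"] deg_cases[of g] deg_cases[of "inv g"] deg_one by auto

lemma deg_a\<^sub>0: "Gdeg L a\<^sub>0 = 1"
  using deg_cases[OF a\<^sub>0(1)] a\<^sub>0(2) by simp

lemma kernel_group_sel:
  "carrier L\<^sub>0 = {g \<in> carrier L. Gdeg L g = 0}" "x \<otimes>\<^bsub>L\<^sub>0\<^esub> y = x \<otimes> y" "\<one>\<^bsub>L\<^sub>0\<^esub> = \<one>"
  "Gtop L\<^sub>0 = subtopology (Gtop L) (carrier L\<^sub>0)" "Gdeg L\<^sub>0 = Gdeg L"
  by (auto simp: kernel_group_def kernel_def Let_def)

lemma continuous_map_kernel_group:
  "continuous_map Z (Gtop L\<^sub>0) f \<longleftrightarrow> continuous_map Z (Gtop L) f \<and> (\<forall>z\<in>topspace Z. f z \<in> carrier L\<^sub>0)"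
  unfolding kernel_group_sel(4) continuous_map_in_subtopology by auto

lemma continuous_map_group_mult:
  "continuous_map Z (Gtop L) f \<Longrightarrow> continuous_map Z (Gtop L) g \<Longrightarrow>
     continuous_map Z (Gtop L) (\<lambda>z. f z \<otimes> g z)"
  by (rule continuous_map_apply2[OF topological_groupD(4)[OF top]])

lemma continuous_map_group_const:
  "g \<in> carrier L \<Longrightarrow> continuous_map Z (Gtop L) (\<lambda>z. g)"
  using topological_groupD(3)[OF top] by simp

lemma subgroup_kernel_group: "subgroup (carrier L\<^sub>0) L"
  by unfold_locales (auto simp: kernel_group_sel deg_mult deg_one deg_inv)

lemma group_kernel_group: "group L\<^sub>0"
proof (rule groupI)
  fix x assume "x \<in> carrier L\<^sub>0"
  then show "\<exists>y\<in>carrier L\<^sub>0. y \<otimes>\<^bsub>L\<^sub>0\<^esub> x = \<one>\<^bsub>L\<^sub>0\<^esub>"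
    by (intro bexI[of _ "inv x"]) (auto simp: kernel_group_sel deg_inv)
qed (auto simp: kernel_group_sel deg_mult deg_one m_assoc)

lemma inv_kernel_group: "g \<in> carrier L\<^sub>0 \<Longrightarrow> inv\<^bsub>L\<^sub>0\<^esub> g = inv g"
  by (rule group.inv_equality[OF group_kernel_group]) (auto simp: kernel_group_sel deg_inv)

lemma topological_group_kernel: "topological_group L\<^sub>0"
  unfolding topological_group_def
proof (intro conjI)
  show "topspace (Gtop L\<^sub>0) = carrier L\<^sub>0"
    unfolding kernel_group_sel(4) using topological_groupD(3)[OF top] by (auto simp: kernel_group_sel)
  then have ts: "topspace (Gtop L\<^sub>0) = carrier L\<^sub>0" .
  have id: "continuous_map (Gtop L\<^sub>0) (Gtop L) (\<lambda>x. x)"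
    unfolding kernel_group_sel(4) by (intro continuous_map_from_subtopology continuous_map_ident)
  have "continuous_map (prod_topology (Gtop L\<^sub>0) (Gtop L\<^sub>0)) (Gtop L) (\<lambda>z. fst z \<otimes> snd z)"
    by (intro continuous_map_group_mult continuous_map_compose_app[OF _ id]
        continuous_map_fst continuous_map_snd)
  then have "continuous_map (prod_topology (Gtop L\<^sub>0) (Gtop L\<^sub>0)) (Gtop L\<^sub>0) (\<lambda>z. fst z \<otimes> snd z)"
    using subgroup.m_closed[OF subgroup_kernel_group] by (simp add: continuous_map_kernel_group ts)
  then show "continuous_map (prod_topology (Gtop L\<^sub>0) (Gtop L\<^sub>0)) (Gtop L\<^sub>0) (\<lambda>(x, y). x \<otimes>\<^bsub>L\<^sub>0\<^esub> y)"
    by (simp add: case_prod_beta' kernel_group_sel(2))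
  have "continuous_map (Gtop L\<^sub>0) (Gtop L\<^sub>0) (\<lambda>x. inv x)"
    unfolding continuous_map_kernel_group
    using subgroup.m_inv_closed[OF subgroup_kernel_group] top
    by (auto intro!: continuous_map_compose_app[OF id] simp: ts topological_group_def)
  then show "continuous_map (Gtop L\<^sub>0) (Gtop L\<^sub>0) (\<lambda>x. inv\<^bsub>L\<^sub>0\<^esub> x)"
    by (rule continuous_map_eq) (simp add: ts inv_kernel_group)
qed (rule group_kernel_group)

text \<open>
  The even and the odd elements both form open sets, so continuity of an action can be checked
  on each of the two sets.
\<close>

lemma openin_degree: "openin (Gtop L) {g \<in> carrier L. Gdeg L g = d}"
proof (cases "d \<in> carrier (integer_mod_group 2)")
  case True
  then show ?thesis
    using openin_continuous_map_preimage[OF deg_cont, of "{d}"] topological_groupD(3)[OF top] by simp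
next
  case False
  then have "{g \<in> carrier L. Gdeg L g = d} = {}"
    using deg_hom by (auto simp: hom_def)
  then show ?thesis by (simp only: openin_empty)
qed

lemma parity:
  "g \<in> carrier L\<^sub>0 \<Longrightarrow> g \<in> carrier L"
  "g \<in> carrier L\<^sub>0 \<Longrightarrow> a\<^sub>0 \<otimes> g \<otimes> inv a\<^sub>0 \<in> carrier L\<^sub>0"
  "g \<in> carrier L \<Longrightarrow> Gdeg L g \<noteq> 0 \<Longrightarrow> a\<^sub>0 \<otimes> g \<in> carrier L\<^sub>0"
  "g \<in> carrier L \<Longrightarrow> Gdeg L g \<noteq> 0 \<Longrightarrow> g \<otimes> inv a\<^sub>0 \<in> carrier L\<^sub>0"
  using a\<^sub>0 deg_cases by (fastforce simp: kernel_group_sel deg_mult deg_inv deg_a\<^sub>0)+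

lemma kernel_deg: "g \<in> carrier L\<^sub>0 \<Longrightarrow> Gdeg L g = 0"
  by (simp add: kernel_group_sel)

lemma inv_mult_cancel:
  assumes "g \<in> carrier L" "h \<in> carrier L"
  shows "inv g \<otimes> (g \<otimes> h) = h" "g \<otimes> (inv g \<otimes> h) = h"
  using assms by (simp_all flip: m_assoc)

lemma G_space_kernel: "G_space L X \<Longrightarrow> G_space L\<^sub>0 X"
proof -
  assume X: "G_space L X"
  have id: "continuous_map (Gtop L\<^sub>0) (Gtop L) (\<lambda>x. x)"
    unfolding kernel_group_sel(4) by (intro continuous_map_from_subtopology continuous_map_ident)
  have "continuous_map (prod_topology (Gtop L\<^sub>0) (Xtop X)) (Xtop X) (\<lambda>z. Xact X (fst z) (snd z))"
    by (intro G_spaceD(1)[OF X top] continuous_map_compose_app[OF _ id] continuous_map_fst continuous_map_snd)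
  then show ?thesis
    using X by (auto simp: G_space_def kernel_group_sel case_prod_beta')
qed

lemma magnetic_bundle_kernel:
  assumes E: "magnetic_bundle L X E"
  shows "magnetic_bundle L\<^sub>0 X E"
proof -
  have id: "continuous_map (Gtop L\<^sub>0) (Gtop L) (\<lambda>x. x)"
    unfolding kernel_group_sel(4) by (intro continuous_map_from_subtopology continuous_map_ident)
  have "continuous_map (prod_topology (Gtop L\<^sub>0) (Etop E)) (Etop E) (\<lambda>z. Eact E (fst z) (snd z))"
    by (intro magnetic_bundle_act_continuous[OF E] continuous_map_compose_app[OF _ id] continuous_map_fst continuous_map_snd)
  then show ?thesis
    by (intro magnetic_bundleI)
      (use magnetic_bundleD[OF E top] in \<open>auto simp: kernel_group_sel case_prod_beta'\<close>)
qed

lemma bundle_iso_kernel: "bundle_iso L E F \<Longrightarrow> bundle_iso L\<^sub>0 E F"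
  by (auto simp: bundle_iso_def kernel_group_sel)

end

lemma conjugate_bundle_sel:
  "Eproj (conjugate_bundle L a X F) = snd"
  "Eadd (conjugate_bundle L a X F) = (\<lambda>z w. (Eadd F (fst z) (fst w), snd z))"
  "Escale (conjugate_bundle L a X F) = (\<lambda>c z. (Escale F (cnj c) (fst z), snd z))"
  "Eact (conjugate_bundle L a X F) =
     (\<lambda>g z. (Eact F (a \<otimes>\<^bsub>L\<^esub> g \<otimes>\<^bsub>L\<^esub> inv\<^bsub>L\<^esub> a) (fst z), Xact X g (snd z)))"
  by (auto simp: conjugate_bundle_def fun_eq_iff)

lemma topspace_conjugate_bundle:
  "z \<in> Epts (conjugate_bundle L a X F) \<longleftrightarrow>
     fst z \<in> Epts F \<and> snd z \<in> topspace (Xtop X) \<and> Eproj F (fst z) = Xact X a (snd z)"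
  by (cases z) (auto simp: conjugate_bundle_def)

lemmas conjugate_simps = topspace_conjugate_bundle conjugate_bundle_sel

lemma continuous_map_conjugate_bundleI:
  assumes "continuous_map Z (Etop F) s" "continuous_map Z (Xtop X) x"
    and "\<And>z. z \<in> topspace Z \<Longrightarrow> Eproj F (s z) = Xact X a (x z)"
  shows "continuous_map Z (Etop (conjugate_bundle L a X F)) (\<lambda>z. (s z, x z))"
  using assms by (auto simp: conjugate_bundle_def intro!: continuous_map_subtopologyI continuous_map_pairedI)

lemma continuous_map_conjugate_bundleD:
  assumes "continuous_map Z (Etop (conjugate_bundle L a X F)) s"
  shows "continuous_map Z (Etop F) (\<lambda>z. fst (s z))" "continuous_map Z (Xtop X) (\<lambda>z. snd (s z))"
  using assms
  by (auto simp: conjugate_bundle_def continuous_map_in_subtopology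
      intro: continuous_map_fst_app continuous_map_snd_app)

context magnetic
begin

lemma Xact_continuous:
  assumes "G_space L X" "g \<in> carrier L"
  shows "continuous_map (Xtop X) (Xtop X) (Xact X g)"
  by (rule G_spaceD(1)[OF assms(1) top continuous_map_group_const[OF assms(2)] continuous_map_ident])

text \<open>
  The action of \<open>a\<^sub>0\<close> is a homeomorphism of the base, and the conjugate bundle is the pullback
  along it with conjugated scalars.
\<close>

lemma complex_vector_bundle_conjugate:
  assumes F: "complex_vector_bundle (Xtop X) F" and X: "G_space L X"
  shows "complex_vector_bundle (Xtop X) (conjugate_bundle L a\<^sub>0 X F)"
proof -
  define P where "P = \<lparr>Etop = subtopology (prod_topology (Xtop X) (Etop F)) {(y, e). Xact X a\<^sub>0 y = Eproj F e},
      Eproj = fst, Eadd = (\<lambda>(y, e) (y', e'). (y, Eadd F e e')),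
      Escale = (\<lambda>c (y, e). (y, Escale F (cnj c) e)), Eact = (\<lambda>g y. y)\<rparr>"
  have P: "complex_vector_bundle (Xtop X) P"
    by (rule complex_vector_bundle_pullback[OF F Xact_continuous[OF X a\<^sub>0(1)], where \<gamma> = cnj])
      (simp_all add: P_def)
  show ?thesis
  proof (rule complex_vector_bundle_transport[OF P, where h = "\<lambda>z. (snd z, fst z)" and k = "\<lambda>z. (snd z, fst z)"])
    show "continuous_map (Etop P) (Etop (conjugate_bundle L a\<^sub>0 X F)) (\<lambda>z. (snd z, fst z))"
      by (rule continuous_map_conjugate_bundleI)
        (auto simp: P_def intro: continuous_map_from_subtopology continuous_map_fst continuous_map_snd)
    show "continuous_map (Etop (conjugate_bundle L a\<^sub>0 X F)) (Etop P) (\<lambda>z. (snd z, fst z))"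
      using continuous_map_conjugate_bundleD[OF continuous_map_ident]
      by (auto simp: P_def topspace_conjugate_bundle intro!: continuous_map_subtopologyI continuous_map_pairedI)
  qed (auto simp: P_def conjugate_bundle_sel)
qed

lemma magnetic_bundle_conjugate:
  assumes F: "magnetic_bundle L\<^sub>0 X F" and X: "G_space L X"
  shows "magnetic_bundle L\<^sub>0 X (conjugate_bundle L a\<^sub>0 X F)"
proof (rule magnetic_bundleI)
  note M = magnetic_bundleD[OF F topological_group_kernel] and S = G_spaceD[OF X top]
  let ?C = "conjugate_bundle L a\<^sub>0 X F"
  show "complex_vector_bundle (Xtop X) ?C"
    by (rule complex_vector_bundle_conjugate[OF M(1) X])
  note s = continuous_map_conjugate_bundleD[OF continuous_map_snd[of "Gtop L\<^sub>0" "Etop ?C"]]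
  note g = continuous_map_fst[of "Gtop L\<^sub>0" "Etop ?C", unfolded continuous_map_kernel_group]
  note topL = topological_groupD(3)[OF topological_group_kernel]
  have conj_act: "Xact X (a\<^sub>0 \<otimes> g \<otimes> inv a\<^sub>0) (Xact X a\<^sub>0 x) = Xact X a\<^sub>0 (Xact X g x)"
    if "g \<in> carrier L\<^sub>0" "x \<in> topspace (Xtop X)" for g x
    using that a\<^sub>0 parity(1)[OF that(1)] by (simp add: m_assoc flip: S(3))
  show "continuous_map (prod_topology (Gtop L\<^sub>0) (Etop ?C)) (Etop ?C) (\<lambda>(g, e). Eact ?C g e)"
    unfolding case_prod_beta' conjugate_bundle_sel
  proof (rule continuous_map_conjugate_bundleI)
    show "continuous_map (prod_topology (Gtop L\<^sub>0) (Etop ?C)) (Xtop X) (\<lambda>z. Xact X (fst z) (snd (snd z)))"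
      by (intro S(1) s) (use g in blast)
    have "continuous_map (prod_topology (Gtop L\<^sub>0) (Etop ?C)) (Gtop L\<^sub>0)
        (\<lambda>z. a\<^sub>0 \<otimes> fst z \<otimes> inv a\<^sub>0)"
      unfolding continuous_map_kernel_group
      using g a\<^sub>0(1) by (auto intro!: continuous_map_group_mult continuous_map_group_const parity(2) simp: topL)
    then show "continuous_map (prod_topology (Gtop L\<^sub>0) (Etop ?C)) (Etop F)
        (\<lambda>z. Eact F (a\<^sub>0 \<otimes> fst z \<otimes> inv a\<^sub>0) (fst (snd z)))"
      by (rule magnetic_bundle_act_continuous[OF F _ s(1)])
  qed (auto simp: topspace_conjugate_bundle topL M(7) parity(2) conj_act)
next
  note M = magnetic_bundleD[OF F topological_group_kernel] and S = G_spaceD[OF X top]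
  let ?C = "conjugate_bundle L a\<^sub>0 X F"
  fix g h e assume gh: "g \<in> carrier L\<^sub>0" "h \<in> carrier L\<^sub>0" and e: "e \<in> Epts ?C"
  have "a\<^sub>0 \<otimes> (g \<otimes> h) \<otimes> inv a\<^sub>0 =
      (a\<^sub>0 \<otimes> g \<otimes> inv a\<^sub>0) \<otimes> (a\<^sub>0 \<otimes> h \<otimes> inv a\<^sub>0)"
    using parity(1)[OF gh(1)] parity(1)[OF gh(2)] a\<^sub>0(1) by (simp add: m_assoc inv_mult_cancel)
  then show "Eact ?C (g \<otimes>\<^bsub>L\<^sub>0\<^esub> h) e = Eact ?C g (Eact ?C h e)"
    using M(6)[OF parity(2)[OF gh(1)] parity(2)[OF gh(2)]] S(3)[OF parity(1)[OF gh(1)] parity(1)[OF gh(2)]] e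
    by (simp add: conjugate_bundle_sel topspace_conjugate_bundle kernel_group_sel(2))
next
  note M = magnetic_bundleD[OF F topological_group_kernel] and S = G_spaceD[OF X top]
  fix e assume "e \<in> Epts (conjugate_bundle L a\<^sub>0 X F)"
  then show "Eact (conjugate_bundle L a\<^sub>0 X F) \<one>\<^bsub>L\<^sub>0\<^esub> e = e"
    using M(5)[of "fst e"] S(2)[of "snd e"] a\<^sub>0(1)
    by (simp add: conjugate_bundle_sel topspace_conjugate_bundle kernel_group_sel(3))
qed (use magnetic_bundleD[OF F topological_group_kernel] parity(2) kernel_deg[OF parity(2)] in
    \<open>auto simp: conjugate_bundle_sel topspace_conjugate_bundle kernel_group_sel(5)
       dest: kernel_deg\<close>)

end

text \<open>
  The magnetic bundle induced from \<open>F\<close>. The points of its fibre over \<open>x\<close> are written \<open>(s, s', x)\<close>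
  with \<open>s\<close> over \<open>x\<close> and \<open>s'\<close> over \<open>a x\<close>, where \<open>s'\<close> stands for \<open>a\<inverse> s'\<close>. For odd \<open>g\<close> the elements
  \<open>g a\<inverse>\<close> and \<open>a g\<close> are even, hence act on \<open>F\<close>; the formula reads \<open>g (a\<inverse> s') = (g a\<inverse>) s'\<close> and
  \<open>g s = a\<inverse> ((a g) s)\<close>.
\<close>

definition transfer_bundle ::
    "'g graded_group \<Rightarrow> 'g \<Rightarrow> ('g, 'x) gspace \<Rightarrow> ('g, 'x, 'e) gbundle \<Rightarrow> ('g, 'x, 'e \<times> 'e \<times> 'x) gbundle" where
  "transfer_bundle L a X F = (F \<oplus>\<^sub>B conjugate_bundle L a X F)\<lparr>Eact := (\<lambda>g (s, s', x).
     if Gdeg L g = 0 then (Eact F g s, Eact F (a \<otimes>\<^bsub>L\<^esub> g \<otimes>\<^bsub>L\<^esub> inv\<^bsub>L\<^esub> a) s', Xact X g x)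
     else (Eact F (g \<otimes>\<^bsub>L\<^esub> inv\<^bsub>L\<^esub> a) s', Eact F (a \<otimes>\<^bsub>L\<^esub> g) s, Xact X g x))\<rparr>"

lemma transfer_bundle_sel:
  "Etop (transfer_bundle L a X F) = Etop (F \<oplus>\<^sub>B conjugate_bundle L a X F)"
  "Eproj (transfer_bundle L a X F) = (\<lambda>z. Eproj F (fst z))"
  "Eadd (transfer_bundle L a X F) =
     (\<lambda>z w. (Eadd F (fst z) (fst w), Eadd F (fst (snd z)) (fst (snd w)), snd (snd z)))"
  "Escale (transfer_bundle L a X F) =
     (\<lambda>c z. (Escale F c (fst z), Escale F (cnj c) (fst (snd z)), snd (snd z)))"
  "Eact (transfer_bundle L a X F) = (\<lambda>g z.
     if Gdeg L g = 0
     then (Eact F g (fst z), Eact F (a \<otimes>\<^bsub>L\<^esub> g \<otimes>\<^bsub>L\<^esub> inv\<^bsub>L\<^esub> a) (fst (snd z)), Xact X g (snd (snd z)))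
     else (Eact F (g \<otimes>\<^bsub>L\<^esub> inv\<^bsub>L\<^esub> a) (fst (snd z)), Eact F (a \<otimes>\<^bsub>L\<^esub> g) (fst z), Xact X g (snd (snd z))))"
  by (auto simp: transfer_bundle_def bundle_sum_sel conjugate_bundle_sel fun_eq_iff)

lemma topspace_transfer_bundle:
  "z \<in> Epts (transfer_bundle L a X F) \<longleftrightarrow>
     fst z \<in> Epts F \<and> fst (snd z) \<in> Epts F \<and> snd (snd z) \<in> topspace (Xtop X) \<and>
     Eproj F (fst z) = snd (snd z) \<and> Eproj F (fst (snd z)) = Xact X a (snd (snd z))"
  by (auto simp: transfer_bundle_sel topspace_bundle_sum conjugate_simps)

lemmas transfer_simps = topspace_transfer_bundle transfer_bundle_sel(2-)

lemma continuous_map_transfer_bundleI: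
  assumes "continuous_map Z (Etop F) s" "continuous_map Z (Etop F) s'" "continuous_map Z (Xtop X) x"
    and "\<And>z. z \<in> topspace Z \<Longrightarrow> Eproj F (s z) = x z"
    and "\<And>z. z \<in> topspace Z \<Longrightarrow> Eproj F (s' z) = Xact X a (x z)"
  shows "continuous_map Z (Etop (transfer_bundle L a X F)) (\<lambda>z. (s z, s' z, x z))"
  unfolding transfer_bundle_sel
  by (intro continuous_map_bundle_sumI continuous_map_conjugate_bundleI assms)
    (simp_all add: assms conjugate_bundle_sel)

lemma continuous_map_transfer_bundleD:
  assumes "continuous_map Z (Etop (transfer_bundle L a X F)) s"
  shows "continuous_map Z (Etop F) (\<lambda>z. fst (s z))" "continuous_map Z (Etop F) (\<lambda>z. fst (snd (s z)))"
    "continuous_map Z (Xtop X) (\<lambda>z. snd (snd (s z)))"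
proof -
  note t = continuous_map_bundle_sumD[OF assms[unfolded transfer_bundle_sel]]
  show "continuous_map Z (Etop F) (\<lambda>z. fst (s z))" by (rule t(1))
  show "continuous_map Z (Etop F) (\<lambda>z. fst (snd (s z)))" "continuous_map Z (Xtop X) (\<lambda>z. snd (snd (s z)))"
    by (rule continuous_map_conjugate_bundleD[OF t(2)])+
qed

context magnetic
begin

lemma conjugate_bundle_additive:
  assumes "bundle_iso L\<^sub>0 (E \<oplus>\<^sub>B F) H"
  shows "bundle_iso L\<^sub>0 (conjugate_bundle L a\<^sub>0 X E \<oplus>\<^sub>B conjugate_bundle L a\<^sub>0 X F) (conjugate_bundle L a\<^sub>0 X H)"
    (is "bundle_iso L\<^sub>0 (?E \<oplus>\<^sub>B ?F) ?H")
proof -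
  obtain h k where hk: "bundle_isomorphisms L\<^sub>0 (E \<oplus>\<^sub>B F) H h k"
    using assms by (auto simp: bundle_iso_iff)
  note h = bundle_isomorphismsD[OF hk]
  note h' = h(3-)[unfolded topspace_bundle_sum bundle_sum_sel]
  note k = continuous_map_bundle_sumD[OF h(2)]
  note i = continuous_map_bundle_sumD[OF continuous_map_ident]
  note j = continuous_map_conjugate_bundleD[OF continuous_map_ident]
  show ?thesis
  proof (rule bundle_isoI[where h = "\<lambda>z. (h (fst (fst z), fst (snd z)), snd (fst z))"
        and k = "\<lambda>w. ((fst (k (fst w)), snd w), (snd (k (fst w)), snd w))"])
    show "continuous_map (Etop (?E \<oplus>\<^sub>B ?F)) (Etop ?H) (\<lambda>z. (h (fst (fst z), fst (snd z)), snd (fst z)))"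
      by (intro continuous_map_conjugate_bundleI continuous_map_compose_app[OF _ h(1)]
          continuous_map_bundle_sumI continuous_map_conjugate_bundleD[OF i(1)]
          continuous_map_conjugate_bundleD[OF i(2)])
        (use h' in \<open>auto simp: sum_simps conjugate_simps\<close>)
    show "continuous_map (Etop ?H) (Etop (?E \<oplus>\<^sub>B ?F)) (\<lambda>w. ((fst (k (fst w)), snd w), (snd (k (fst w)), snd w)))"
      by (intro continuous_map_conjugate_bundleI continuous_map_bundle_sumI j
          continuous_map_compose_app[OF j(1) k(1)] continuous_map_compose_app[OF j(1) k(2)])
        (use h' in \<open>auto simp: sum_simps conjugate_simps\<close>)
  qed (use h' in \<open>auto simp: sum_simps conjugate_simps
      prod_eq_iff parity(2)\<close>)
qed

lemma transfer_bundle_additive: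
  assumes "bundle_iso L\<^sub>0 (E \<oplus>\<^sub>B F) H"
  shows "bundle_iso L (transfer_bundle L a\<^sub>0 X E \<oplus>\<^sub>B transfer_bundle L a\<^sub>0 X F) (transfer_bundle L a\<^sub>0 X H)"
    (is "bundle_iso L (?E \<oplus>\<^sub>B ?F) ?H")
proof -
  obtain h k where hk: "bundle_isomorphisms L\<^sub>0 (E \<oplus>\<^sub>B F) H h k"
    using assms by (auto simp: bundle_iso_iff)
  note h = bundle_isomorphismsD[OF hk]
  note h' = h(3-)[unfolded topspace_bundle_sum bundle_sum_sel]
  note k = continuous_map_bundle_sumD[OF h(2)]
  note i = continuous_map_bundle_sumD[OF continuous_map_ident]
  note j = continuous_map_transfer_bundleD[OF continuous_map_ident]
  note D = continuous_map_transfer_bundleD[OF i(1)] continuous_map_transfer_bundleD[OF i(2)]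
  have even: "g \<in> carrier L\<^sub>0" if "g \<in> carrier L" "Gdeg L g = 0" for g
    using that by (simp add: kernel_group_sel)
  show ?thesis
  proof (rule bundle_isoI[where h = "\<lambda>z. (h (fst (fst z), fst (snd z)), h (fst (snd (fst z)), fst (snd (snd z))), snd (snd (fst z)))"
        and k = "\<lambda>w. ((fst (k (fst w)), fst (k (fst (snd w))), snd (snd w)), (snd (k (fst w)), snd (k (fst (snd w))), snd (snd w)))"])
    show "continuous_map (Etop (?E \<oplus>\<^sub>B ?F)) (Etop ?H)
        (\<lambda>z. (h (fst (fst z), fst (snd z)), h (fst (snd (fst z)), fst (snd (snd z))), snd (snd (fst z))))"
      by (intro continuous_map_transfer_bundleI continuous_map_compose_app[OF _ h(1)]
          continuous_map_bundle_sumI D)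
        (use h' in \<open>auto simp: sum_simps transfer_simps\<close>)
    show "continuous_map (Etop ?H) (Etop (?E \<oplus>\<^sub>B ?F))
        (\<lambda>w. ((fst (k (fst w)), fst (k (fst (snd w))), snd (snd w)), (snd (k (fst w)), snd (k (fst (snd w))), snd (snd w))))"
      by (intro continuous_map_transfer_bundleI continuous_map_bundle_sumI j
          continuous_map_compose_app[OF j(1) k(1)] continuous_map_compose_app[OF j(1) k(2)]
          continuous_map_compose_app[OF j(2) k(1)] continuous_map_compose_app[OF j(2) k(2)])
        (use h' in \<open>auto simp: sum_simps transfer_simps\<close>)
  qed (use h' in \<open>auto simp: sum_simps transfer_simps
      prod_eq_iff parity even\<close>)
qed

text \<open>
  The inverse of \<open>a\<^sub>0\<close> maps the fibre over \<open>a\<^sub>0 x\<close> antilinearly to the one over \<open>x\<close>, so it is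
  linear on the conjugate bundle.
\<close>

lemma conjugate_bundle_iso_self:
  assumes E: "magnetic_bundle L X E" and X: "G_space L X"
  shows "bundle_iso L\<^sub>0 (conjugate_bundle L a\<^sub>0 X E) E"
proof -
  note M = magnetic_bundleD[OF E top] and S = G_spaceD[OF X top]
  note j = continuous_map_conjugate_bundleD[OF continuous_map_ident]
  have c: "Eact E (inv a\<^sub>0) (Eact E a\<^sub>0 e) = e" "Eact E a\<^sub>0 (Eact E (inv a\<^sub>0) e) = e"
    if "e \<in> Epts E" for e
    using that a\<^sub>0(1) by (simp_all add: M(5) flip: M(6))
  have x: "Xact X (inv a\<^sub>0) (Xact X a\<^sub>0 y) = y" if "y \<in> topspace (Xtop X)" for y
    using that a\<^sub>0(1) by (simp add: S(2) flip: S(3))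
  show ?thesis
  proof (rule bundle_isoI[where h = "\<lambda>z. Eact E (inv a\<^sub>0) (fst z)" and k = "\<lambda>e. (Eact E a\<^sub>0 e, Eproj E e)"])
    show "continuous_map (Etop (conjugate_bundle L a\<^sub>0 X E)) (Etop E) (\<lambda>z. Eact E (inv a\<^sub>0) (fst z))"
      by (intro magnetic_bundle_act_continuous[OF E] continuous_map_group_const j inv_closed a\<^sub>0)
    show "continuous_map (Etop E) (Etop (conjugate_bundle L a\<^sub>0 X E)) (\<lambda>e. (Eact E a\<^sub>0 e, Eproj E e))"
      by (intro continuous_map_conjugate_bundleI magnetic_bundle_act_continuous[OF E]
          continuous_map_group_const continuous_map_ident a\<^sub>0 M(2,7))
    fix g e assume g: "g \<in> carrier L\<^sub>0" and e: "e \<in> Epts (conjugate_bundle L a\<^sub>0 X E)"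
    note gL = parity(1)[OF g]
    have "Eact E (inv a\<^sub>0) (Eact E (a\<^sub>0 \<otimes> g \<otimes> inv a\<^sub>0) (fst e)) =
        Eact E (inv a\<^sub>0 \<otimes> (a\<^sub>0 \<otimes> g \<otimes> inv a\<^sub>0)) (fst e)"
      using e gL a\<^sub>0(1) by (simp add: M(6) topspace_conjugate_bundle)
    also have "\<dots> = Eact E g (Eact E (inv a\<^sub>0) (fst e))"
      using e gL a\<^sub>0(1) by (simp add: m_assoc inv_mult_cancel M(6) topspace_conjugate_bundle)
    finally show "Eact E (inv a\<^sub>0) (fst (Eact (conjugate_bundle L a\<^sub>0 X E) g e)) =
        Eact E g (Eact E (inv a\<^sub>0) (fst e))"
      by (simp add: conjugate_bundle_sel)
  qed (use a\<^sub>0(1) in \<open>auto simp: conjugate_simps c x M(7-9) deg_inv deg_a\<^sub>0\<close>)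
qed

lemma transfer_bundle_iso_restriction:
  "bundle_iso L\<^sub>0 (transfer_bundle L a\<^sub>0 X F) (F \<oplus>\<^sub>B conjugate_bundle L a\<^sub>0 X F)"
  by (rule bundle_isoI[where h = "\<lambda>z. z" and k = "\<lambda>z. z"])
    (auto simp: transfer_bundle_sel continuous_map_ident bundle_sum_sel conjugate_bundle_sel kernel_deg)

end

text \<open>
  The identities that make \<open>(s, u) \<mapsto> (s + u, \<i> (s - u))\<close> an invertible linear map, stated with
  the operations of \<open>E\<close> because its fibres are vector spaces only through coordinates. The last
  two describe the effect of exchanging \<open>s\<close> and \<open>u\<close>.
\<close>

lemma complex_vector_bundle_fibre_identities:
  assumes E: "complex_vector_bundle T E"
    and s: "s \<in> Epts E" "Eproj E s = x" and u: "u \<in> Epts E" "Eproj E u = x"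
    and s': "s' \<in> Epts E" "Eproj E s' = x" and u': "u' \<in> Epts E" "Eproj E u' = x"
  shows "Escale E (1/2) (Eadd E (Eadd E s u) (Escale E (- \<i>) (Escale E \<i> (Eadd E s (Escale E (- 1) u))))) = s"
    and "Escale E (1/2) (Eadd E (Eadd E s u) (Escale E \<i> (Escale E \<i> (Eadd E s (Escale E (- 1) u))))) = u"
    and "Eadd E (Escale E (1/2) (Eadd E s (Escale E (- \<i>) u))) (Escale E (1/2) (Eadd E s (Escale E \<i> u))) = s"
    and "Escale E \<i> (Eadd E (Escale E (1/2) (Eadd E s (Escale E (- \<i>) u)))
           (Escale E (- 1) (Escale E (1/2) (Eadd E s (Escale E \<i> u))))) = u"
    and "Eadd E (Eadd E s s') (Eadd E u u') = Eadd E (Eadd E s u) (Eadd E s' u')"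
    and "Escale E \<i> (Eadd E (Eadd E s s') (Escale E (- 1) (Eadd E u u'))) =
         Eadd E (Escale E \<i> (Eadd E s (Escale E (- 1) u))) (Escale E \<i> (Eadd E s' (Escale E (- 1) u')))"
    and "Eadd E (Escale E c s) (Escale E c u) = Escale E c (Eadd E s u)"
    and "Escale E \<i> (Eadd E (Escale E c s) (Escale E (- 1) (Escale E c u))) =
         Escale E c (Escale E \<i> (Eadd E s (Escale E (- 1) u)))"
    and "Eadd E u s = Eadd E s u"
    and "Escale E \<i> (Eadd E u (Escale E (- 1) s)) = Escale E (- \<i>) (Eadd E s (Escale E (- 1) u))"
proof -
  have "x \<in> topspace T" using complex_vector_bundle_proj(2)[OF E s(1)] s(2) by simp
  with E obtain n :: nat and \<eta> :: "(nat \<Rightarrow> complex) \<Rightarrow> _" and \<kappa> where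
    k: "\<And>e. e \<in> Epts E \<Longrightarrow> Eproj E e = x \<Longrightarrow> \<kappa> e \<in> extensional {..<n} \<and> \<eta> (\<kappa> e) = e"
    and ops: "\<And>v w. v \<in> extensional {..<n} \<Longrightarrow> w \<in> extensional {..<n} \<Longrightarrow>
       Eadd E (\<eta> v) (\<eta> w) = \<eta> (\<lambda>i\<in>{..<n}. v i + w i)"
    "\<And>c v. v \<in> extensional {..<n} \<Longrightarrow> Escale E c (\<eta> v) = \<eta> (\<lambda>i\<in>{..<n}. c * v i)"
    by (rule fibre_coordinates) blast
  obtain v w v' w' where c: "s = \<eta> v" "v \<in> extensional {..<n}" "u = \<eta> w" "w \<in> extensional {..<n}"
    "s' = \<eta> v'" "v' \<in> extensional {..<n}" "u' = \<eta> w'" "w' \<in> extensional {..<n}"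
    using k[OF s] k[OF u] k[OF s'] k[OF u'] by metis
  have eq: "\<eta> (restrict f {..<n}) = \<eta> g" if "g \<in> extensional {..<n}" "\<And>i. i < n \<Longrightarrow> f i = g i" for f g
    using that by (intro arg_cong[where f = \<eta>] extensionalityI[of _ "{..<n}"]) auto
  note [simp] = c ops
  show "Escale E (1/2) (Eadd E (Eadd E s u) (Escale E (- \<i>) (Escale E \<i> (Eadd E s (Escale E (- 1) u))))) = s"
    by (simp, rule eq) (simp_all add: field_simps)
  show "Escale E (1/2) (Eadd E (Eadd E s u) (Escale E \<i> (Escale E \<i> (Eadd E s (Escale E (- 1) u))))) = u"
    by (simp, rule eq) (simp_all add: field_simps)
  show "Eadd E (Escale E (1/2) (Eadd E s (Escale E (- \<i>) u))) (Escale E (1/2) (Eadd E s (Escale E \<i> u))) = s"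
    by (simp, rule eq) (simp_all add: field_simps)
  show "Escale E \<i> (Eadd E (Escale E (1/2) (Eadd E s (Escale E (- \<i>) u)))
           (Escale E (- 1) (Escale E (1/2) (Eadd E s (Escale E \<i> u))))) = u"
    by (simp, rule eq) (simp_all add: field_simps)
  show "Eadd E (Eadd E s s') (Eadd E u u') = Eadd E (Eadd E s u) (Eadd E s' u')"
    by (simp, rule eq) (simp_all add: field_simps)
  show "Escale E \<i> (Eadd E (Eadd E s s') (Escale E (- 1) (Eadd E u u'))) =
         Eadd E (Escale E \<i> (Eadd E s (Escale E (- 1) u))) (Escale E \<i> (Eadd E s' (Escale E (- 1) u')))"
    by (simp, rule eq) (simp_all add: field_simps)
  show "Eadd E (Escale E c s) (Escale E c u) = Escale E c (Eadd E s u)"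
    by (simp, rule eq) (simp_all add: field_simps)
  show "Escale E \<i> (Eadd E (Escale E c s) (Escale E (- 1) (Escale E c u))) =
         Escale E c (Escale E \<i> (Eadd E s (Escale E (- 1) u)))"
    by (simp, rule eq) (simp_all add: field_simps)
  show "Eadd E u s = Eadd E s u"
    by (simp, rule eq) (simp_all add: field_simps)
  show "Escale E \<i> (Eadd E u (Escale E (- 1) s)) = Escale E (- \<i>) (Eadd E s (Escale E (- 1) u))"
    by (simp, rule eq) (simp_all add: field_simps)
qed

context magnetic
begin

text \<open>
  The action law has four cases, according to the parities of both factors. In each of them it
  reduces to the law for \<open>F\<close>, since the inner factors \<open>a\<^sub>0\<inverse>\<close> and \<open>a\<^sub>0\<close> cancel.
\<close>

lemma magnetic_bundle_transfer:
  assumes F: "magnetic_bundle L\<^sub>0 X F" and X: "G_space L X"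
  shows "magnetic_bundle L X (transfer_bundle L a\<^sub>0 X F)"
proof (rule magnetic_bundleI)
  note M = magnetic_bundleD[OF F topological_group_kernel] and S = G_spaceD[OF X top]
  let ?M = "transfer_bundle L a\<^sub>0 X F"
  have "complex_vector_bundle (Xtop X) (F \<oplus>\<^sub>B conjugate_bundle L a\<^sub>0 X F)"
    by (rule complex_vector_bundle_sum[OF M(1) complex_vector_bundle_conjugate[OF M(1) X]])
  then show "complex_vector_bundle (Xtop X) ?M"
    by (simp add: transfer_bundle_def complex_vector_bundle_def)
  have even: "g \<in> carrier L\<^sub>0" if "g \<in> carrier L" "Gdeg L g = 0" for g
    using that by (simp add: kernel_group_sel)
  have even_act: "Xact X (a\<^sub>0 \<otimes> g \<otimes> inv a\<^sub>0) (Xact X a\<^sub>0 x) = Xact X a\<^sub>0 (Xact X g x)"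
    and odd_act: "Xact X (g \<otimes> inv a\<^sub>0) (Xact X a\<^sub>0 x) = Xact X g x"
    "Xact X (a\<^sub>0 \<otimes> g) x = Xact X a\<^sub>0 (Xact X g x)"
    if "g \<in> carrier L" "x \<in> topspace (Xtop X)" for g x
    using that a\<^sub>0(1) by (simp_all add: m_assoc flip: S(3))
  have mult: "Eact F (g \<otimes> h) e = Eact F g (Eact F h e)"
    if "g \<in> carrier L\<^sub>0" "h \<in> carrier L\<^sub>0" "e \<in> Epts F" for g h e
    using M(6)[OF that] by (simp add: kernel_group_sel(2))
  have scale: "Eact F g (Escale F c e) = Escale F c (Eact F g e)"
    if "g \<in> carrier L\<^sub>0" "e \<in> Epts F" for g c e
    using M(9)[OF that] kernel_deg[OF that(1)] by (simp add: kernel_group_sel(5))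
  show "continuous_map (prod_topology (Gtop L) (Etop ?M)) (Etop ?M) (\<lambda>(g, e). Eact ?M g e)"
  proof (rule continuous_map_locally)
    fix z assume z: "z \<in> topspace (prod_topology (Gtop L) (Etop ?M))"
    let ?D = "{g \<in> carrier L. Gdeg L g = Gdeg L (fst z)}"
    define Z where "Z = subtopology (prod_topology (Gtop L) (Etop ?M)) (?D \<times> Epts ?M)"
    have topZ: "w \<in> topspace Z \<longleftrightarrow> fst w \<in> carrier L \<and> Gdeg L (fst w) = Gdeg L (fst z) \<and> snd w \<in> Epts ?M" for w
      using topological_groupD(3)[OF top] by (cases w) (auto simp: Z_def)
    have g: "continuous_map Z (Gtop L) fst"
      unfolding Z_def by (intro continuous_map_from_subtopology continuous_map_fst)
    have "continuous_map Z (Etop ?M) snd"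
      unfolding Z_def by (intro continuous_map_from_subtopology continuous_map_snd)
    note e = continuous_map_transfer_bundleD[OF this]
    note mult_cont = continuous_map_group_mult continuous_map_group_const
    have "continuous_map Z (Etop ?M) (\<lambda>w. Eact ?M (fst w) (snd w))"
    proof (cases "Gdeg L (fst z) = 0")
      case True
      have "continuous_map Z (Gtop L\<^sub>0) fst"
        "continuous_map Z (Gtop L\<^sub>0) (\<lambda>w. a\<^sub>0 \<otimes> fst w \<otimes> inv a\<^sub>0)"
        unfolding continuous_map_kernel_group
        by (use True in \<open>auto simp: topZ even parity intro!: g mult_cont a\<^sub>0\<close>)
      then have "continuous_map Z (Etop ?M) (\<lambda>w. (Eact F (fst w) (fst (snd w)),
          Eact F (a\<^sub>0 \<otimes> fst w \<otimes> inv a\<^sub>0) (fst (snd (snd w))), Xact X (fst w) (snd (snd (snd w)))))"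
        by (intro continuous_map_transfer_bundleI magnetic_bundle_act_continuous[OF F] S(1) g e)
          (use True in \<open>auto simp: topZ topspace_transfer_bundle M(7) even parity even_act\<close>)
      then show ?thesis
        by (rule continuous_map_eq) (auto simp only: topZ transfer_bundle_sel True if_True simp_thms)
    next
      case False
      have "continuous_map Z (Gtop L\<^sub>0) (\<lambda>w. fst w \<otimes> inv a\<^sub>0)"
        "continuous_map Z (Gtop L\<^sub>0) (\<lambda>w. a\<^sub>0 \<otimes> fst w)"
        unfolding continuous_map_kernel_group
        by (use False in \<open>auto simp: topZ parity intro!: g mult_cont a\<^sub>0\<close>)
      then have "continuous_map Z (Etop ?M) (\<lambda>w. (Eact F (fst w \<otimes> inv a\<^sub>0) (fst (snd (snd w))),
          Eact F (a\<^sub>0 \<otimes> fst w) (fst (snd w)), Xact X (fst w) (snd (snd (snd w)))))"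
        by (intro continuous_map_transfer_bundleI magnetic_bundle_act_continuous[OF F] S(1) g e)
          (use False in \<open>auto simp: topZ topspace_transfer_bundle M(7) parity odd_act\<close>)
      then show ?thesis
        by (rule continuous_map_eq) (auto simp only: topZ transfer_bundle_sel False if_False simp_thms)
    qed
    moreover have "openin (prod_topology (Gtop L) (Etop ?M)) (?D \<times> Epts ?M)"
      by (simp add: openin_prod_Times_iff openin_degree)
    moreover have "z \<in> ?D \<times> Epts ?M"
      using z topological_groupD(3)[OF top] by (cases z) auto
    ultimately show "\<exists>U. openin (prod_topology (Gtop L) (Etop ?M)) U \<and> z \<in> U \<and>
        continuous_map (subtopology (prod_topology (Gtop L) (Etop ?M)) U) (Etop ?M) (\<lambda>(g, e). Eact ?M g e)"
      unfolding case_prod_beta' Z_def by blast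
  qed
  show "Eact ?M \<one> e = e" if "e \<in> Epts ?M" for e
    using that a\<^sub>0(1) M(5)[unfolded kernel_group_sel(3)] S(2)
    by (auto simp: transfer_bundle_sel(5) topspace_transfer_bundle deg_one)
  show "Eact ?M (g \<otimes> h) e = Eact ?M g (Eact ?M h e)"
    if g: "g \<in> carrier L" and h: "h \<in> carrier L" and e: "e \<in> Epts ?M" for g h e
  proof -
    have G: "(Gdeg L g = 0 \<and> g \<in> carrier L\<^sub>0 \<and> a\<^sub>0 \<otimes> g \<otimes> inv a\<^sub>0 \<in> carrier L\<^sub>0) \<or>
      (Gdeg L g = 1 \<and> a\<^sub>0 \<otimes> g \<in> carrier L\<^sub>0 \<and> g \<otimes> inv a\<^sub>0 \<in> carrier L\<^sub>0)" if "g \<in> carrier L" for g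
      using deg_cases[OF that] parity(2)[OF even[OF that]] parity(3,4)[OF that] even[OF that] by auto
    have e': "fst e \<in> Epts F" "fst (snd e) \<in> Epts F" "snd (snd e) \<in> topspace (Xtop X)"
      using e by (auto simp: topspace_transfer_bundle)
    from G[OF g] G[OF h] show ?thesis
      using g h a\<^sub>0(1)
      by (elim disjE conjE)
        (simp_all add: transfer_bundle_sel(5) deg_mult S(3) e' m_assoc inv_mult_cancel flip: mult)
  qed
  show "Eproj ?M (Eact ?M g e) = Xact X g (Eproj ?M e)"
    if g: "g \<in> carrier L" and e: "e \<in> Epts ?M" for g e
    using e g by (auto simp: transfer_bundle_sel(2,5) topspace_transfer_bundle M(7) even parity odd_act)
  show "Eact ?M g (Eadd ?M e f) = Eadd ?M (Eact ?M g e) (Eact ?M g f)"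
    if g: "g \<in> carrier L" and e: "e \<in> Epts ?M" and f: "f \<in> Epts ?M"
      and ef: "Eproj ?M f = Eproj ?M e" for g e f
    using e f g ef by (auto simp: transfer_bundle_sel(2,3,5) topspace_transfer_bundle M(8) even parity)
  show "Eact ?M g (Escale ?M c e) = Escale ?M (if Gdeg L g = 0 then c else cnj c) (Eact ?M g e)"
    if g: "g \<in> carrier L" and e: "e \<in> Epts ?M" for g c e
    using e g by (auto simp: transfer_bundle_sel(4,5) topspace_transfer_bundle scale even parity)
qed

text \<open>
  With \<open>u = a\<^sub>0\<inverse> s'\<close>, the odd elements exchange \<open>s\<close> and \<open>u\<close>. They act antilinearly, so they
  commute with the passage from \<open>(s, u)\<close> to \<open>s + u\<close> and to \<open>\<i> (s - u)\<close>. For a group acting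
  linearly, the second component would change sign under the odd elements instead.
\<close>

lemma transfer_bundle_iso_double:
  fixes E :: "('g, 'x, 'e) gbundle"
  assumes E: "magnetic_bundle L X E" and X: "G_space L X"
  shows "bundle_iso L (transfer_bundle L a\<^sub>0 X E) (E \<oplus>\<^sub>B E)"
proof -
  note M = magnetic_bundleD[OF E top] and S = G_spaceD[OF X top]
  note ops = complex_vector_bundle_ops[OF M(1)]
  let ?M = "transfer_bundle L a\<^sub>0 X E"
  note j = continuous_map_transfer_bundleD[OF continuous_map_ident]
  note i = continuous_map_bundle_sumD[OF continuous_map_ident]
  have ia: "inv a\<^sub>0 \<in> carrier L" using a\<^sub>0(1) by simp
  have c: "Eact E (inv a\<^sub>0) (Eact E a\<^sub>0 e) = e" "Eact E a\<^sub>0 (Eact E (inv a\<^sub>0) e) = e"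
    if "e \<in> Epts E" for e
    using that a\<^sub>0(1) by (simp_all add: M(5) flip: M(6))
  have x: "Xact X (inv a\<^sub>0) (Xact X a\<^sub>0 y) = y" if "y \<in> topspace (Xtop X)" for y
    using that a\<^sub>0(1) by (simp add: S(2) flip: S(3))
  define u where "u z = Eact E (inv a\<^sub>0) (fst (snd z))" for z :: "'e \<times> 'e \<times> 'x"
  have z: "fst z \<in> Epts E" "Eproj E (fst z) = snd (snd z)" "u z \<in> Epts E"
    "Eproj E (u z) = snd (snd z)" if "z \<in> Epts ?M" for z
    using that a\<^sub>0(1) by (auto simp: topspace_transfer_bundle u_def M(7,10) x)
  define h where "h z = (Eadd E (fst z) (u z), Escale E \<i> (Eadd E (fst z) (Escale E (- 1) (u z))))" for z
  define k\<^sub>1 where "k\<^sub>1 w = Escale E (1/2) (Eadd E (fst w) (Escale E (- \<i>) (snd w)))" for w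
  define k\<^sub>2 where "k\<^sub>2 w = Escale E (1/2) (Eadd E (fst w) (Escale E \<i> (snd w)))" for w
  define k where "k w = (k\<^sub>1 w, Eact E a\<^sub>0 (k\<^sub>2 w), Eproj E (fst w))" for w
  have w: "k\<^sub>1 w \<in> Epts E" "Eproj E (k\<^sub>1 w) = Eproj E (fst w)"
    "k\<^sub>2 w \<in> Epts E" "Eproj E (k\<^sub>2 w) = Eproj E (fst w)" if "w \<in> Epts (E \<oplus>\<^sub>B E)" for w
    using that by (simp_all add: topspace_bundle_sum k\<^sub>1_def k\<^sub>2_def ops)
  have cu: "continuous_map (Etop ?M) (Etop E) u"
    unfolding u_def by (intro magnetic_bundle_act_continuous[OF E] continuous_map_group_const ia j)
  have ck: "continuous_map (Etop (E \<oplus>\<^sub>B E)) (Etop E) k\<^sub>1" "continuous_map (Etop (E \<oplus>\<^sub>B E)) (Etop E) k\<^sub>2"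
    unfolding k\<^sub>1_def k\<^sub>2_def
    by (intro continuous_map_Escale[OF M(1)] continuous_map_Eadd[OF M(1)] i; simp add: topspace_bundle_sum ops)+
  note fib = complex_vector_bundle_fibre_identities[OF M(1)]
  show ?thesis
  proof (rule bundle_isoI[where h = h and k = k])
    show "continuous_map (Etop ?M) (Etop (E \<oplus>\<^sub>B E)) h"
      unfolding h_def
      by (intro continuous_map_bundle_sumI continuous_map_Escale[OF M(1)] continuous_map_Eadd[OF M(1)] j cu)
        (simp_all add: z ops)
    show "continuous_map (Etop (E \<oplus>\<^sub>B E)) (Etop ?M) k"
      unfolding k_def
      by (intro continuous_map_transfer_bundleI magnetic_bundle_act_continuous[OF E]
          continuous_map_group_const a\<^sub>0 ck continuous_map_compose_app[OF i(1) M(2)])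
        (simp_all add: w M(7) a\<^sub>0)
    show "k (h e) = e" if "e \<in> Epts ?M" for e
    proof -
      have "k\<^sub>1 (h e) = fst e" "k\<^sub>2 (h e) = u e"
        using fib(1,2)[OF z(1,2)[OF that] z(3,4)[OF that] z(1,2)[OF that] z(1,2)[OF that]]
        by (simp_all add: h_def k\<^sub>1_def k\<^sub>2_def)
      moreover have "Eproj E (fst (h e)) = snd (snd e)"
        using z[OF that] by (simp add: h_def ops)
      moreover have "Eact E a\<^sub>0 (u e) = fst (snd e)"
        using that c by (simp add: u_def topspace_transfer_bundle)
      ultimately show ?thesis by (simp add: k_def)
    qed
    show "h (k f) = f" if f: "f \<in> Epts (E \<oplus>\<^sub>B E)" for f
    proof -
      have "u (k f) = k\<^sub>2 f" using w(3)[OF f] c by (simp add: u_def k_def)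
      moreover have "fst (k f) = k\<^sub>1 f" by (simp add: k_def)
      moreover have "fst f \<in> Epts E" "Eproj E (fst f) = Eproj E (fst f)"
        "snd f \<in> Epts E" "Eproj E (snd f) = Eproj E (fst f)"
        using f by (auto simp: topspace_bundle_sum)
      note fib(3,4)[OF this this]
      ultimately show ?thesis by (simp add: h_def k\<^sub>1_def k\<^sub>2_def)
    qed
    fix e assume e: "e \<in> Epts ?M"
    show "Eproj (E \<oplus>\<^sub>B E) (h e) = Eproj ?M e"
      using z[OF e] by (simp add: h_def bundle_sum_sel transfer_bundle_sel(2) ops)
    show "h (Escale ?M c e) = Escale (E \<oplus>\<^sub>B E) c (h e)" for c
    proof -
      have "u (Escale ?M c e) = Escale E c (u e)"
        using e ia by (simp add: u_def transfer_bundle_sel(4) topspace_transfer_bundle M(9) deg_inv a\<^sub>0 deg_a\<^sub>0)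
      then show ?thesis
        using fib(7,8)[OF z(1,2)[OF e] z(3,4)[OF e] z(1,2)[OF e] z(1,2)[OF e]]
        by (simp add: h_def bundle_sum_sel transfer_bundle_sel(4))
    qed
    show "h (Eadd ?M e e') = Eadd (E \<oplus>\<^sub>B E) (h e) (h e')"
      if e': "e' \<in> Epts ?M" and ee': "Eproj ?M e' = Eproj ?M e" for e'
    proof -
      have x': "snd (snd e') = snd (snd e)"
        using ee' z(2)[OF e] z(2)[OF e'] by (simp add: transfer_bundle_sel(2))
      have "u (Eadd ?M e e') = Eadd E (u e) (u e')"
        using e e' ia x' by (simp add: u_def transfer_bundle_sel(3) topspace_transfer_bundle M(8))
      then show ?thesis
        using fib(5,6)[OF z(1,2)[OF e] z(3,4)[OF e] z(1,2)[OF e', unfolded x'] z(3,4)[OF e', unfolded x']]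
        by (simp add: h_def bundle_sum_sel transfer_bundle_sel(3))
    qed
    show "h (Eact ?M g e) = Eact (E \<oplus>\<^sub>B E) g (h e)" if g: "g \<in> carrier L" for g
    proof -
      have e': "fst e \<in> Epts E" "fst (snd e) \<in> Epts E"
        using e by (auto simp: topspace_transfer_bundle)
      note ze = z[OF e]
      have gs: "Eact E g (fst e) \<in> Epts E" "Eproj E (Eact E g (fst e)) = Xact X g (snd (snd e))"
        "Eact E g (u e) \<in> Epts E" "Eproj E (Eact E g (u e)) = Xact X g (snd (snd e))"
        using ze g by (simp_all add: M(7,10))
      have lin: "Eact E g (Eadd E (fst e) (u e)) = Eadd E (Eact E g (fst e)) (Eact E g (u e))"
        "Eact E g (Escale E \<i> (Eadd E (fst e) (Escale E (- 1) (u e)))) =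
         Escale E (if Gdeg L g = 0 then \<i> else - \<i>) (Eadd E (Eact E g (fst e)) (Escale E (- 1) (Eact E g (u e))))"
        using ze g by (simp_all add: M(8,9) ops)
      show ?thesis
      proof (cases "Gdeg L g = 0")
        case True
        have "u (Eact ?M g e) = Eact E g (u e)"
          using True g e' a\<^sub>0(1) by (simp add: u_def transfer_bundle_sel(5) m_assoc inv_mult_cancel flip: M(6))
        then show ?thesis
          using True lin by (simp add: h_def bundle_sum_sel transfer_bundle_sel(5))
      next
        case False
        have "u (Eact ?M g e) = Eact E g (fst e)" "fst (Eact ?M g e) = Eact E g (u e)"
          using False g e' a\<^sub>0(1) by (simp_all add: u_def transfer_bundle_sel(5) m_assoc inv_mult_cancel flip: M(6))
        then show ?thesis
          using False lin fib(9,10)[OF gs gs] by (simp add: h_def bundle_sum_sel)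
      qed
    qed
  qed
qed

text \<open>
  In the fibre over \<open>y\<close>, both sides consist of a point of \<open>E\<close> over \<open>f y\<close> and one over \<open>a\<^sub>0 (f y)\<close>;
  only the base points recorded with them differ.
\<close>

lemma transfer_bundle_pullback:
  assumes E: "magnetic_bundle L\<^sub>0 X E" and X: "G_space L X" and Y: "G_space L Y"
    and f: "continuous_map (Xtop Y) (Xtop X) f"
    and equiv: "\<And>g y. g \<in> carrier L \<Longrightarrow> y \<in> topspace (Xtop Y) \<Longrightarrow> f (Xact Y g y) = Xact X g (f y)"
  shows "bundle_iso L (transfer_bundle L a\<^sub>0 Y (pullback_bundle Y f E))
           (pullback_bundle Y f (transfer_bundle L a\<^sub>0 X E))"
    (is "bundle_iso L ?M ?P")
proof -
  note S = G_spaceD[OF Y top]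
  note i = continuous_map_transfer_bundleD[OF continuous_map_ident]
  note j = continuous_map_pullback_bundleD[OF continuous_map_ident]
  note i' = continuous_map_pullback_bundleD(2)[OF i(1)] continuous_map_pullback_bundleD(2)[OF i(2)]
  note j' = continuous_map_transfer_bundleD[OF j(2)]
  have even: "g \<in> carrier L\<^sub>0" if "g \<in> carrier L" "Gdeg L g = 0" for g
    using that by (simp add: kernel_group_sel)
  have act: "Xact Y (a\<^sub>0 \<otimes> g \<otimes> inv a\<^sub>0) (Xact Y a\<^sub>0 y) = Xact Y a\<^sub>0 (Xact Y g y)"
    "Xact Y (g \<otimes> inv a\<^sub>0) (Xact Y a\<^sub>0 y) = Xact Y g y"
    "Xact Y (a\<^sub>0 \<otimes> g) y = Xact Y a\<^sub>0 (Xact Y g y)"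
    if "g \<in> carrier L" "y \<in> topspace (Xtop Y)" for g y
    using that a\<^sub>0(1) by (simp_all add: m_assoc flip: S(3))
  note top_simps = topspace_transfer_bundle topspace_pullback_bundle transfer_bundle_sel(2-) pullback_bundle_sel
  show ?thesis
  proof (rule bundle_isoI[where h = "\<lambda>z. (snd (snd z), snd (fst z), snd (fst (snd z)), f (snd (snd z)))"
        and k = "\<lambda>w. ((fst w, fst (snd w)), (Xact Y a\<^sub>0 (fst w), fst (snd (snd w))), fst w)"])
    show "continuous_map (Etop ?M) (Etop ?P) (\<lambda>z. (snd (snd z), snd (fst z), snd (fst (snd z)), f (snd (snd z))))"
      by (intro continuous_map_pullback_bundleI continuous_map_transfer_bundleI i i'
          continuous_map_compose_app[OF i(3) f])
        (auto simp: top_simps equiv a\<^sub>0)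
    show "continuous_map (Etop ?P) (Etop ?M) (\<lambda>w. ((fst w, fst (snd w)), (Xact Y a\<^sub>0 (fst w), fst (snd (snd w))), fst w))"
      by (intro continuous_map_pullback_bundleI continuous_map_transfer_bundleI j j'
          continuous_map_compose_app[OF j(1) Xact_continuous[OF Y a\<^sub>0(1)]])
        (auto simp: top_simps equiv a\<^sub>0)
  qed (auto simp: top_simps equiv a\<^sub>0 act prod_eq_iff)
qed

end

section \<open>K-groups as groups of formal differences\<close>

text \<open>
  Equality of \<open>a - b\<close> and \<open>c - d\<close> in the Grothendieck group of \<open>V\<close>.
\<close>

definition diff_equiv :: "'a monoid \<Rightarrow> 'a \<Rightarrow> 'a \<Rightarrow> 'a \<Rightarrow> 'a \<Rightarrow> bool" where
  "diff_equiv V a b c d \<longleftrightarrow> (\<exists>f\<in>carrier V. a \<otimes>\<^bsub>V\<^esub> d \<otimes>\<^bsub>V\<^esub> f = c \<otimes>\<^bsub>V\<^esub> b \<otimes>\<^bsub>V\<^esub> f)"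

context
  fixes V :: "'a monoid" (structure)
  assumes V: "comm_monoid V"
begin

interpretation comm_monoid V by (rule V)

lemma diff_equiv_refl: "a \<in> carrier V \<Longrightarrow> b \<in> carrier V \<Longrightarrow> diff_equiv V a b a b"
  unfolding diff_equiv_def by (rule bexI[of _ \<one>]) auto

lemma diff_equiv_sym: "diff_equiv V a b c d \<Longrightarrow> diff_equiv V c d a b"
  unfolding diff_equiv_def by metis

lemma diff_equiv_trans:
  assumes "diff_equiv V a b c d" "diff_equiv V c d e h"
    and [simp]: "a \<in> carrier V" "b \<in> carrier V" "c \<in> carrier V" "d \<in> carrier V" "e \<in> carrier V" "h \<in> carrier V"
  shows "diff_equiv V a b e h"
proof -
  obtain f g where [simp]: "f \<in> carrier V" "g \<in> carrier V"
    and f: "a \<otimes> d \<otimes> f = c \<otimes> b \<otimes> f" and g: "c \<otimes> h \<otimes> g = e \<otimes> d \<otimes> g"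
    using assms(1,2) unfolding diff_equiv_def by blast
  have "a \<otimes> h \<otimes> (d \<otimes> f \<otimes> g) = (a \<otimes> d \<otimes> f) \<otimes> (h \<otimes> g)" by (simp add: m_ac)
  also have "\<dots> = (c \<otimes> h \<otimes> g) \<otimes> (b \<otimes> f)" unfolding f by (simp add: m_ac)
  also have "\<dots> = e \<otimes> b \<otimes> (d \<otimes> f \<otimes> g)" unfolding g by (simp add: m_ac)
  finally show ?thesis unfolding diff_equiv_def by (intro bexI[of _ "d \<otimes> f \<otimes> g"]) auto
qed

lemma diff_equiv_mult:
  assumes "diff_equiv V a b c d" "diff_equiv V a' b' c' d'"
    and [simp]: "a \<in> carrier V" "b \<in> carrier V" "c \<in> carrier V" "d \<in> carrier V"
      "a' \<in> carrier V" "b' \<in> carrier V" "c' \<in> carrier V" "d' \<in> carrier V"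
  shows "diff_equiv V (a \<otimes> a') (b \<otimes> b') (c \<otimes> c') (d \<otimes> d')"
proof -
  obtain f g where [simp]: "f \<in> carrier V" "g \<in> carrier V"
    and f: "a \<otimes> d \<otimes> f = c \<otimes> b \<otimes> f" and g: "a' \<otimes> d' \<otimes> g = c' \<otimes> b' \<otimes> g"
    using assms(1,2) unfolding diff_equiv_def by blast
  have "(a \<otimes> a') \<otimes> (d \<otimes> d') \<otimes> (f \<otimes> g) = (a \<otimes> d \<otimes> f) \<otimes> (a' \<otimes> d' \<otimes> g)" by (simp add: m_ac)
  also have "\<dots> = (c \<otimes> c') \<otimes> (b \<otimes> b') \<otimes> (f \<otimes> g)" unfolding f g by (simp add: m_ac)
  finally show ?thesis unfolding diff_equiv_def by (intro bexI[of _ "f \<otimes> g"]) auto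
qed

end

text \<open>
  The class contains standard bundles only, so that bundles with total spaces of different types
  can be compared by equality of their classes.
\<close>

definition iso_class ::
    "'g graded_group \<Rightarrow> ('g, 'x) gspace \<Rightarrow> ('g, 'x, 'e) gbundle \<Rightarrow> ('g, 'x) std_bundle set" where
  "iso_class L X E = {P. magnetic_bundle L X P \<and> bundle_iso L E P}"

definition bundle_monoid ::
    "'g graded_group \<Rightarrow> ('g, 'x) gspace \<Rightarrow> ('g, 'x) std_bundle set monoid" where
  "bundle_monoid L X =
     \<lparr>carrier = {iso_class L X E | E :: ('g, 'x) std_bundle. magnetic_bundle L X E},
      monoid.mult = (\<lambda>A B. \<Union>E\<in>A. \<Union>F\<in>B. iso_class L X (E \<oplus>\<^sub>B F)),
      one = iso_class L X (zero_bundle X)\<rparr>"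

locale equivariant_base =
  fixes L :: "'g graded_group" and X :: "('g, 'x) gspace"
  assumes top: "topological_group L" and space: "G_space L X"
begin

abbreviation "mag E \<equiv> magnetic_bundle L X E"
abbreviation "V \<equiv> bundle_monoid L X"
abbreviation "cls E \<equiv> iso_class L X E"

lemma standard_representative:
  assumes "mag E"
  obtains P :: "('g, 'x) std_bundle" where "mag P" "bundle_iso L E P"
proof -
  obtain P :: "('g, 'x) std_bundle" where P: "bundle_iso L E P"
    using standard_bundle_exists[OF magnetic_bundleD(1)[OF assms top]] by blast
  show thesis by (rule that[OF magnetic_bundle_iso[OF P assms top] P])
qed

lemma iso_class_eq_iff:
  assumes E: "mag E" and F: "mag F"
  shows "cls E = cls F \<longleftrightarrow> bundle_iso L E F"
proof
  assume eq: "cls E = cls F"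
  obtain P :: "('g, 'x) std_bundle" where P: "mag P" "bundle_iso L E P"
    using standard_representative[OF E] .
  then have "bundle_iso L F P" using eq by (auto simp: iso_class_def)
  then show "bundle_iso L E F"
    by (rule bundle_iso_trans[OF P(2) bundle_iso_sym[OF _ F top]])
next
  assume EF: "bundle_iso L E F"
  show "cls E = cls F"
    by (auto simp: iso_class_def intro: bundle_iso_trans[OF EF] bundle_iso_trans[OF bundle_iso_sym[OF EF E top]])
qed

lemma mem_iso_class: "P \<in> cls E \<longleftrightarrow> mag P \<and> bundle_iso L E P"
  by (simp add: iso_class_def)

lemma iso_class_nonempty:
  assumes "mag E"
  shows "cls E \<noteq> {}"
proof -
  obtain P :: "('g, 'x) std_bundle" where "mag P" "bundle_iso L E P"
    using standard_representative[OF assms] .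
  then have "P \<in> cls E" by (simp add: mem_iso_class)
  then show ?thesis by blast
qed

lemma iso_class_std:
  assumes "mag E"
  obtains P :: "('g, 'x) std_bundle" where "mag P" "cls E = cls P"
proof -
  obtain P :: "('g, 'x) std_bundle" where P: "mag P" "bundle_iso L E P"
    using standard_representative[OF assms] .
  then have "cls E = cls P" by (simp add: iso_class_eq_iff assms)
  with P(1) show thesis by (rule that)
qed

lemma carrier_V: "a \<in> carrier V \<longleftrightarrow> (\<exists>E :: ('g, 'x) std_bundle. mag E \<and> a = cls E)"
  by (auto simp: bundle_monoid_def)

lemma iso_class_zero: "cls (zero_bundle X) = \<one>\<^bsub>V\<^esub>"
  by (simp add: bundle_monoid_def)

lemma iso_class_closed [simp]: "mag E \<Longrightarrow> cls E \<in> carrier V"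
  by (erule iso_class_std) (auto simp: carrier_V)

lemma magnetic_sum [simp]:
  "mag E \<Longrightarrow> mag F \<Longrightarrow> mag (E \<oplus>\<^sub>B F)"
  by (rule magnetic_bundle_sum[OF _ _ top])

lemma magnetic_zero [simp]: "mag (zero_bundle X)"
  by (rule magnetic_bundle_zero[OF space top])

lemma iso_class_sum:
  assumes E: "mag E" and F: "mag F"
  shows "cls (E \<oplus>\<^sub>B F) = cls E \<otimes>\<^bsub>V\<^esub> cls F"
proof -
  have "cls (P \<oplus>\<^sub>B Q) = cls (E \<oplus>\<^sub>B F)" if "P \<in> cls E" "Q \<in> cls F" for P Q
  proof -
    have "bundle_iso L (E \<oplus>\<^sub>B F) (P \<oplus>\<^sub>B Q)"
      by (rule bundle_sum_iso_cong) (use that in \<open>auto simp: mem_iso_class\<close>)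
    then have "cls (E \<oplus>\<^sub>B F) = cls (P \<oplus>\<^sub>B Q)"
      by (subst iso_class_eq_iff) (use that E F in \<open>auto simp: mem_iso_class\<close>)
    then show ?thesis by simp
  qed
  moreover have "cls E \<noteq> {}" "cls F \<noteq> {}"
    by (rule iso_class_nonempty, fact)+
  ultimately have "(\<Union>P\<in>cls E. \<Union>Q\<in>cls F. cls (P \<oplus>\<^sub>B Q)) = cls (E \<oplus>\<^sub>B F)"
    by auto
  then show ?thesis by (simp add: bundle_monoid_def)
qed

lemma comm_monoid_V: "comm_monoid V"
proof -
  have rep: "\<exists>E :: ('g, 'x) std_bundle. mag E \<and> a = cls E" if "a \<in> carrier V" for a
    using that by (simp add: carrier_V)
  note one = iso_class_zero[symmetric]
  show ?thesis
  proof (rule comm_monoidI)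
    fix x y assume "x \<in> carrier V" "y \<in> carrier V"
    then obtain E F :: "('g, 'x) std_bundle" where *: "mag E" "x = cls E"
      "mag F" "y = cls F"
      using rep by metis
    then show "x \<otimes>\<^bsub>V\<^esub> y \<in> carrier V"
      by (simp flip: iso_class_sum)
    have "cls (E \<oplus>\<^sub>B F) = cls (F \<oplus>\<^sub>B E)"
      using * bundle_sum_iso_commute by (simp add: iso_class_eq_iff)
    then show "x \<otimes>\<^bsub>V\<^esub> y = y \<otimes>\<^bsub>V\<^esub> x"
      using * by (simp add: iso_class_sum)
    have "cls (E \<oplus>\<^sub>B zero_bundle X) = cls E"
      using * bundle_sum_iso_zero[OF *(1) top] by (simp add: iso_class_eq_iff)
    then have "x \<otimes>\<^bsub>V\<^esub> \<one>\<^bsub>V\<^esub> = x"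
      using * by (simp add: iso_class_sum one)
    moreover have "cls (E \<oplus>\<^sub>B zero_bundle X) = cls (zero_bundle X \<oplus>\<^sub>B E)"
      using * bundle_sum_iso_commute by (simp add: iso_class_eq_iff)
    ultimately show "\<one>\<^bsub>V\<^esub> \<otimes>\<^bsub>V\<^esub> x = x"
      using * by (simp add: iso_class_sum one)
    fix z assume "z \<in> carrier V"
    then obtain H :: "('g, 'x) std_bundle" where H: "mag H" "z = cls H"
      using rep by metis
    have "cls (E \<oplus>\<^sub>B F \<oplus>\<^sub>B H) = cls (E \<oplus>\<^sub>B (F \<oplus>\<^sub>B H))"
      using * H bundle_sum_iso_assoc by (simp add: iso_class_eq_iff)
    then show "x \<otimes>\<^bsub>V\<^esub> y \<otimes>\<^bsub>V\<^esub> z = x \<otimes>\<^bsub>V\<^esub> (y \<otimes>\<^bsub>V\<^esub> z)"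
      using * H by (simp add: iso_class_sum)
  qed (simp add: one)
qed

sublocale V: comm_monoid V by (rule comm_monoid_V)

abbreviation "K E F \<equiv> K_class L X E F"
abbreviation "KG \<equiv> K_group L X"

text \<open>
  The classes of formal differences are the elements of the Grothendieck group of the monoid of
  isomorphism classes; this reduces statements about them to cancellation in that monoid.
\<close>

lemma mem_K_class:
  assumes E: "mag E0" "mag E1"
  shows "(P0, P1) \<in> K E0 E1 \<longleftrightarrow>
     mag P0 \<and> mag P1 \<and> diff_equiv V (cls E0) (cls E1) (cls P0) (cls P1)"
proof -
  have "(\<exists>F :: ('g, 'x) std_bundle. mag F \<and>
           bundle_iso L (E0 \<oplus>\<^sub>B P1 \<oplus>\<^sub>B F) (P0 \<oplus>\<^sub>B E1 \<oplus>\<^sub>B F)) \<longleftrightarrow>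
        diff_equiv V (cls E0) (cls E1) (cls P0) (cls P1)"
    if P: "mag P0" "mag P1"
  proof -
    have "bundle_iso L (E0 \<oplus>\<^sub>B P1 \<oplus>\<^sub>B F) (P0 \<oplus>\<^sub>B E1 \<oplus>\<^sub>B F) \<longleftrightarrow>
        cls E0 \<otimes>\<^bsub>V\<^esub> cls P1 \<otimes>\<^bsub>V\<^esub> cls F = cls P0 \<otimes>\<^bsub>V\<^esub> cls E1 \<otimes>\<^bsub>V\<^esub> cls F"
      if "mag F" for F :: "('g, 'x) std_bundle"
      using E P that by (simp flip: iso_class_eq_iff iso_class_sum)
    then show ?thesis
      unfolding diff_equiv_def Bex_def carrier_V by blast
  qed
  then show ?thesis unfolding K_class_def by auto
qed

lemma K_class_eq_iff:
  assumes E: "mag E0" "mag E1"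
    and F: "mag F0" "mag F1"
  shows "K E0 E1 = K F0 F1 \<longleftrightarrow> diff_equiv V (cls E0) (cls E1) (cls F0) (cls F1)"
proof
  assume eq: "K E0 E1 = K F0 F1"
  obtain P0 :: "('g, 'x) std_bundle" where P0: "mag P0" "cls F0 = cls P0"
    using iso_class_std[OF F(1)] .
  obtain P1 :: "('g, 'x) std_bundle" where P1: "mag P1" "cls F1 = cls P1"
    using iso_class_std[OF F(2)] .
  have "(P0, P1) \<in> K F0 F1"
    using P0 P1 by (simp add: mem_K_class F diff_equiv_refl[OF comm_monoid_V])
  then have "(P0, P1) \<in> K E0 E1" using eq by simp
  then show "diff_equiv V (cls E0) (cls E1) (cls F0) (cls F1)"
    using P0 P1 by (simp add: mem_K_class E)
next
  assume d: "diff_equiv V (cls E0) (cls E1) (cls F0) (cls F1)"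
  have "diff_equiv V (cls E0) (cls E1) (cls P0) (cls P1) \<longleftrightarrow> diff_equiv V (cls F0) (cls F1) (cls P0) (cls P1)"
    if "mag P0" "mag P1" for P0 P1 :: "('g, 'x) std_bundle"
    using diff_equiv_trans[OF comm_monoid_V d] diff_equiv_trans[OF comm_monoid_V diff_equiv_sym[OF comm_monoid_V d]]
      E F that by auto
  then show "K E0 E1 = K F0 F1"
    by (auto simp: mem_K_class E F)
qed

lemma K_class_cong:
  assumes "mag E0" "mag E1" "mag F0" "mag F1"
    and "cls E0 = cls F0" "cls E1 = cls F1"
  shows "K E0 E1 = K F0 F1"
  using assms by (simp add: K_class_eq_iff diff_equiv_refl[OF comm_monoid_V])

lemma K_class_std:
  assumes "mag E0" "mag E1"
  obtains P0 P1 :: "('g, 'x) std_bundle" where "mag P0" "mag P1"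
    "bundle_iso L E0 P0" "bundle_iso L E1 P1" "K E0 E1 = K P0 P1"
proof -
  obtain P0 :: "('g, 'x) std_bundle" where P0: "mag P0" "bundle_iso L E0 P0"
    using standard_representative[OF assms(1)] .
  obtain P1 :: "('g, 'x) std_bundle" where P1: "mag P1" "bundle_iso L E1 P1"
    using standard_representative[OF assms(2)] .
  have "K E0 E1 = K P0 P1"
    by (rule K_class_cong) (use assms P0 P1 in \<open>auto simp: iso_class_eq_iff\<close>)
  then show thesis using that P0 P1 by blast
qed

lemma K_class_closed [simp]:
  "mag E0 \<Longrightarrow> mag E1 \<Longrightarrow> K E0 E1 \<in> carrier KG"
  by (erule (1) K_class_std) (auto simp: K_group_def)

lemma K_group_cases:
  assumes "a \<in> carrier KG"
  obtains E0 E1 :: "('g, 'x) std_bundle"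
  where "mag E0" "mag E1" "a = K E0 E1"
  using assms by (auto simp: K_group_def)

lemma K_class_mult:
  assumes E: "mag E0" "mag E1"
    and F: "mag F0" "mag F1"
  shows "K E0 E1 \<otimes>\<^bsub>KG\<^esub> K F0 F1 = K (E0 \<oplus>\<^sub>B F0) (E1 \<oplus>\<^sub>B F1)"
proof -
  have "K (P0 \<oplus>\<^sub>B Q0) (P1 \<oplus>\<^sub>B Q1) = K (E0 \<oplus>\<^sub>B F0) (E1 \<oplus>\<^sub>B F1)"
    if PQ: "(P0, P1) \<in> K E0 E1" "(Q0, Q1) \<in> K F0 F1" for P0 P1 Q0 Q1
  proof -
    have P: "mag P0" "mag P1" "diff_equiv V (cls E0) (cls E1) (cls P0) (cls P1)"
      and Q: "mag Q0" "mag Q1" "diff_equiv V (cls F0) (cls F1) (cls Q0) (cls Q1)"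
      using PQ by (simp_all add: mem_K_class E F)
    have "K (E0 \<oplus>\<^sub>B F0) (E1 \<oplus>\<^sub>B F1) = K (P0 \<oplus>\<^sub>B Q0) (P1 \<oplus>\<^sub>B Q1)"
      using diff_equiv_mult[OF comm_monoid_V P(3) Q(3)] E F P Q
      by (simp add: K_class_eq_iff iso_class_sum)
    then show ?thesis by simp
  qed
  moreover obtain P0 P1 :: "('g, 'x) std_bundle" where "(P0, P1) \<in> K E0 E1"
    using K_class_std[OF E] E by (metis mem_K_class diff_equiv_refl[OF comm_monoid_V] iso_class_closed)
  moreover obtain Q0 Q1 :: "('g, 'x) std_bundle" where "(Q0, Q1) \<in> K F0 F1"
    using K_class_std[OF F] F by (metis mem_K_class diff_equiv_refl[OF comm_monoid_V] iso_class_closed)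
  ultimately have "(\<Union>(P0, P1)\<in>K E0 E1. \<Union>(Q0, Q1)\<in>K F0 F1. K (P0 \<oplus>\<^sub>B Q0) (P1 \<oplus>\<^sub>B Q1)) =
      K (E0 \<oplus>\<^sub>B F0) (E1 \<oplus>\<^sub>B F1)"
    by fastforce
  then show ?thesis by (simp add: K_group_def)
qed

lemma K_group_one: "\<one>\<^bsub>KG\<^esub> = K (zero_bundle X) (zero_bundle X)"
  by (simp add: K_group_def)

lemma K_class_diagonal:
  assumes "mag E" "mag F" "cls E = cls F"
  shows "K E F = \<one>\<^bsub>KG\<^esub>"
  unfolding K_group_one using assms
  by (subst K_class_eq_iff) (auto simp: diff_equiv_def V.m_ac intro!: bexI[of _ "\<one>\<^bsub>V\<^esub>"])

lemma comm_group_K_group: "comm_group KG"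
proof (rule comm_groupI)
  show "\<one>\<^bsub>KG\<^esub> \<in> carrier KG" by (simp add: K_group_one)
next
  fix x y assume x: "x \<in> carrier KG" and y: "y \<in> carrier KG"
  obtain E0 E1 :: "('g, 'x) std_bundle"
    where E: "mag E0" "mag E1" "x = K E0 E1"
    using x by (rule K_group_cases)
  obtain F0 F1 :: "('g, 'x) std_bundle"
    where F: "mag F0" "mag F1" "y = K F0 F1"
    using y by (rule K_group_cases)
  show "x \<otimes>\<^bsub>KG\<^esub> y \<in> carrier KG"
    using E F by (simp add: K_class_mult)
  show "x \<otimes>\<^bsub>KG\<^esub> y = y \<otimes>\<^bsub>KG\<^esub> x"
    using E F by (simp add: K_class_mult) (rule K_class_cong; simp add: iso_class_sum V.m_comm)
  fix z assume z: "z \<in> carrier KG"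
  obtain H0 H1 :: "('g, 'x) std_bundle"
    where H: "mag H0" "mag H1" "z = K H0 H1"
    using z by (rule K_group_cases)
  show "x \<otimes>\<^bsub>KG\<^esub> y \<otimes>\<^bsub>KG\<^esub> z = x \<otimes>\<^bsub>KG\<^esub> (y \<otimes>\<^bsub>KG\<^esub> z)"
    using E F H by (simp add: K_class_mult) (rule K_class_cong; simp add: iso_class_sum V.m_assoc)
next
  fix x assume "x \<in> carrier KG"
  then obtain E0 E1 :: "('g, 'x) std_bundle"
    where E: "mag E0" "mag E1" "x = K E0 E1"
    by (rule K_group_cases)
  note one = iso_class_zero
  show "\<one>\<^bsub>KG\<^esub> \<otimes>\<^bsub>KG\<^esub> x = x"
    using E by (simp add: K_class_mult K_group_one) (rule K_class_cong; simp add: iso_class_sum one)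
  have "K E1 E0 \<otimes>\<^bsub>KG\<^esub> x = \<one>\<^bsub>KG\<^esub>"
    using E by (simp add: K_class_mult) (rule K_class_diagonal; simp add: iso_class_sum V.m_comm)
  then show "\<exists>y\<in>carrier KG. y \<otimes>\<^bsub>KG\<^esub> x = \<one>\<^bsub>KG\<^esub>"
    using E by (intro bexI[of _ "K E1 E0"]) auto
qed

sublocale KG: comm_group KG by (rule comm_group_K_group)

lemma K_class_inv:
  assumes "mag E0" "mag E1"
  shows "inv\<^bsub>KG\<^esub> (K E0 E1) = K E1 E0"
proof (rule KG.inv_equality)
  show "K E1 E0 \<otimes>\<^bsub>KG\<^esub> K E0 E1 = \<one>\<^bsub>KG\<^esub>"
    using assms by (simp add: K_class_mult) (rule K_class_diagonal; simp add: iso_class_sum V.m_comm)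
qed (use assms in auto)

end

text \<open>
  Additivity is stated so that it includes invariance under isomorphism: adding the zero bundle
  turns an isomorphism \<open>E \<cong> H\<close> into one of the form \<open>E \<oplus> F \<cong> H\<close>.
\<close>

locale additive_construction =
  A: equivariant_base L X + B: equivariant_base M Y
  for L :: "'g graded_group" and X :: "('g, 'x) gspace" and M :: "'h graded_group" and Y :: "('h, 'y) gspace" +
  fixes t :: "('g, 'x) std_bundle \<Rightarrow> ('h, 'y, 'e) gbundle"
  assumes magnetic: "\<And>E. magnetic_bundle L X E \<Longrightarrow> magnetic_bundle M Y (t E)"
    and additive: "\<And>E F H. magnetic_bundle L X E \<Longrightarrow> magnetic_bundle L X F \<Longrightarrow> magnetic_bundle L X H \<Longrightarrow>
          bundle_iso L (E \<oplus>\<^sub>B F) H \<Longrightarrow> bundle_iso M (t E \<oplus>\<^sub>B t F) (t H)"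
begin

lemma class_sum:
  assumes "A.mag E" "A.mag F" "A.mag H"
    and "A.cls E \<otimes>\<^bsub>A.V\<^esub> A.cls F = A.cls H"
  shows "B.cls (t E) \<otimes>\<^bsub>B.V\<^esub> B.cls (t F) = B.cls (t H)"
  using assms additive magnetic
  by (simp add: A.iso_class_eq_iff B.iso_class_eq_iff flip: A.iso_class_sum B.iso_class_sum)

lemma class_cong:
  assumes E: "A.mag E" and F: "A.mag F" and eq: "A.cls E = A.cls F"
  shows "B.cls (t E) = B.cls (t F)"
proof -
  obtain Z :: "('g, 'x) std_bundle" where Z: "A.mag Z" "A.cls (zero_bundle X) = A.cls Z"
    using A.iso_class_std[OF A.magnetic_zero] .
  have "A.cls E \<otimes>\<^bsub>A.V\<^esub> A.cls Z = A.cls E"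
    using Z(2) A.V.r_one[OF A.iso_class_closed[OF E]] by (simp add: A.iso_class_zero)
  then have "B.cls (t E) \<otimes>\<^bsub>B.V\<^esub> B.cls (t Z) = B.cls (t E)" "B.cls (t E) \<otimes>\<^bsub>B.V\<^esub> B.cls (t Z) = B.cls (t F)"
    using class_sum[OF E Z(1) E] class_sum[OF E Z(1) F] eq by simp_all
  then show ?thesis by simp
qed

text \<open>
  The map on isomorphism classes is additive, hence carries the equation that witnesses the
  equivalence to another one. Standard bundles \<open>S\<close> and \<open>S'\<close> represent its two sides.
\<close>

lemma diff_equiv_image:
  assumes m: "A.mag P0" "A.mag P1" "A.mag Q0" "A.mag Q1"
    and d: "diff_equiv A.V (A.cls P0) (A.cls P1) (A.cls Q0) (A.cls Q1)"
  shows "diff_equiv B.V (B.cls (t P0)) (B.cls (t P1)) (B.cls (t Q0)) (B.cls (t Q1))"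
proof -
  obtain F :: "('g, 'x) std_bundle" where F: "A.mag F"
    "A.cls P0 \<otimes>\<^bsub>A.V\<^esub> A.cls Q1 \<otimes>\<^bsub>A.V\<^esub> A.cls F = A.cls Q0 \<otimes>\<^bsub>A.V\<^esub> A.cls P1 \<otimes>\<^bsub>A.V\<^esub> A.cls F"
    using d unfolding diff_equiv_def Bex_def A.carrier_V by blast
  have sum: "\<exists>S :: ('g, 'x) std_bundle. A.mag S \<and>
      A.cls E \<otimes>\<^bsub>A.V\<^esub> A.cls E' \<otimes>\<^bsub>A.V\<^esub> A.cls F = A.cls S \<and>
      B.cls (t E) \<otimes>\<^bsub>B.V\<^esub> B.cls (t E') \<otimes>\<^bsub>B.V\<^esub> B.cls (t F) = B.cls (t S)"
    if E: "A.mag E" "A.mag E'" for E E' :: "('g, 'x) std_bundle"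
  proof -
    obtain R :: "('g, 'x) std_bundle" where R: "A.mag R" "A.cls (E \<oplus>\<^sub>B E') = A.cls R"
      using A.iso_class_std[OF A.magnetic_sum[OF E]] .
    obtain S :: "('g, 'x) std_bundle" where S: "A.mag S" "A.cls (R \<oplus>\<^sub>B F) = A.cls S"
      using A.iso_class_std[OF A.magnetic_sum[OF R(1) F(1)]] .
    show ?thesis
      using E R S F(1) class_sum[OF E R(1)] class_sum[OF R(1) F(1) S(1)]
      by (intro exI[of _ S]) (simp add: A.iso_class_sum)
  qed
  obtain S :: "('g, 'x) std_bundle" where S: "A.mag S"
      "A.cls P0 \<otimes>\<^bsub>A.V\<^esub> A.cls Q1 \<otimes>\<^bsub>A.V\<^esub> A.cls F = A.cls S"
      "B.cls (t P0) \<otimes>\<^bsub>B.V\<^esub> B.cls (t Q1) \<otimes>\<^bsub>B.V\<^esub> B.cls (t F) = B.cls (t S)"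
    using sum[OF m(1,4)] by blast
  obtain S' :: "('g, 'x) std_bundle" where S': "A.mag S'"
      "A.cls Q0 \<otimes>\<^bsub>A.V\<^esub> A.cls P1 \<otimes>\<^bsub>A.V\<^esub> A.cls F = A.cls S'"
      "B.cls (t Q0) \<otimes>\<^bsub>B.V\<^esub> B.cls (t P1) \<otimes>\<^bsub>B.V\<^esub> B.cls (t F) = B.cls (t S')"
    using sum[OF m(3,2)] by blast
  have "B.cls (t S) = B.cls (t S')"
    by (rule class_cong[OF S(1) S'(1)]) (use S S' F in simp)
  then show ?thesis
    unfolding diff_equiv_def using S S' magnetic[OF F(1)] by (intro bexI[of _ "B.cls (t F)"]) auto
qed

lemma K_induced_class:
  assumes E: "A.mag E0" "A.mag E1"
  shows "K_induced M Y t (A.K E0 E1) = B.K (t E0) (t E1)"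
proof -
  have 1: "B.K (t P0) (t P1) = B.K (t E0) (t E1)" if "(P0, P1) \<in> A.K E0 E1" for P0 P1
  proof -
    have P: "A.mag P0" "A.mag P1"
      "diff_equiv A.V (A.cls E0) (A.cls E1) (A.cls P0) (A.cls P1)"
      using that by (simp_all add: A.mem_K_class E)
    have "B.K (t E0) (t E1) = B.K (t P0) (t P1)"
      using diff_equiv_image[OF E P] E P by (simp add: B.K_class_eq_iff magnetic)
    then show ?thesis by simp
  qed
  have 2: "(E0, E1) \<in> A.K E0 E1"
    using E by (simp add: A.mem_K_class diff_equiv_refl[OF A.comm_monoid_V])
  show ?thesis
    unfolding K_induced_def
  proof (rule equalityI)
    show "(\<Union>(P0, P1)\<in>A.K E0 E1. B.K (t P0) (t P1)) \<subseteq> B.K (t E0) (t E1)"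
      by (rule UN_least) (use 1 in blast)
    show "B.K (t E0) (t E1) \<subseteq> (\<Union>(P0, P1)\<in>A.K E0 E1. B.K (t P0) (t P1))"
      using UN_upper[OF 2, of "\<lambda>(P0, P1). B.K (t P0) (t P1)"] by simp
  qed
qed

lemma K_induced_hom: "K_induced M Y t \<in> hom A.KG B.KG"
proof (rule homI)
  fix x assume "x \<in> carrier A.KG"
  then obtain E0 E1 :: "('g, 'x) std_bundle"
    where E: "A.mag E0" "A.mag E1" "x = A.K E0 E1"
    by (rule A.K_group_cases)
  then show "K_induced M Y t x \<in> carrier B.KG"
    by (simp add: K_induced_class magnetic)
  fix y assume "y \<in> carrier A.KG"
  then obtain F0 F1 :: "('g, 'x) std_bundle"
    where F: "A.mag F0" "A.mag F1" "y = A.K F0 F1"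
    by (rule A.K_group_cases)
  obtain P0 P1 :: "('g, 'x) std_bundle" where P: "A.mag P0" "A.mag P1"
    "bundle_iso L (E0 \<oplus>\<^sub>B F0) P0" "bundle_iso L (E1 \<oplus>\<^sub>B F1) P1"
    "A.K (E0 \<oplus>\<^sub>B F0) (E1 \<oplus>\<^sub>B F1) = A.K P0 P1"
    using A.K_class_std[OF A.magnetic_sum[OF E(1) F(1)] A.magnetic_sum[OF E(2) F(2)]] .
  have "K_induced M Y t (x \<otimes>\<^bsub>A.KG\<^esub> y) = B.K (t P0) (t P1)"
    using E F P by (simp add: A.K_class_mult K_induced_class)
  also have "\<dots> = B.K (t E0 \<oplus>\<^sub>B t F0) (t E1 \<oplus>\<^sub>B t F1)"
    by (rule B.K_class_cong)
      (use E F P additive[OF E(1) F(1) P(1,3)] additive[OF E(2) F(2) P(2,4)] in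
        \<open>simp_all add: magnetic B.iso_class_eq_iff[symmetric]\<close>)
  finally show "K_induced M Y t (x \<otimes>\<^bsub>A.KG\<^esub> y) = K_induced M Y t x \<otimes>\<^bsub>B.KG\<^esub> K_induced M Y t y"
    using E F by (simp add: K_induced_class B.K_class_mult magnetic)
qed

end

section \<open>Twisted and reduced K-groups\<close>

locale twisted_base = equivariant_base L X
  for L :: "'g graded_group" and X :: "('g, 'x) gspace" +
  fixes inc :: "complex \<Rightarrow> 'g"
  assumes inc_closed: "\<And>a. a \<in> carrier sign_group \<Longrightarrow> inc a \<in> carrier L"
    and inc_trivial: "\<And>a x. a \<in> carrier sign_group \<Longrightarrow> x \<in> topspace (Xtop X) \<Longrightarrow> Xact X (inc a) x = x"
begin

lemma twisted_magnetic: "twisted_bundle inc L X E \<Longrightarrow> mag E"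
  by (simp add: twisted_bundle_def)

lemma twisted_zero: "twisted_bundle inc L X (zero_bundle X)"
  using inc_trivial by (simp add: twisted_bundle_def) (simp add: zero_bundle_def)

lemma twisted_sum:
  "twisted_bundle inc L X E \<Longrightarrow> twisted_bundle inc L X F \<Longrightarrow> twisted_bundle inc L X (E \<oplus>\<^sub>B F)"
  by (auto simp: twisted_bundle_def topspace_bundle_sum) (auto simp: bundle_sum_sel)

lemma twisted_iso:
  assumes "bundle_iso L E F" and E: "twisted_bundle inc L X E"
  shows "twisted_bundle inc L X F"
proof -
  obtain h k where "bundle_isomorphisms L E F h k"
    using assms(1) by (auto simp: bundle_iso_iff)
  note hk = bundle_isomorphismsD(4,6,10,11)[OF this]
  have "Eact F (inc a) f = Escale F a f" if "a \<in> carrier sign_group" "f \<in> Epts F" for a f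
  proof -
    have "Eact F (inc a) (h (k f)) = Escale F a (h (k f))"
      using E that hk(2)[OF that(2)] inc_closed[OF that(1)]
      by (simp add: twisted_bundle_def flip: hk(3,4))
    then show ?thesis using hk(1)[OF that(2)] by simp
  qed
  then show ?thesis
    using magnetic_bundle_iso[OF assms(1) twisted_magnetic[OF E] top] by (simp add: twisted_bundle_def)
qed

lemma K_class_twisted_std:
  assumes "twisted_bundle inc L X E0" "twisted_bundle inc L X E1"
  obtains P0 P1 :: "('g, 'x) std_bundle"
  where "twisted_bundle inc L X P0" "twisted_bundle inc L X P1" "K E0 E1 = K P0 P1"
  using K_class_std[OF twisted_magnetic[OF assms(1)] twisted_magnetic[OF assms(2)]]
    twisted_iso[OF _ assms(1)] twisted_iso[OF _ assms(2)] by metis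

abbreviation "TK \<equiv> twisted_K_group inc L X"

text \<open>
  The inverse of the class of \<open>E - 0\<close> is that of \<open>0 - E\<close>, so the subgroup generated by the twisted
  bundles consists of the differences of two of them.
\<close>

lemma carrier_twisted_K_group:
  "carrier TK = {K E0 E1 | (E0 :: ('g, 'x) std_bundle) (E1 :: ('g, 'x) std_bundle).
     twisted_bundle inc L X E0 \<and> twisted_bundle inc L X E1}" (is "_ = ?H")
proof
  let ?S = "{K E (zero_bundle X) | E :: ('g, 'x) std_bundle. twisted_bundle inc L X E}"
  have in_H: "K E0 E1 \<in> ?H" if "twisted_bundle inc L X E0" "twisted_bundle inc L X E1"
    for E0 :: "('g, 'x, 'e) gbundle" and E1 :: "('g, 'x, 'f) gbundle"
    using that by (rule K_class_twisted_std) blast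
  have "subgroup ?H KG"
  proof (rule KG.subgroupI)
    show "?H \<subseteq> carrier KG" by (auto simp: twisted_magnetic)
    show "?H \<noteq> {}" using in_H[OF twisted_zero twisted_zero] by blast
  next
    fix a assume "a \<in> ?H"
    then obtain E0 E1 :: "('g, 'x) std_bundle"
      where E: "a = K E0 E1" "twisted_bundle inc L X E0" "twisted_bundle inc L X E1" by blast
    then show "inv\<^bsub>KG\<^esub> a \<in> ?H"
      using in_H[OF E(3,2)] by (simp add: K_class_inv twisted_magnetic)
    fix b assume "b \<in> ?H"
    then obtain F0 F1 :: "('g, 'x) std_bundle"
      where F: "b = K F0 F1" "twisted_bundle inc L X F0" "twisted_bundle inc L X F1" by blast
    show "a \<otimes>\<^bsub>KG\<^esub> b \<in> ?H"
      using in_H[OF twisted_sum[OF E(2) F(2)] twisted_sum[OF E(3) F(3)]] E F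
      by (simp add: K_class_mult twisted_magnetic)
  qed
  moreover have "carrier KG \<inter> ?S \<subseteq> ?H"
    using in_H twisted_zero by blast
  ultimately show "carrier TK \<subseteq> ?H"
    unfolding twisted_K_group_def carrier_subgroup_generated by (rule KG.generate_subgroup_incl[rotated])
  show "?H \<subseteq> carrier TK"
  proof
    fix a assume "a \<in> ?H"
    then obtain E0 E1 :: "('g, 'x) std_bundle"
      where E: "a = K E0 E1" "twisted_bundle inc L X E0" "twisted_bundle inc L X E1" by blast
    have gen: "K E (zero_bundle X) \<in> carrier KG \<inter> ?S" if "twisted_bundle inc L X E"
      for E :: "('g, 'x) std_bundle"
      using that by (auto simp: twisted_magnetic)
    have "a = K E0 (zero_bundle X) \<otimes>\<^bsub>KG\<^esub> inv\<^bsub>KG\<^esub> (K E1 (zero_bundle X))"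
      unfolding E(1) using E(2,3)[THEN twisted_magnetic]
      by (simp add: K_class_mult K_class_inv) (rule K_class_cong; simp add: iso_class_sum iso_class_zero)
    then show "a \<in> carrier TK"
      unfolding twisted_K_group_def carrier_subgroup_generated
      using generate.eng[OF generate.incl[OF gen[OF E(2)]] generate.inv[OF gen[OF E(3)]]] by simp
  qed
qed

lemma twisted_K_group_cases:
  assumes "a \<in> carrier TK"
  obtains E0 E1 :: "('g, 'x) std_bundle"
  where "twisted_bundle inc L X E0" "twisted_bundle inc L X E1" "a = K E0 E1"
  using assms by (auto simp: carrier_twisted_K_group)

lemma twisted_K_class_closed:
  "twisted_bundle inc L X E0 \<Longrightarrow> twisted_bundle inc L X E1 \<Longrightarrow> K E0 E1 \<in> carrier TK"
  by (erule (1) K_class_twisted_std) (auto simp: carrier_twisted_K_group)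

lemma twisted_K_group_sel: "x \<otimes>\<^bsub>TK\<^esub> y = x \<otimes>\<^bsub>KG\<^esub> y" "\<one>\<^bsub>TK\<^esub> = \<one>\<^bsub>KG\<^esub>"
  by (simp_all add: twisted_K_group_def)

lemma twisted_K_group_subset: "carrier TK \<subseteq> carrier KG"
  by (auto simp: carrier_twisted_K_group twisted_magnetic)

lemma group_twisted_K_group: "group TK"
  unfolding twisted_K_group_def by (rule KG.group_subgroup_generated)

end

lemma (in additive_construction) K_induced_twisted_hom:
  assumes A': "twisted_base L X inc" and B': "twisted_base M Y inc'"
    and t: "\<And>E. twisted_bundle inc L X E \<Longrightarrow> twisted_bundle inc' M Y (t E)"
  shows "K_induced M Y t \<in> hom (twisted_K_group inc L X) (twisted_K_group inc' M Y)"
proof (rule homI)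
  interpret A': twisted_base L X inc by (rule A')
  interpret B': twisted_base M Y inc' by (rule B')
  fix x assume x: "x \<in> carrier A'.TK"
  then obtain E0 E1 :: "('g, 'x) std_bundle"
    where E: "twisted_bundle inc L X E0" "twisted_bundle inc L X E1" "x = A.K E0 E1"
    by (rule A'.twisted_K_group_cases)
  then show "K_induced M Y t x \<in> carrier B'.TK"
    by (simp add: K_induced_class A'.twisted_magnetic B'.twisted_K_class_closed t)
  fix y assume "y \<in> carrier A'.TK"
  with x show "K_induced M Y t (x \<otimes>\<^bsub>A'.TK\<^esub> y) = K_induced M Y t x \<otimes>\<^bsub>B'.TK\<^esub> K_induced M Y t y"
    using hom_mult[OF K_induced_hom] A'.twisted_K_group_subset
    by (auto simp: A'.twisted_K_group_sel B'.twisted_K_group_sel)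
qed

text \<open>
  For composing induced maps: the bundles produced by the inner construction are not standard and
  have to be replaced by isomorphic ones before the outer construction applies.
\<close>

lemma (in additive_construction) K_induced_class_std:
  assumes "A.mag E0" "A.mag E1"
  obtains P0 P1 :: "('g, 'x) std_bundle"
  where "A.mag P0" "A.mag P1" "bundle_iso L E0 P0" "bundle_iso L E1 P1"
    "K_induced M Y t (A.K E0 E1) = B.K (t P0) (t P1)"
  using A.K_class_std[OF assms] K_induced_class by metis


section \<open>Restriction, conjugation and transfer on K-groups\<close>

locale twisted_magnetic = magnetic L a\<^sub>0
  for L :: "'g graded_group" (structure) and a\<^sub>0 :: 'g +
  fixes X :: "('g, 'x) gspace" and inc :: "complex \<Rightarrow> 'g"
  assumes space: "G_space L X"
    and inc_kernel: "\<And>a. a \<in> carrier sign_group \<Longrightarrow> inc a \<in> carrier L\<^sub>0"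
    and inc_central: "\<And>a. a \<in> carrier sign_group \<Longrightarrow> inc a \<otimes> a\<^sub>0 = a\<^sub>0 \<otimes> inc a"
    and inc_trivial: "\<And>a x. a \<in> carrier sign_group \<Longrightarrow> x \<in> topspace (Xtop X) \<Longrightarrow> Xact X (inc a) x = x"
begin

sublocale A: twisted_base L X inc
  by unfold_locales (use top space inc_kernel parity(1) inc_trivial in auto)

sublocale B: twisted_base L\<^sub>0 X inc
  by unfold_locales
    (use topological_group_kernel G_space_kernel[OF space] inc_kernel inc_trivial in auto)

abbreviation "res \<equiv> K_induced L\<^sub>0 X (\<lambda>E :: ('g, 'x) std_bundle. E)"
abbreviation "tr \<equiv> K_induced L X (transfer_bundle L a\<^sub>0 X :: ('g, 'x) std_bundle \<Rightarrow> _)"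
abbreviation "con \<equiv> K_induced L\<^sub>0 X (conjugate_bundle L a\<^sub>0 X :: ('g, 'x) std_bundle \<Rightarrow> _)"

sublocale res: additive_construction L X L\<^sub>0 X "\<lambda>E. E"
  by unfold_locales (auto intro: magnetic_bundle_kernel bundle_iso_kernel)

sublocale tr: additive_construction L\<^sub>0 X L X "transfer_bundle L a\<^sub>0 X"
  by unfold_locales (auto intro: magnetic_bundle_transfer[OF _ space] transfer_bundle_additive)

sublocale con: additive_construction L\<^sub>0 X L\<^sub>0 X "conjugate_bundle L a\<^sub>0 X"
  by unfold_locales (auto intro: magnetic_bundle_conjugate[OF _ space] conjugate_bundle_additive)

lemma res_hom: "res \<in> hom A.TK B.TK"
proof (rule res.K_induced_twisted_hom[OF A.twisted_base_axioms B.twisted_base_axioms])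
  show "twisted_bundle inc L\<^sub>0 X E" if "twisted_bundle inc L X E" for E :: "('g, 'x) std_bundle"
    using that magnetic_bundle_kernel by (auto simp: twisted_bundle_def)
qed

text \<open>
  Signs are real, so they act by the same scalars on a bundle and on its conjugate.
\<close>

lemma tr_hom: "tr \<in> hom B.TK A.TK"
proof (rule tr.K_induced_twisted_hom[OF B.twisted_base_axioms A.twisted_base_axioms])
  fix E :: "('g, 'x) std_bundle" assume E: "twisted_bundle inc L\<^sub>0 X E"
  have "a\<^sub>0 \<otimes> inc a \<otimes> inv a\<^sub>0 = inc a" if "a \<in> carrier sign_group" for a
    using that a\<^sub>0(1) parity(1)[OF inc_kernel[OF that]] by (simp add: m_assoc flip: inc_central)
  moreover have "cnj a = a" if "a \<in> carrier sign_group" for a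
    using that by (auto simp: sign_group_def)
  ultimately show "twisted_bundle inc L X (transfer_bundle L a\<^sub>0 X E)"
    using E tr.magnetic[OF B.twisted_magnetic[OF E]] inc_trivial kernel_deg[OF inc_kernel]
    by (auto simp: twisted_bundle_def topspace_transfer_bundle transfer_bundle_sel(4,5))
qed

lemma con_hom: "con \<in> hom B.KG B.KG"
  by (rule con.K_induced_hom)

lemma con_res:
  assumes "a \<in> carrier A.KG"
  shows "con (res a) = res a"
  using assms
proof (rule A.K_group_cases)
  fix E0 E1 :: "('g, 'x) std_bundle"
  assume E: "A.mag E0" "A.mag E1" "a = A.K E0 E1"
  note E' = E(1,2)[THEN magnetic_bundle_kernel]
  have "B.K (conjugate_bundle L a\<^sub>0 X E0) (conjugate_bundle L a\<^sub>0 X E1) = B.K E0 E1"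
    by (rule B.K_class_cong)
      (use E E' conjugate_bundle_iso_self[OF _ space] in \<open>auto simp: con.magnetic B.iso_class_eq_iff\<close>)
  then show ?thesis
    using E E' by (simp add: res.K_induced_class con.K_induced_class)
qed

lemma tr_res:
  assumes "a \<in> carrier A.KG"
  shows "tr (res a) = a \<otimes>\<^bsub>A.KG\<^esub> a"
  using assms
proof (rule A.K_group_cases)
  fix E0 E1 :: "('g, 'x) std_bundle"
  assume E: "A.mag E0" "A.mag E1" "a = A.K E0 E1"
  note E' = E(1,2)[THEN magnetic_bundle_kernel]
  have "A.K (transfer_bundle L a\<^sub>0 X E0) (transfer_bundle L a\<^sub>0 X E1) = A.K (E0 \<oplus>\<^sub>B E0) (E1 \<oplus>\<^sub>B E1)"
    by (rule A.K_class_cong)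
      (use E E' transfer_bundle_iso_double[OF _ space] in \<open>auto simp: tr.magnetic A.iso_class_eq_iff\<close>)
  then show ?thesis
    using E E' by (simp add: res.K_induced_class tr.K_induced_class A.K_class_mult)
qed

lemma res_tr:
  assumes "b \<in> carrier B.KG"
  shows "res (tr b) = b \<otimes>\<^bsub>B.KG\<^esub> con b"
  using assms
proof (rule B.K_group_cases)
  fix F0 F1 :: "('g, 'x) std_bundle"
  assume F: "B.mag F0" "B.mag F1" "b = B.K F0 F1"
  obtain P0 P1 :: "('g, 'x) std_bundle"
  where P: "A.mag P0" "A.mag P1"
    "bundle_iso L (transfer_bundle L a\<^sub>0 X F0) P0" "bundle_iso L (transfer_bundle L a\<^sub>0 X F1) P1"
    "res (A.K (transfer_bundle L a\<^sub>0 X F0) (transfer_bundle L a\<^sub>0 X F1)) = B.K P0 P1"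
    using res.K_induced_class_std[OF tr.magnetic[OF F(1)] tr.magnetic[OF F(2)]] .
  have iso: "B.cls P = B.cls (F \<oplus>\<^sub>B conjugate_bundle L a\<^sub>0 X F)"
    if "B.mag F" "A.mag P" "bundle_iso L (transfer_bundle L a\<^sub>0 X F) P"
    for F P :: "('g, 'x) std_bundle"
  proof -
    have m: "B.mag (transfer_bundle L a\<^sub>0 X F)"
      by (rule magnetic_bundle_kernel[OF tr.magnetic[OF that(1)]])
    have "B.cls P = B.cls (transfer_bundle L a\<^sub>0 X F)"
      using m that magnetic_bundle_kernel[OF that(2)] bundle_iso_kernel[OF that(3)]
      by (metis B.iso_class_eq_iff)
    also have "\<dots> = B.cls (F \<oplus>\<^sub>B conjugate_bundle L a\<^sub>0 X F)"
      using m that(1) by (simp add: B.iso_class_eq_iff con.magnetic transfer_bundle_iso_restriction)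
    finally show ?thesis .
  qed
  have "B.K P0 P1 = B.K (F0 \<oplus>\<^sub>B conjugate_bundle L a\<^sub>0 X F0) (F1 \<oplus>\<^sub>B conjugate_bundle L a\<^sub>0 X F1)"
    by (rule B.K_class_cong)
      (use F P in \<open>auto simp: con.magnetic magnetic_bundle_kernel iso[OF F(1) P(1,3)] iso[OF F(2) P(2,4)]\<close>)
  then show ?thesis
    using F P by (simp add: tr.K_induced_class con.K_induced_class B.K_class_mult con.magnetic)
qed

lemma transfer_bundle_iso:
  assumes E: "B.mag E" and "bundle_iso L\<^sub>0 E F"
  shows "bundle_iso L (transfer_bundle L a\<^sub>0 X E) (transfer_bundle L a\<^sub>0 X F)"
proof -
  have z: "bundle_iso L\<^sub>0 (E \<oplus>\<^sub>B zero_bundle X) E"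
    by (rule bundle_sum_iso_zero[OF E topological_group_kernel])
  have "A.mag (transfer_bundle L a\<^sub>0 X E \<oplus>\<^sub>B transfer_bundle L a\<^sub>0 X (zero_bundle X))"
    by (intro A.magnetic_sum magnetic_bundle_transfer space E B.magnetic_zero)
  from bundle_iso_sym[OF transfer_bundle_additive[OF z] this top]
  show ?thesis
    by (rule bundle_iso_trans) (rule transfer_bundle_additive[OF bundle_iso_trans[OF z assms(2)]])
qed

end

lemma (in equivariant_base) pullback_bundle_iso:
  assumes E: "magnetic_bundle L X E" and "bundle_iso L E F" and Y: "G_space L Y"
    and f: "continuous_map (Xtop Y) (Xtop X) f"
    and equiv: "\<And>g y. g \<in> carrier L \<Longrightarrow> y \<in> topspace (Xtop Y) \<Longrightarrow> f (Xact Y g y) = Xact X g (f y)"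
  shows "bundle_iso L (pullback_bundle Y f E) (pullback_bundle Y f F)"
proof -
  have z: "bundle_iso L (E \<oplus>\<^sub>B zero_bundle X) E"
    by (rule bundle_sum_iso_zero[OF E top])
  have "magnetic_bundle L Y (pullback_bundle Y f E \<oplus>\<^sub>B pullback_bundle Y f (zero_bundle X))"
    by (intro magnetic_bundle_sum magnetic_bundle_pullback[OF _ top Y f equiv] E magnetic_zero top)
  from bundle_iso_sym[OF pullback_bundle_additive[OF z] this top]
  show ?thesis
    by (rule bundle_iso_trans) (rule pullback_bundle_additive[OF bundle_iso_trans[OF z assms(2)]])
qed

section \<open>Reduced groups and the rational isomorphism\<close>

lemma G_space_subspace_point:
  assumes X: "G_space L X" and L: "topological_group L"
    and fixed: "\<And>g. g \<in> carrier L \<Longrightarrow> Xact X g x\<^sub>0 = x\<^sub>0"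
  shows "G_space L (subspace_of X {x\<^sub>0})"
proof -
  let ?P = "subspace_of X {x\<^sub>0}"
  have id: "continuous_map (Xtop ?P) (Xtop X) (\<lambda>x. x)"
    by (simp add: subspace_of_def continuous_map_from_subtopology continuous_map_ident)
  have "continuous_map (prod_topology (Gtop L) (Xtop ?P)) (Xtop X) (\<lambda>z. Xact X (fst z) (snd z))"
    by (intro G_spaceD(1)[OF X L] continuous_map_fst continuous_map_compose_app[OF continuous_map_snd id])
  then have "continuous_map (prod_topology (Gtop L) (Xtop ?P)) (Xtop ?P) (\<lambda>z. Xact X (fst z) (snd z))"
    using fixed topological_groupD(3)[OF L]
    by (auto simp: subspace_of_def intro!: continuous_map_subtopologyI)
  then show ?thesis
    using X by (auto simp: G_space_def subspace_of_def case_prod_beta')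
qed

locale twisted_magnetic_pointed = twisted_magnetic L a\<^sub>0 X inc
  for L :: "'g graded_group" and a\<^sub>0 :: 'g and X :: "('g, 'x) gspace" and inc :: "complex \<Rightarrow> 'g" +
  fixes x\<^sub>0 :: 'x
  assumes fixed: "\<And>g. g \<in> carrier L \<Longrightarrow> Xact X g x\<^sub>0 = x\<^sub>0"
begin

abbreviation "P \<equiv> subspace_of X {x\<^sub>0}"
abbreviation "pb \<equiv> pullback_bundle P (\<lambda>x. x)"

lemma subspace_sel: "Xact P = Xact X" "Xtop P = subtopology (Xtop X) {x\<^sub>0}"
  by (simp_all add: subspace_of_def)

lemma inclusion_continuous: "continuous_map (Xtop P) (Xtop X) (\<lambda>x. x)"
  by (simp add: subspace_sel continuous_map_from_subtopology continuous_map_ident)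

sublocale P: twisted_magnetic L a\<^sub>0 P inc
  by unfold_locales
    (use G_space_subspace_point[OF space top fixed] inc_kernel inc_central inc_trivial in \<open>auto simp: subspace_sel\<close>)

sublocale ptA: additive_construction L X L P pb
  by unfold_locales
    (auto simp: subspace_sel intro: magnetic_bundle_pullback[OF _ top P.space inclusion_continuous] pullback_bundle_additive)

sublocale ptB: additive_construction L\<^sub>0 X L\<^sub>0 P pb
  by unfold_locales
    (auto simp: subspace_sel intro: magnetic_bundle_pullback[OF _ topological_group_kernel P.B.space inclusion_continuous]
      pullback_bundle_additive)

lemma pullback_twisted:
  assumes "twisted_bundle inc M X E" "magnetic_bundle M P (pb E)"
  shows "twisted_bundle inc M P (pb E)"
  using assms P.inc_trivial
  by (auto simp: twisted_bundle_def topspace_pullback_bundle pullback_bundle_sel subspace_sel)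

abbreviation "restrA \<equiv> K_induced L P (pb :: ('g, 'x) std_bundle \<Rightarrow> _)"
abbreviation "restrB \<equiv> K_induced L\<^sub>0 P (pb :: ('g, 'x) std_bundle \<Rightarrow> _)"

lemma restrA_hom: "group_hom A.TK P.A.TK restrA"
  unfolding group_hom_def group_hom_axioms_def
  by (intro conjI A.group_twisted_K_group P.A.group_twisted_K_group
      ptA.K_induced_twisted_hom[OF A.twisted_base_axioms P.A.twisted_base_axioms] pullback_twisted)
    (auto dest: A.twisted_magnetic intro: ptA.magnetic)

lemma restrB_hom: "group_hom B.TK P.B.TK restrB"
  unfolding group_hom_def group_hom_axioms_def
  by (intro conjI B.group_twisted_K_group P.B.group_twisted_K_group
      ptB.K_induced_twisted_hom[OF B.twisted_base_axioms P.B.twisted_base_axioms] pullback_twisted)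
    (auto dest: B.twisted_magnetic intro: ptB.magnetic)

text \<open>
  A reduced group is the kernel of the restriction to the base point. Therefore restriction of
  the group and transfer respect reduced groups once they commute with this restriction.
\<close>

lemma restr_res:
  assumes "a \<in> carrier A.KG"
  shows "restrB (res a) = P.res (restrA a)"
  using assms
proof (rule A.K_group_cases)
  fix E0 E1 :: "('g, 'x) std_bundle"
  assume E: "A.mag E0" "A.mag E1" "a = A.K E0 E1"
  obtain Q0 Q1 :: "('g, 'x) std_bundle"
  where Q: "P.A.mag Q0" "P.A.mag Q1"
    "bundle_iso L (pb E0) Q0" "bundle_iso L (pb E1) Q1" "P.res (P.A.K (pb E0) (pb E1)) = P.B.K Q0 Q1"
    using P.res.K_induced_class_std[OF ptA.magnetic[OF E(1)] ptA.magnetic[OF E(2)]] .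
  have "P.B.K (pb E0) (pb E1) = P.B.K Q0 Q1"
    by (rule P.B.K_class_cong)
      (use E Q in \<open>auto simp: P.B.iso_class_eq_iff magnetic_bundle_kernel ptB.magnetic bundle_iso_kernel\<close>)
  then show ?thesis
    using E Q by (simp add: res.K_induced_class ptA.K_induced_class ptB.K_induced_class magnetic_bundle_kernel)
qed

lemma restr_tr:
  assumes "b \<in> carrier B.KG"
  shows "restrA (tr b) = P.tr (restrB b)"
  using assms
proof (rule B.K_group_cases)
  fix F0 F1 :: "('g, 'x) std_bundle"
  assume F: "B.mag F0" "B.mag F1" "b = B.K F0 F1"
  obtain P0 P1 :: "('g, 'x) std_bundle"
  where R: "A.mag P0" "A.mag P1"
    "bundle_iso L (transfer_bundle L a\<^sub>0 X F0) P0" "bundle_iso L (transfer_bundle L a\<^sub>0 X F1) P1"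
    "restrA (A.K (transfer_bundle L a\<^sub>0 X F0) (transfer_bundle L a\<^sub>0 X F1)) = P.A.K (pb P0) (pb P1)"
    using ptA.K_induced_class_std[OF tr.magnetic[OF F(1)] tr.magnetic[OF F(2)]] .
  obtain Q0 Q1 :: "('g, 'x) std_bundle"
  where Q: "P.B.mag Q0" "P.B.mag Q1"
    "bundle_iso L\<^sub>0 (pb F0) Q0" "bundle_iso L\<^sub>0 (pb F1) Q1"
    "P.tr (P.B.K (pb F0) (pb F1)) = P.A.K (transfer_bundle L a\<^sub>0 P Q0) (transfer_bundle L a\<^sub>0 P Q1)"
    using P.tr.K_induced_class_std[OF ptB.magnetic[OF F(1)] ptB.magnetic[OF F(2)]] .
  have iso: "P.A.cls (pb P') = P.A.cls (transfer_bundle L a\<^sub>0 P Q)"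
    if F: "B.mag F" and P': "A.mag P'" "bundle_iso L (transfer_bundle L a\<^sub>0 X F) P'"
      and Q: "P.B.mag Q" "bundle_iso L\<^sub>0 (pb F) Q" for F P' Q :: "('g, 'x) std_bundle"
  proof -
    have equiv: "Xact P g y = Xact X g y" for g y by (simp add: subspace_sel)
    note m = tr.magnetic[OF F] ptA.magnetic[OF P'(1)] P.tr.magnetic[OF Q(1)] ptB.magnetic[OF F]
    have m': "P.A.mag (transfer_bundle L a\<^sub>0 P (pb F))" "P.A.mag (pb (transfer_bundle L a\<^sub>0 X F))"
      by (rule magnetic_bundle_transfer[OF m(4) P.space],
          rule magnetic_bundle_pullback[OF m(1) top P.space inclusion_continuous equiv])
    have "P.A.cls (pb P') = P.A.cls (pb (transfer_bundle L a\<^sub>0 X F))"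
      using A.pullback_bundle_iso[OF m(1) P'(2) P.space inclusion_continuous equiv] m(2) m'
      by (metis P.A.iso_class_eq_iff)
    also have "\<dots> = P.A.cls (transfer_bundle L a\<^sub>0 P (pb F))"
      using transfer_bundle_pullback[OF F space P.space inclusion_continuous equiv] m'
      by (metis P.A.iso_class_eq_iff)
    also have "\<dots> = P.A.cls (transfer_bundle L a\<^sub>0 P Q)"
      using P.transfer_bundle_iso[OF m(4) Q(2)] m m' by (simp add: P.A.iso_class_eq_iff)
    finally show ?thesis .
  qed
  have "P.A.K (pb P0) (pb P1) = P.A.K (transfer_bundle L a\<^sub>0 P Q0) (transfer_bundle L a\<^sub>0 P Q1)"
    by (rule P.A.K_class_cong)
      (use R Q iso[OF F(1) R(1,3) Q(1,3)] iso[OF F(2) R(2,4) Q(2,4)] in \<open>simp_all add: ptA.magnetic P.tr.magnetic\<close>)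
  then show ?thesis
    using F R Q by (simp add: tr.K_induced_class ptB.K_induced_class)
qed

abbreviation "RA \<equiv> reduced_twisted_K_group inc L X x\<^sub>0"
abbreviation "RB \<equiv> reduced_twisted_K_group inc L\<^sub>0 X x\<^sub>0"

lemma reduced_eq:
  "RA = A.TK\<lparr>carrier := kernel A.TK P.A.TK restrA\<rparr>" "RB = B.TK\<lparr>carrier := kernel B.TK P.B.TK restrB\<rparr>"
  by (simp_all add: reduced_twisted_K_group_def Let_def)

lemma reduced_sel:
  "a \<in> carrier RA \<longleftrightarrow> a \<in> carrier A.TK \<and> restrA a = \<one>\<^bsub>P.A.TK\<^esub>"
  "b \<in> carrier RB \<longleftrightarrow> b \<in> carrier B.TK \<and> restrB b = \<one>\<^bsub>P.B.TK\<^esub>"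
  "x \<otimes>\<^bsub>RA\<^esub> y = x \<otimes>\<^bsub>A.KG\<^esub> y" "u \<otimes>\<^bsub>RB\<^esub> v = u \<otimes>\<^bsub>B.KG\<^esub> v"
  "\<one>\<^bsub>RA\<^esub> = \<one>\<^bsub>A.KG\<^esub>" "\<one>\<^bsub>RB\<^esub> = \<one>\<^bsub>B.KG\<^esub>"
  by (auto simp: reduced_eq kernel_def A.twisted_K_group_sel B.twisted_K_group_sel)

lemma group_reduced: "group RA" "group RB"
  unfolding reduced_eq
  by (intro group.subgroup_imp_group A.group_twisted_K_group B.group_twisted_K_group
      group_hom.subgroup_kernel restrA_hom restrB_hom)+

lemma reduced_subset: "carrier RA \<subseteq> carrier A.KG" "carrier RB \<subseteq> carrier B.KG"
  using A.twisted_K_group_subset B.twisted_K_group_subset by (auto simp: reduced_sel)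

lemma res_reduced: "res \<in> hom RA RB"
proof (rule homI)
  fix a assume a: "a \<in> carrier RA"
  have "restrB (res a) = P.res \<one>\<^bsub>P.A.TK\<^esub>"
    using a reduced_subset(1) by (auto simp: restr_res reduced_sel)
  also have "\<dots> = \<one>\<^bsub>P.B.TK\<^esub>"
    by (rule hom_one[OF P.res_hom P.A.group_twisted_K_group P.B.group_twisted_K_group])
  finally show "res a \<in> carrier RB"
    using a hom_in_carrier[OF res_hom] by (simp add: reduced_sel)
  fix b assume "b \<in> carrier RA"
  then show "res (a \<otimes>\<^bsub>RA\<^esub> b) = res a \<otimes>\<^bsub>RB\<^esub> res b"
    using a reduced_subset(1) hom_mult[OF res.K_induced_hom] by (auto simp: reduced_sel(3,4))
qed

lemma tr_reduced: "tr \<in> hom RB RA"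
proof (rule homI)
  fix a assume a: "a \<in> carrier RB"
  have "restrA (tr a) = P.tr \<one>\<^bsub>P.B.TK\<^esub>"
    using a reduced_subset(2) by (auto simp: restr_tr reduced_sel)
  also have "\<dots> = \<one>\<^bsub>P.A.TK\<^esub>"
    by (rule hom_one[OF P.tr_hom P.B.group_twisted_K_group P.A.group_twisted_K_group])
  finally show "tr a \<in> carrier RA"
    using a hom_in_carrier[OF tr_hom] by (simp add: reduced_sel)
  fix b assume "b \<in> carrier RB"
  then show "tr (a \<otimes>\<^bsub>RB\<^esub> b) = tr a \<otimes>\<^bsub>RA\<^esub> tr b"
    using a reduced_subset(2) hom_mult[OF tr.K_induced_hom] by (auto simp: reduced_sel(3,4))
qed

abbreviation "FB \<equiv> fixed_subgroup RB con"

lemma fixed_sel: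
  "b \<in> carrier FB \<longleftrightarrow> b \<in> carrier RB \<and> con b = b" "x \<otimes>\<^bsub>FB\<^esub> y = x \<otimes>\<^bsub>RB\<^esub> y"
  by (auto simp: fixed_subgroup_def)

lemma group_fixed: "group FB"
proof -
  interpret RB: group RB by (rule group_reduced(2))
  interpret con: group_hom B.KG B.KG con
    by unfold_locales (rule con_hom)
  have inv_eq: "inv\<^bsub>RB\<^esub> b = inv\<^bsub>B.KG\<^esub> b" if "b \<in> carrier RB" for b
    using RB.l_inv[OF that] RB.inv_closed[OF that] reduced_subset(2) that
    by (intro B.KG.inv_equality[symmetric]) (auto simp: reduced_sel(4,6))
  have "subgroup {b \<in> carrier RB. con b = b} RB"
  proof (rule RB.subgroupI)
    show "{b \<in> carrier RB. con b = b} \<noteq> {}"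
      using RB.one_closed con.hom_one by (auto simp: reduced_sel(6))
    show "inv\<^bsub>RB\<^esub> b \<in> {b \<in> carrier RB. con b = b}" if "b \<in> {b \<in> carrier RB. con b = b}" for b
      using that reduced_subset(2) RB.inv_closed[of b] con.hom_inv[of b] by (auto simp: inv_eq)
    show "b \<otimes>\<^bsub>RB\<^esub> c \<in> {b \<in> carrier RB. con b = b}"
      if "b \<in> {b \<in> carrier RB. con b = b}" "c \<in> {b \<in> carrier RB. con b = b}" for b c
    proof -
      have "b \<in> carrier B.KG" "c \<in> carrier B.KG"
        using that reduced_subset(2) by blast+
      then have "con (b \<otimes>\<^bsub>RB\<^esub> c) = b \<otimes>\<^bsub>RB\<^esub> c"
        using that by (simp add: reduced_sel(4))
      then show ?thesis using that by simp
    qed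
  qed auto
  then show ?thesis
    unfolding fixed_subgroup_def by (rule RB.subgroup_imp_group)
qed

lemma res_fixed_hom: "res \<in> hom RA FB"
proof (rule homI)
  fix a assume a: "a \<in> carrier RA"
  show "res a \<in> carrier FB"
    using hom_in_carrier[OF res_reduced a] con_res[OF subsetD[OF reduced_subset(1) a]]
    by (simp add: fixed_sel)
  fix b assume "b \<in> carrier RA"
  with a show "res (a \<otimes>\<^bsub>RA\<^esub> b) = res a \<otimes>\<^bsub>FB\<^esub> res b"
    by (simp add: fixed_sel(2) hom_mult[OF res_reduced])
qed

theorem restriction_rational_iso:
  "group_hom RA FB res"
  "tensor_map FB rat_group res \<in> iso (RA \<otimes>\<^sub>\<int> rat_group) (FB \<otimes>\<^sub>\<int> rat_group)"
proof -
  show "group_hom RA FB res"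
    using group_reduced(1) group_fixed res_fixed_hom by (simp add: group_hom_def group_hom_axioms_def)
  show "tensor_map FB rat_group res \<in> iso (RA \<otimes>\<^sub>\<int> rat_group) (FB \<otimes>\<^sub>\<int> rat_group)"
  proof (rule tensor_map_rat_iso[OF group_reduced(1) group_fixed res_fixed_hom])
    show "tr \<in> hom FB RA"
      using tr_reduced by (auto simp: hom_def fixed_sel)
    show "tr (res a) = a \<otimes>\<^bsub>RA\<^esub> a" if "a \<in> carrier RA" for a
      using that reduced_subset(1) tr_res by (auto simp: reduced_sel(3))
    show "res (tr b) = b \<otimes>\<^bsub>FB\<^esub> b" if "b \<in> carrier FB" for b
      using that reduced_subset(2) res_tr by (auto simp: fixed_sel reduced_sel(4))
  qed
qed

end

section \<open>The pointed spaces that define the K-groups in negative degrees\<close>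

lemma topspace_collapse_topology:
  "topspace (collapse_topology T Y) = insert None (Some ` (topspace T - Y))"
proof
  have "openin (collapse_topology T Y) (topspace (collapse_topology T Y))"
    by (rule openin_topspace)
  then show "topspace (collapse_topology T Y) \<subseteq> insert None (Some ` (topspace T - Y))"
    unfolding openin_collapse_topology by (rule conjunct1)
  have "{x \<in> topspace T. collapse Y x \<in> insert None (Some ` (topspace T - Y))} = topspace T"
    by (auto simp: collapse_def)
  then have "openin (collapse_topology T Y) (insert None (Some ` (topspace T - Y)))"
    by (simp add: openin_collapse_topology)
  then show "insert None (Some ` (topspace T - Y)) \<subseteq> topspace (collapse_topology T Y)"
    by (rule openin_subset)
qed

text \<open>
  The product of \<open>G\<close> with a quotient map need not be a quotient map. Near the base point,
  compactness of \<open>G\<close> helps: the points whose whole orbit lies in a given open set form an open set.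
\<close>

lemma G_space_quotient:
  assumes X: "G_space G X" and G: "topological_group G" "compact_space (Gtop G)"
    and Y: "closedin (Xtop X) Y" "\<And>g y. g \<in> carrier G \<Longrightarrow> y \<in> Y \<Longrightarrow> Xact X g y \<in> Y"
  shows "G_space G (quotient_space X Y)"
proof -
  define T where "T = Xtop X"
  define Q where "Q = collapse_topology T Y"
  define act where "act z = map_option (Xact X (fst z)) (snd z)" for z
  note S = G_spaceD[OF X G(1)] and topG = topological_groupD(3)[OF G(1)]
  interpret group G by (rule topological_groupD(1)[OF G(1)])
  have YT: "Y \<subseteq> topspace T" using closedin_subset[OF Y(1)] by (simp add: T_def)
  have notin: "Xact X g x \<notin> Y" if "g \<in> carrier G" "x \<in> topspace T" "x \<notin> Y" for g x
  proof
    assume "Xact X g x \<in> Y"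
    then have "Xact X (inv\<^bsub>G\<^esub> g) (Xact X g x) \<in> Y" by (rule Y(2)[OF inv_closed[OF that(1)]])
    moreover have "Xact X (inv\<^bsub>G\<^esub> g) (Xact X g x) = x"
      using that by (simp add: T_def S(2) flip: S(3))
    ultimately show False using that by simp
  qed
  have act_in: "act z \<in> topspace Q" if "z \<in> topspace (prod_topology (Gtop G) Q)" for z
    using that notin S(4) by (auto simp: act_def Q_def topspace_collapse_topology topG T_def)
  have opQ: "openin Q (Some ` R)" if "openin T R" "R \<inter> Y = {}" for R
  proof -
    have "{x \<in> topspace T. collapse Y x \<in> Some ` R} = R"
      using that openin_subset[OF that(1)] by (auto simp: collapse_def split: if_splits)
    then show ?thesis
      using that openin_subset[OF that(1)] by (auto simp: Q_def openin_collapse_topology)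
  qed
  have opQ': "openin Q (insert None (Some ` (R - Y)))" if "openin T R" "Y \<subseteq> R" for R
  proof -
    have "{x \<in> topspace T. collapse Y x \<in> insert None (Some ` (R - Y))} = R"
      using that openin_subset[OF that(1)] by (auto simp: collapse_def split: if_splits)
    then show ?thesis
      using that openin_subset[OF that(1)] by (auto simp: Q_def openin_collapse_topology)
  qed
  have "continuous_map (prod_topology (Gtop G) Q) Q act"
    unfolding continuous_map_def
  proof (intro conjI allI impI)
    show "act \<in> topspace (prod_topology (Gtop G) Q) \<rightarrow> topspace Q"
      using act_in by blast
    fix U assume U: "openin Q U"
    define W where "W = {x \<in> topspace T. collapse Y x \<in> U}"
    have W: "openin T W" using U by (simp add: W_def Q_def openin_collapse_topology)
    define O' where "O' = {z \<in> topspace (prod_topology (Gtop G) T). Xact X (fst z) (snd z) \<in> W}"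
    have O': "openin (prod_topology (Gtop G) T) O'"
      unfolding O'_def
    proof (rule openin_continuous_map_preimage[OF _ W])
      show "continuous_map (prod_topology (Gtop G) T) T (\<lambda>z. Xact X (fst z) (snd z))"
        unfolding T_def by (intro S(1) continuous_map_fst continuous_map_snd)
    qed
    have inU: "Some (Xact X g x) \<in> U" if "(g, x) \<in> O'" "x \<notin> Y" for g x
      using that notin[of g x] by (auto simp: O'_def W_def collapse_def topG)
    show "openin (prod_topology (Gtop G) Q) {z \<in> topspace (prod_topology (Gtop G) Q). act z \<in> U}"
      (is "openin _ ?N")
    proof (subst openin_subopen, intro ballI)
      fix z assume z: "z \<in> ?N"
      then have zG: "fst z \<in> carrier G" and zQ: "snd z \<in> topspace Q" and zU: "act z \<in> U"
        by (auto simp: topG)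
      show "\<exists>D. openin (prod_topology (Gtop G) Q) D \<and> z \<in> D \<and> D \<subseteq> ?N"
      proof (cases "snd z")
        case None
        then have NU: "None \<in> U" using zU by (simp add: act_def)
        \<comment> \<open>\<open>C\<close> is closed because projections along compact spaces are closed maps.\<close>
        define C where "C = snd ` (topspace (prod_topology (Gtop G) T) - O')"
        have "closedin T C"
          using closed_map_snd[OF G(2), of T] O' unfolding C_def closed_map_def by blast
        then have op: "openin T (topspace T - C)" by blast
        have "Y \<subseteq> topspace T - C"
          using YT Y(2) NU by (auto simp: C_def O'_def W_def collapse_def topG)
        note D = opQ'[OF op this]
        have "(carrier G) \<times> insert None (Some ` (topspace T - C - Y)) \<subseteq> ?N"
        proof (intro subsetI CollectI conjI)
          fix w assume w: "w \<in> (carrier G) \<times> insert None (Some ` (topspace T - C - Y))"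
          then show "w \<in> topspace (prod_topology (Gtop G) Q)"
            using openin_subset[OF D] by (auto simp: topG)
          have "(g, x) \<in> O'" if "g \<in> carrier G" "x \<in> topspace T" "x \<notin> C" for g x
            using that by (force simp: C_def topG)
          with w show "act w \<in> U"
            using NU inU by (auto simp: act_def)
        qed
        moreover have "openin (prod_topology (Gtop G) Q) (carrier G \<times> insert None (Some ` (topspace T - C - Y)))"
          using D openin_topspace[of "Gtop G"] by (simp add: openin_prod_Times_iff topG)
        ultimately show ?thesis
          using zG None by (intro exI conjI) (auto simp: mem_Times_iff)
      next
        case (Some x)
        then have x: "x \<in> topspace T" "x \<notin> Y"
          using zQ by (auto simp: Q_def topspace_collapse_topology)
        have "Some (Xact X (fst z) x) \<in> U" using zU Some by (simp add: act_def)
        then have "(fst z, x) \<in> O'"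
          using x zG notin S(4) by (auto simp: O'_def W_def collapse_def topG T_def)
        moreover have "openin T (topspace T - Y)" using Y(1) by (auto simp: T_def)
        then have "openin (prod_topology (Gtop G) T) (O' \<inter> (carrier G \<times> (topspace T - Y)))"
          using O' openin_topspace[of "Gtop G"] by (intro openin_Int) (auto simp: openin_prod_Times_iff topG)
        ultimately obtain A R where AR: "openin (Gtop G) A" "openin T R" "fst z \<in> A" "x \<in> R"
          "A \<times> R \<subseteq> O' \<inter> (carrier G \<times> (topspace T - Y))"
          using zG x unfolding openin_prod_topology_alt by (metis Int_iff Diff_iff mem_Sigma_iff)
        have RY: "R \<inter> Y = {}" using AR(3,5) by auto
        note D = opQ[OF AR(2) RY]
        have "Some (Xact X g y) \<in> U" if "g \<in> A" "y \<in> R" for g y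
          using AR(5) that by (intro inU) auto
        then have "A \<times> Some ` R \<subseteq> ?N"
          using openin_subset[OF D] openin_subset[OF AR(1)] by (auto simp: act_def topG)
        moreover have "openin (prod_topology (Gtop G) Q) (A \<times> Some ` R)"
          using D AR(1) by (simp add: openin_prod_Times_iff)
        ultimately show ?thesis
          using AR(3,4) Some by (intro exI conjI) (auto simp: mem_Times_iff)
      qed
    qed
  qed
  from this[unfolded act_def[abs_def]] show ?thesis
    using X YT unfolding G_space_def
    by (auto simp: quotient_space_def Q_def T_def case_prod_beta' topspace_collapse_topology
        option.map_comp)
qed

lemma G_space_times_ball:
  assumes X: "G_space G X" and G: "topological_group G"
  shows "G_space G (times_ball X q)"
proof -
  let ?B = "subtopology (Euclidean_space q) (unit_ball q)"
  let ?D = "prod_topology (Gtop G) (prod_topology (Xtop X) ?B)"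
  have "continuous_map ?D (prod_topology (Xtop X) ?B)
      (\<lambda>z. (Xact X (fst z) (fst (snd z)), snd (snd z)))"
    by (intro continuous_map_pairedI G_spaceD(1)[OF X G] continuous_map_fst
        continuous_map_fst_app[OF continuous_map_snd] continuous_map_snd_app[OF continuous_map_snd])
  then show ?thesis
    using X by (auto simp: G_space_def times_ball_def case_prod_beta')
qed

lemma closedin_unit_sphere:
  "closedin (subtopology (Euclidean_space q) (unit_ball q)) (unit_sphere q)"
proof -
  let ?B = "subtopology (Euclidean_space q) (unit_ball q)"
  have "continuous_map ?B euclideanreal (\<lambda>v. \<Sum>i<q. (v i)\<^sup>2)"
    unfolding Euclidean_space_def
    by (intro continuous_map_sum continuous_map_real_pow continuous_map_from_subtopology
        continuous_map_product_projection) auto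
  then have "closedin ?B {v \<in> topspace ?B. (\<Sum>i<q. (v i)\<^sup>2) \<in> {1}}"
    by (rule closedin_continuous_map_preimage) auto
  moreover have "{v \<in> topspace ?B. (\<Sum>i<q. (v i)\<^sup>2) \<in> {1}} = unit_sphere q"
    by (auto simp: unit_sphere_def unit_ball_def)
  ultimately show ?thesis by simp
qed

lemma G_space_ball_mod_sphere:
  assumes X: "G_space G X" and G: "topological_group G" "compact_space (Gtop G)"
  shows "G_space G (ball_mod_sphere X q)"
  unfolding ball_mod_sphere_def
proof (rule G_space_quotient[OF G_space_times_ball[OF X G(1)] G])
  show "closedin (Xtop (times_ball X q)) (topspace (Xtop X) \<times> unit_sphere q)"
    using closedin_unit_sphere by (auto simp: times_ball_def closedin_prod_Times_iff)
  show "Xact (times_ball X q) g y \<in> topspace (Xtop X) \<times> unit_sphere q"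
    if "g \<in> carrier G" "y \<in> topspace (Xtop X) \<times> unit_sphere q" for g y
    using that G_spaceD(4)[OF X G(1)] by (auto simp: times_ball_def)
qed

lemma G_space_act_via:
  assumes X: "G_space G X" and G: "topological_group G" and H: "topological_group H"
    and \<pi>: "\<pi> \<in> hom H G" "continuous_map (Gtop H) (Gtop G) \<pi>"
  shows "G_space H (act_via \<pi> X)"
proof -
  have "continuous_map (prod_topology (Gtop H) (Xtop X)) (Xtop X) (\<lambda>z. Xact X (\<pi> (fst z)) (snd z))"
    by (intro G_spaceD(1)[OF X G] continuous_map_snd continuous_map_compose_app[OF continuous_map_fst \<pi>(2)])
  moreover have "\<pi> \<one>\<^bsub>H\<^esub> = \<one>\<^bsub>G\<^esub>"
    by (rule hom_one[OF \<pi>(1) topological_groupD(1)[OF H] topological_groupD(1)[OF G]])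
  moreover have "\<pi> h \<in> carrier G" if "h \<in> carrier H" for h
    using \<pi>(1) that by (auto simp: hom_def)
  ultimately show ?thesis
    using X \<pi>(1) by (auto simp: G_space_def act_via_def case_prod_beta' hom_mult)
qed

section \<open>Magnetic central extensions\<close>

lemma magnetic_extension:
  assumes G: "magnetic_group G" and ext: "magnetic_central_extension inc Gt \<pi> G"
    and a: "a\<^sub>0 \<in> carrier Gt - carrier (kernel_group Gt)"
  shows "magnetic Gt a\<^sub>0"
proof
  have \<pi>: "\<pi> \<in> hom Gt G" "continuous_map (Gtop Gt) (Gtop G) \<pi>"
    and deg: "\<And>h. h \<in> carrier Gt \<Longrightarrow> Gdeg Gt h = Gdeg G (\<pi> h)"
    using ext by (auto simp: magnetic_central_extension_def epi_def)
  have G': "Gdeg G \<in> hom G (integer_mod_group 2)"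
    "continuous_map (Gtop G) (discrete_topology (carrier (integer_mod_group 2))) (Gdeg G)"
    using G by (auto simp: magnetic_group_def epi_def)
  show top: "topological_group Gt"
    using ext by (auto simp: magnetic_central_extension_def compact_Lie_group_def)
  show "Gdeg Gt \<in> hom Gt (integer_mod_group 2)"
  proof (rule homI)
    fix x y assume x: "x \<in> carrier Gt" and y: "y \<in> carrier Gt"
    show "Gdeg Gt x \<in> carrier (integer_mod_group 2)"
      using x hom_in_carrier[OF G'(1) hom_in_carrier[OF \<pi>(1) x]] by (simp add: deg)
    have xy: "x \<otimes>\<^bsub>Gt\<^esub> y \<in> carrier Gt"
      by (rule monoid.m_closed[OF topological_groupD(2)[OF top] x y])
    show "Gdeg Gt (x \<otimes>\<^bsub>Gt\<^esub> y) = Gdeg Gt x \<otimes>\<^bsub>integer_mod_group 2\<^esub> Gdeg Gt y"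
      unfolding deg[OF x] deg[OF y] deg[OF xy] hom_mult[OF \<pi>(1) x y]
      by (rule hom_mult[OF G'(1) hom_in_carrier[OF \<pi>(1) x] hom_in_carrier[OF \<pi>(1) y]])
  qed
  show "continuous_map (Gtop Gt) (discrete_topology (carrier (integer_mod_group 2))) (Gdeg Gt)"
    by (rule continuous_map_eq[OF continuous_map_compose_app[OF \<pi>(2) G'(2)]])
      (simp add: deg topological_groupD(3)[OF top])
  show "a\<^sub>0 \<in> carrier Gt" "Gdeg Gt a\<^sub>0 \<noteq> 0"
    using a by (auto simp: kernel_group_def kernel_def Let_def)
qed

theorem mainTheorem2:
  fixes G :: "'g graded_group" and Gt :: "'h graded_group"
    and X :: "('g, 'x) gspace"
    and inc :: "complex \<Rightarrow> 'h" and \<pi> :: "'h \<Rightarrow> 'g" and a\<^sub>0 :: 'h and n :: int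
  assumes "compact_Lie_group G" and "magnetic_group G"
    and "G_space G X" and "compact_space (Xtop X)"
    and "magnetic_central_extension inc Gt \<pi> G"
    and "a\<^sub>0 \<in> carrier Gt - carrier (kernel_group Gt)"
  shows "group_hom
           (twisted_K inc Gt n (act_via \<pi> X))
           (fixed_subgroup (twisted_K inc (kernel_group Gt) n (act_via \<pi> X))
              (conjugation Gt a\<^sub>0 n (act_via \<pi> X)))
           (restriction Gt n (act_via \<pi> X)) \<and>
         tensor_map
           (fixed_subgroup (twisted_K inc (kernel_group Gt) n (act_via \<pi> X))
              (conjugation Gt a\<^sub>0 n (act_via \<pi> X)))
           rat_group (restriction Gt n (act_via \<pi> X))
         \<in> iso
             (twisted_K inc Gt n (act_via \<pi> X) \<otimes>\<^sub>\<int> rat_group)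
             (fixed_subgroup (twisted_K inc (kernel_group Gt) n (act_via \<pi> X))
                (conjugation Gt a\<^sub>0 n (act_via \<pi> X)) \<otimes>\<^sub>\<int> rat_group)"
proof -
  interpret magnetic Gt a\<^sub>0
    by (rule magnetic_extension[OF assms(2,5,6)])
  define Z where "Z = ball_mod_sphere (act_via \<pi> X) (degree_shift n)"
  have ext: "compact_space (Gtop Gt)" "\<pi> \<in> hom Gt G" "continuous_map (Gtop Gt) (Gtop G) \<pi>"
    "inc \<in> hom sign_group Gt" "inc ` carrier sign_group = kernel Gt G \<pi>"
    "\<And>a h. a \<in> carrier sign_group \<Longrightarrow> h \<in> carrier Gt \<Longrightarrow> inc a \<otimes>\<^bsub>Gt\<^esub> h = h \<otimes>\<^bsub>Gt\<^esub> inc a"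
    "\<And>h. h \<in> carrier Gt \<Longrightarrow> Gdeg Gt h = Gdeg G (\<pi> h)"
    using assms(5) by (auto simp: magnetic_central_extension_def compact_Lie_group_def epi_def mon_def)
  have G: "topological_group G"
    using assms(2) by (simp add: magnetic_group_def)
  have "Gdeg G \<in> hom G (integer_mod_group 2)"
    using assms(2) by (simp add: magnetic_group_def epi_def)
  then have deg_one: "Gdeg G \<one>\<^bsub>G\<^esub> = 0"
    using hom_one[OF _ topological_groupD(1)[OF G] group_integer_mod_group] by fastforce
  have inc: "inc a \<in> carrier Gt" "\<pi> (inc a) = \<one>\<^bsub>G\<^esub>" if "a \<in> carrier sign_group" for a
    using ext(5) that by (auto simp: kernel_def)
  \<comment> \<open>The signs lie over the unit of \<open>G\<close>.\<close>
  have trivial: "Xact Z (inc a) z = z" if "a \<in> carrier sign_group" "z \<in> topspace (Xtop Z)" for a z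
    using that assms(3) inc(2)[OF that(1)]
    by (auto simp: Z_def ball_mod_sphere_def quotient_space_def times_ball_def act_via_def
        topspace_collapse_topology G_space_def)
  interpret twisted_magnetic_pointed Gt a\<^sub>0 Z inc None
  proof
    show "G_space Gt Z"
      unfolding Z_def
      by (rule G_space_ball_mod_sphere[OF G_space_act_via[OF assms(3) G top ext(2,3)] top ext(1)])
  qed (use inc ext(6) a\<^sub>0(1) trivial in \<open>auto simp: kernel_group_sel ext(7) deg_one\<close>,
      simp_all add: Z_def ball_mod_sphere_def quotient_space_def)
  show ?thesis
    using restriction_rational_iso
    by (simp add: twisted_K_def restriction_def conjugation_def Let_def flip: Z_def)
qed

end
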